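(* Let $\alpha>0$, let $\phi_0=(u_0;v_0)\in\mathcal H$, let $f_t$, $t\ge0$, be a continuous predictable process in $H$, and let $M_t$, $t\ge 0$, be a continuous $H$-valued martingale with $M_0=0$ and covariation operator $Q_t$, such that $$E\left\{\int_0^T\|f_t\|^2\,dt+\int_0^T\operatorname{Tr}Q_t\,dt\right\}<\infty\quad\text{for every }T>0 .$$ Let $\phi_t=(u_t;v_t)$ be the continuous $\mathcal H$-valued solution of $$u_t=u_0+\int_0^t v_s\,ds,\qquad v_t=v_0+\int_0^t Au_s\,ds-2\alpha\int_0^t v_s\,ds+\int_0^t f_s\,ds+M_t,\qquad t\ge0 .$$ If $$0<\lambda\le\lambda_0:=\min\left\{\frac{\alpha}{2},\frac{\eta_1}{4\alpha}\right\},$$ then there exists $\alpha_1\in(0,\lambda)$ such that for all $t\ge0$ $$E\,\mathbf e^\lambda(\phi_t)\le\mathbf e^\lambda(\phi_0)e^{-\alpha_1t}+\int_0^te^{-\alpha_1(t-s)}E\left\{\frac{2}{\alpha_1}\|f_s\|^2+\operatorname{Tr}Q_s\right\}ds .$$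
   Context: $\mathcal D\subset\mathbf R^d$ is a bounded domain with $C^2$ boundary. $H=L^2(\mathcal D)$ has inner product $(\cdot,\cdot)$ and norm $\|\cdot\|$. $(\Omega,\mathcal F,P)$ is a complete probability space with a filtration $\mathcal F_t$; all processes are relative to this filtration. $A\varphi(x)=\sum_{i,j=1}^d\partial_{x_i}[a^{ij}(x)\,\partial_{x_j}\varphi(x)]-b(x)\varphi(x)$ with domain $H^2(\mathcal D)\cap H_0^1(\mathcal D)$, where $a^{ij}=a^{ji}$ and $b$ are smooth and, for some constants $a_1\ge a_0>0$, $a_0(1+|\xi|^2)\le\sum_{i,j}a^{ij}(x)\xi_i\xi_j+b(x)\le a_1(1+|\xi|^2)$ for all $x\in\mathcal D$, $\xi\in\mathbf R^d$. Thus $-A$ is self-adjoint and strictly positive in $H$; $B=\sqrt{-A}$ has domain $H_0^1=H^1_0(\mathcal D)$, and one sets $\|u\|_1=\|Bu\|$ for $u\in H_0^1$ (a norm equivalent to the usual one). $A$ is extended as an operator from $H_0^1$ to its dual $H^{-1}$. The smallest eigenvalue of $-A$ is $\eta_1=\inf_{g\in H_0^1,\,g\ne0}\|g\|_1^2/\|g\|^2>0$. $\mathcal H=H_0^1\times H$ with norm $\{\|u\|_1^2+\|v\|^2\}^{1/2}$. For $\lambda>0$ the pseudo energy function is $\mathbf e^\lambda(u;v)=\|Bu\|^2+\|v+\lambda u\|^2$. An $H$-valued continuous martingale $M_t$ has covariation operator $Q_t$ if $\langle (M_\cdot,g),(M_\cdot,h)\rangle_t=\int_0^t(Q_sg,h)\,ds$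 for all $g,h\in H$; $\operatorname{Tr}$ is the trace in $H$. A solution is an adapted $\mathcal H$-valued process satisfying the integral equations a.s. in the distributional sense (the second one in $H^{-1}$). *)

theory Defs
  imports "HOL-Probability.Probability"
begin

section \<open>The Hilbert space of square-integrable functions\<close>

text \<open>
  The type \<open>'a L2\<close> is the real Hilbert space of square-integrable functions on the whole
  Euclidean space, modulo equality almost everywhere. Borel representatives suffice, since every
  Lebesgue measurable function agrees almost everywhere with a Borel one.
\<close>

definition square_integrable :: "('a::euclidean_space \<Rightarrow> real) \<Rightarrow> bool" where
  "square_integrable f \<longleftrightarrow> f \<in> borel_measurable lborel \<and> integrable lborel (\<lambda>x. (f x)\<^sup>2)"

definition l2_eq :: "('a::euclidean_space \<Rightarrow> real) \<Rightarrow> ('a \<Rightarrow> real) \<Rightarrow> bool" where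
  "l2_eq f g \<longleftrightarrow> square_integrable f \<and> square_integrable g \<and> (AE x in lborel. f x = g x)"

lemma square_integrable_zero: "square_integrable (\<lambda>x. 0)"
  by (simp add: square_integrable_def)

lemma square_integrable_scale: "square_integrable f \<Longrightarrow> square_integrable (\<lambda>x. c * f x)"
  by (auto simp: square_integrable_def power_mult_distrib)

lemma square_integrable_mult_integrable:
  assumes "square_integrable f" "square_integrable g"
  shows "integrable lborel (\<lambda>x. f x * g x)"
proof (rule Bochner_Integration.integrable_bound)
  show "integrable lborel (\<lambda>x. (f x)\<^sup>2 + (g x)\<^sup>2)"
    using assms by (auto simp: square_integrable_def)
  show "(\<lambda>x. f x * g x) \<in> borel_measurable lborel"
    using assms by (auto simp: square_integrable_def)
  have "\<bar>s * t\<bar> \<le> s\<^sup>2 + t\<^sup>2" for s t :: real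
  proof -
    have "2 * (\<bar>s\<bar> * \<bar>t\<bar>) \<le> \<bar>s\<bar>\<^sup>2 + \<bar>t\<bar>\<^sup>2"
      using sum_squares_bound[of "\<bar>s\<bar>" "\<bar>t\<bar>"] by simp
    moreover have "0 \<le> \<bar>s\<bar> * \<bar>t\<bar>" by simp
    ultimately show ?thesis by (simp only: abs_mult power2_abs)
  qed
  then show "AE x in lborel. norm (f x * g x) \<le> norm ((f x)\<^sup>2 + (g x)\<^sup>2)"
    by simp
qed

lemma square_integrable_add:
  assumes "square_integrable f" "square_integrable g"
  shows "square_integrable (\<lambda>x. f x + g x)"
  using assms square_integrable_mult_integrable[OF assms]
  by (auto simp: square_integrable_def power2_sum mult.assoc)

lemma square_integrable_minus: "square_integrable f \<Longrightarrow> square_integrable (\<lambda>x. - f x)"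
  by (auto simp: square_integrable_def)

lemma square_integrable_diff:
  "square_integrable f \<Longrightarrow> square_integrable g \<Longrightarrow> square_integrable (\<lambda>x. f x - g x)"
  using square_integrable_add[of f "\<lambda>x. - g x"] square_integrable_minus[of g] by simp

quotient_type (overloaded) 'a L2 = "'a::euclidean_space \<Rightarrow> real" / partial: l2_eq
  morphisms rep_L2 to_L2
proof (rule part_equivpI)
  show "\<exists>f::'a \<Rightarrow> real. l2_eq f f"
    by (rule exI[of _ "\<lambda>x. 0"]) (simp add: l2_eq_def square_integrable_zero)
  show "symp (l2_eq :: ('a \<Rightarrow> real) \<Rightarrow> _)"
    by (auto simp: symp_def l2_eq_def)
  show "transp (l2_eq :: ('a \<Rightarrow> real) \<Rightarrow> _)"
    unfolding transp_def l2_eq_def by (auto elim: AE_mp)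
qed

lemma l2_eq_rep: "l2_eq (rep_L2 f) (rep_L2 f)"
  by (rule Quotient_rep_reflp[OF Quotient_L2])

lemma square_integrable_rep [simp]: "square_integrable (rep_L2 f)"
  using l2_eq_rep[of f] by (simp add: l2_eq_def)

lemma to_L2_rep [simp]: "to_L2 (rep_L2 f) = f"
  by (rule Quotient_abs_rep[OF Quotient_L2])

lemma rep_to_L2:
  assumes "square_integrable f"
  shows "AE x in lborel. rep_L2 (to_L2 f) x = f x"
  using Quotient_rep_abs[OF Quotient_L2, of f] assms by (simp add: l2_eq_def)

instantiation L2 :: (euclidean_space) real_vector
begin

lift_definition zero_L2 :: "'a L2" is "\<lambda>x. 0"
  by (simp add: l2_eq_def square_integrable_zero)
lift_definition plus_L2 :: "'a L2 \<Rightarrow> 'a L2 \<Rightarrow> 'a L2" is "\<lambda>f g x. f x + g x"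
  unfolding l2_eq_def by (auto intro!: square_integrable_add)
lift_definition minus_L2 :: "'a L2 \<Rightarrow> 'a L2 \<Rightarrow> 'a L2" is "\<lambda>f g x. f x - g x"
  unfolding l2_eq_def by (auto intro!: square_integrable_diff)
lift_definition uminus_L2 :: "'a L2 \<Rightarrow> 'a L2" is "\<lambda>f x. - f x"
  unfolding l2_eq_def by (auto intro!: square_integrable_minus)
lift_definition scaleR_L2 :: "real \<Rightarrow> 'a L2 \<Rightarrow> 'a L2" is "\<lambda>c f x. c * f x"
  unfolding l2_eq_def by (auto intro!: square_integrable_scale)

instance
  by standard (transfer; auto simp: l2_eq_def algebra_simps
      intro!: square_integrable_add square_integrable_minus square_integrable_diff
        square_integrable_scale square_integrable_zero)+

end

lemma l2_eq_inner:
  assumes "l2_eq f f'" "l2_eq g g'"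
  shows "(LINT x|lborel. f x * g x) = (LINT x|lborel. f' x * g' x)"
  using assms by (intro integral_cong_AE) (auto simp: l2_eq_def square_integrable_def)

instantiation L2 :: (euclidean_space) real_inner
begin

lift_definition inner_L2 :: "'a L2 \<Rightarrow> 'a L2 \<Rightarrow> real" is "\<lambda>f g. LINT x|lborel. f x * g x"
  by (rule l2_eq_inner)

definition norm_L2 :: "'a L2 \<Rightarrow> real" where "norm_L2 f = sqrt (f \<bullet> f)"
definition dist_L2 :: "'a L2 \<Rightarrow> 'a L2 \<Rightarrow> real" where "dist_L2 f g = norm (f - g)"
definition sgn_L2 :: "'a L2 \<Rightarrow> 'a L2" where "sgn_L2 f = f /\<^sub>R norm f"
definition uniformity_L2 :: "('a L2 \<times> 'a L2) filter" where
  "uniformity_L2 = (INF e\<in>{0<..}. principal {(f, g). dist f g < e})"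
definition open_L2 :: "'a L2 set \<Rightarrow> bool" where
  "open_L2 U \<longleftrightarrow> (\<forall>f\<in>U. eventually (\<lambda>(f', g). f' = f \<longrightarrow> g \<in> U) uniformity)"

instance
proof
  fix f g h :: "'a L2" and c :: real
  show "f \<bullet> g = g \<bullet> f" by transfer (simp add: mult.commute)
  show "(f + g) \<bullet> h = f \<bullet> h + g \<bullet> h"
    by transfer (auto simp: l2_eq_def distrib_right square_integrable_mult_integrable
        intro!: Bochner_Integration.integral_add)
  show "(c *\<^sub>R f) \<bullet> g = c * (f \<bullet> g)" by transfer (simp add: mult.assoc)
  show "0 \<le> f \<bullet> f" by transfer simp
  show "f \<bullet> f = 0 \<longleftrightarrow> f = 0"
  proof transfer
    fix f :: "'a \<Rightarrow> real" assume "l2_eq f f"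
    then have f: "square_integrable f" by (simp add: l2_eq_def)
    then have "(LINT x|lborel. f x * f x) = 0 \<longleftrightarrow> (AE x in lborel. f x * f x = 0)"
      by (intro integral_nonneg_eq_0_iff_AE square_integrable_mult_integrable) auto
    then show "((LINT x|lborel. f x * f x) = 0) = l2_eq f (\<lambda>x. 0)"
      using f by (simp add: l2_eq_def square_integrable_zero)
  qed
qed (auto simp: norm_L2_def dist_L2_def sgn_L2_def uniformity_L2_def open_L2_def)

end

lemma inner_to_L2:
  assumes "square_integrable f" "square_integrable g"
  shows "to_L2 f \<bullet> to_L2 g = (LINT x|lborel. f x * g x)"
  using assms by (simp add: inner_L2.abs_eq l2_eq_def)

lemma diff_to_L2:
  assumes "square_integrable f" "square_integrable g"
  shows "to_L2 f - to_L2 g = to_L2 (\<lambda>x. f x - g x)"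
  using assms by (simp add: minus_L2.abs_eq l2_eq_def)

lemma norm_to_L2:
  assumes "square_integrable f"
  shows "(norm (to_L2 f))\<^sup>2 = (LINT x|lborel. (f x)\<^sup>2)"
  unfolding power2_norm_eq_inner inner_to_L2[OF assms assms] by (simp add: power2_eq_square)

lemma norm_L2_rep: "(norm f)\<^sup>2 = (LINT x|lborel. (rep_L2 f x)\<^sup>2)"
  using norm_to_L2[of "rep_L2 f"] by simp

lemma nn_norm_L2:
  assumes "square_integrable f"
  shows "(\<integral>\<^sup>+x. ennreal ((f x)\<^sup>2) \<partial>lborel) = ennreal ((norm (to_L2 f))\<^sup>2)"
  using assms unfolding norm_to_L2[OF assms]
  by (intro nn_integral_eq_integral) (auto simp: square_integrable_def)

lemma square_integrableI_nn:
  assumes "f \<in> borel_measurable lborel" "(\<integral>\<^sup>+x. ennreal ((f x)\<^sup>2) \<partial>lborel) < \<infinity>"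
  shows "square_integrable f"
  using assms unfolding square_integrable_def
  by (auto intro!: integrableI_nonneg)

instance L2 :: (euclidean_space) complete_space
proof
  fix X :: "nat \<Rightarrow> 'a L2"
  assume X: "Cauchy X"
  have "\<forall>n. \<exists>N. \<forall>i\<ge>N. \<forall>j\<ge>N. norm (X i - X j) < (1/2)^n"
    using X unfolding Cauchy_iff by auto
  then obtain N where N: "\<And>n i j. i \<ge> N n \<Longrightarrow> j \<ge> N n \<Longrightarrow> norm (X i - X j) < (1/2)^n"
    by metis
  define k where "k n = (\<Sum>i\<le>n. N i) + n" for n
  have kN: "k n \<ge> N n" for n
    unfolding k_def by (rule trans_le_add1) (rule member_le_sum, auto)
  have smk: "strict_mono k"
    by (rule strict_monoI_Suc) (simp add: k_def)
  define f where "f n = rep_L2 (X (k n))" for n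
  have f: "square_integrable (f n)" for n by (simp add: f_def)
  have fm [measurable]: "f n \<in> borel_measurable lborel" for n
    using f[of n] by (simp add: square_integrable_def)
  have Xf: "X (k n) = to_L2 (f n)" for n by (simp add: f_def)
  have fd: "(\<integral>\<^sup>+x. ennreal ((f m x - f n x)\<^sup>2) \<partial>lborel) = ennreal ((norm (X (k m) - X (k n)))\<^sup>2)" for m n
    using nn_norm_L2[OF square_integrable_diff[OF f f], of m n]
    by (simp add: Xf diff_to_L2[OF f f])
  define d where "d n x = (f (Suc n) x - f n x)\<^sup>2" for n x
  have dm [measurable]: "d n \<in> borel_measurable lborel" for n by (simp add: d_def[abs_def])
  have d_int: "(\<integral>\<^sup>+x. ennreal (2^n * d n x) \<partial>lborel) \<le> ennreal ((1/2)^n)" for n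
  proof -
    have nb: "norm (X (k (Suc n)) - X (k n)) < (1/2)^n"
      using kN[of n] strict_mono_leD[OF smk, of n "Suc n"] by (intro N) auto
    have "(\<integral>\<^sup>+x. ennreal (2^n * d n x) \<partial>lborel) = ennreal (2^n) * (\<integral>\<^sup>+x. ennreal (d n x) \<partial>lborel)"
      by (subst nn_integral_cmult[symmetric]) (auto simp: ennreal_mult d_def)
    also have "\<dots> = ennreal (2^n * (norm (X (k (Suc n)) - X (k n)))\<^sup>2)"
      unfolding d_def fd by (simp add: ennreal_mult)
    also have "\<dots> \<le> ennreal (2^n * ((1/2)^n)\<^sup>2)"
      using nb by (intro ennreal_leI mult_left_mono power_mono) auto
    also have "(2::real)^n * ((1/2)^n)\<^sup>2 = (1/2)^n"
      by (simp add: power2_eq_square power_divide)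
    finally show ?thesis .
  qed
  have "(\<integral>\<^sup>+x. (\<Sum>n. ennreal (2^n * d n x)) \<partial>lborel) = (\<Sum>n. \<integral>\<^sup>+x. ennreal (2^n * d n x) \<partial>lborel)"
    by (rule nn_integral_suminf) simp
  also have "\<dots> \<le> (\<Sum>n. ennreal ((1/2)^n))"
    by (intro suminf_le d_int) auto
  also have "\<dots> = ennreal 2"
  proof -
    have "(\<lambda>n. (1/2::real)^n) sums 2" using geometric_sums[of "1/2::real"] by simp
    then show ?thesis by (intro sums_unique[symmetric]) (subst sums_ennreal; auto)
  qed
  finally have fin: "(\<integral>\<^sup>+x. (\<Sum>n. ennreal (2^n * d n x)) \<partial>lborel) \<noteq> \<infinity>"
    by (auto simp: top_unique)
  have AE_fin: "AE x in lborel. (\<Sum>n. ennreal (2^n * d n x)) \<noteq> \<infinity>"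
    by (rule nn_integral_PInf_AE[OF _ fin]) measurable
  have conv: "convergent (\<lambda>n. f n x)" if x: "(\<Sum>n. ennreal (2^n * d n x)) \<noteq> \<infinity>" for x
  proof -
    obtain C where C: "C \<ge> 0" "(\<Sum>n. ennreal (2^n * d n x)) = ennreal C"
      using x by (cases "(\<Sum>n. ennreal (2^n * d n x))") auto
    have bd: "\<bar>f (Suc n) x - f n x\<bar> \<le> sqrt C * (sqrt (1/2))^n" for n
    proof -
      have "ennreal (2^n * d n x) \<le> ennreal C"
        unfolding C(2)[symmetric] using sum_le_suminf[of "\<lambda>n. ennreal (2^n * d n x)" "{n}"] by simp
      then have "2^n * d n x \<le> C" using C(1) by simp
      then have "d n x \<le> C * (1/2)^n" by (simp add: field_simps)
      then have "sqrt (d n x) \<le> sqrt (C * (1/2)^n)" by simp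
      moreover have "sqrt (d n x) = \<bar>f (Suc n) x - f n x\<bar>" unfolding d_def by (rule real_sqrt_abs)
      ultimately show ?thesis by (simp only: real_sqrt_mult real_sqrt_power)
    qed
    have "summable (\<lambda>n. sqrt C * (sqrt (1/2))^n)"
      by (intro summable_mult summable_geometric) (simp add: real_sqrt_lt_1_iff)
    then have "summable (\<lambda>n. f (Suc n) x - f n x)"
      by (rule summable_comparison_test'[where N=0]) (simp only: real_norm_def bd)
    then have "convergent (\<lambda>n. \<Sum>i<n. f (Suc i) x - f i x)"
      by (simp add: summable_iff_convergent)
    then have "convergent (\<lambda>n. f n x - f 0 x)"
      unfolding sum_lessThan_telescope[of "\<lambda>n. f n x"] .
    then have "convergent (\<lambda>n. (f n x - f 0 x) + f 0 x)"
      by (intro convergent_add convergent_const)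
    then show ?thesis by simp
  qed
  define g where "g x = lim (\<lambda>n. f n x)" for x
  have gm [measurable]: "g \<in> borel_measurable lborel"
    unfolding g_def[abs_def] by (rule borel_measurable_lim_metric) (rule fm)
  have lim: "AE x in lborel. (\<lambda>n. f n x) \<longlonglongrightarrow> g x"
    using AE_fin by eventually_elim (simp add: g_def conv convergent_LIMSEQ_iff[symmetric])
  have fatou: "(\<integral>\<^sup>+x. ennreal ((g x - f m x)\<^sup>2) \<partial>lborel) \<le> ennreal (((1/2)^m)\<^sup>2)" for m
  proof -
    have "(\<integral>\<^sup>+x. ennreal ((g x - f m x)\<^sup>2) \<partial>lborel)
        = (\<integral>\<^sup>+x. liminf (\<lambda>n. ennreal ((f n x - f m x)\<^sup>2)) \<partial>lborel)"
      using lim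
    proof (intro nn_integral_cong_AE, eventually_elim)
      case (elim x)
      then have "(\<lambda>n. ennreal ((f n x - f m x)\<^sup>2)) \<longlonglongrightarrow> ennreal ((g x - f m x)\<^sup>2)"
        by (intro tendsto_intros)
      from lim_imp_Liminf[OF _ this] show ?case by simp
    qed
    also have "\<dots> \<le> liminf (\<lambda>n. \<integral>\<^sup>+x. ennreal ((f n x - f m x)\<^sup>2) \<partial>lborel)"
      by (rule nn_integral_liminf) simp
    also have "\<dots> \<le> ennreal (((1/2)^m)\<^sup>2)"
    proof (rule Liminf_le)
      show "sequentially \<noteq> bot" by simp
      show "\<forall>\<^sub>F n in sequentially. (\<integral>\<^sup>+x. ennreal ((f n x - f m x)\<^sup>2) \<partial>lborel) \<le> ennreal (((1/2)^m)\<^sup>2)"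
        using eventually_ge_at_top[of m]
      proof eventually_elim
        case (elim n)
        have "norm (X (k n) - X (k m)) < (1/2)^m"
          using kN[of m] strict_mono_leD[OF smk elim] by (intro N) auto
        then show ?case unfolding fd by (intro ennreal_leI power_mono) auto
      qed
    qed
    finally show ?thesis .
  qed
  have gf: "square_integrable (\<lambda>x. g x - f m x)" for m
    by (rule square_integrableI_nn) (use fatou[of m] in \<open>auto simp: top_unique intro: le_less_trans\<close>)
  have g: "square_integrable g"
    using square_integrable_add[OF gf[of 0] f[of 0]] by simp
  have "norm (to_L2 g - X (k m)) \<le> (1/2)^m" for m
  proof -
    have "ennreal ((norm (to_L2 g - X (k m)))\<^sup>2) \<le> ennreal (((1/2)^m)\<^sup>2)"
      using fatou[of m] unfolding Xf diff_to_L2[OF g f] nn_norm_L2[OF gf] .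
    then have "(norm (to_L2 g - X (k m)))\<^sup>2 \<le> ((1/2)^m)\<^sup>2" by simp
    then show ?thesis by (rule power2_le_imp_le) simp
  qed
  then have lim_bd: "norm (X i - to_L2 g) < 2 * (1/2)^m" if "i \<ge> N m" for i m
    using norm_triangle_lt[of "X i - X (k m)" "X (k m) - to_L2 g" "2 * (1/2)^m"]
      N[OF that kN] that by (simp add: norm_minus_commute add_strict_mono add_less_le_mono) (smt (verit) norm_minus_commute)
  have "X \<longlonglongrightarrow> to_L2 g"
  proof (rule LIMSEQ_I)
    fix e :: real assume "0 < e"
    then obtain m where "(1/2)^m < e / 2"
      using real_arch_pow_inv[of "e / 2" "1/2"] by auto
    then have "\<forall>i\<ge>N m. norm (X i - to_L2 g) < e"
      using lim_bd[of m] by fastforce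
    then show "\<exists>no. \<forall>n\<ge>no. norm (X n - to_L2 g) < e" ..
  qed
  then show "convergent X" by (auto simp: convergent_def)
qed

lemma L2_tendsto_dominated:
  fixes g :: "'a::euclidean_space \<Rightarrow> real"
  assumes h: "\<And>n. h n \<in> borel_measurable lborel" "g \<in> borel_measurable lborel"
    and w: "square_integrable w" "\<And>n x. \<bar>h n x\<bar> \<le> \<bar>w x\<bar>"
    and lim: "\<And>x. (\<lambda>n. h n x) \<longlonglongrightarrow> g x"
  shows "square_integrable g" "(\<lambda>n. to_L2 (h n)) \<longlonglongrightarrow> to_L2 g"
proof -
  note [measurable] = h
  have wi: "integrable lborel (\<lambda>x. (w x)\<^sup>2)" and [measurable]: "w \<in> borel_measurable lborel"
    using w(1) by (auto simp: square_integrable_def)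
  have gw: "\<bar>g x\<bar> \<le> \<bar>w x\<bar>" for x
    using tendsto_rabs[OF lim[of x]] w(2) by (intro LIMSEQ_le_const2[where X="\<lambda>n. \<bar>h n x\<bar>"]) auto
  show g: "square_integrable g"
    unfolding square_integrable_def using gw
    by (auto intro!: Bochner_Integration.integrable_bound[OF wi] simp: abs_le_square_iff)
  have hs: "square_integrable (h n)" for n
    unfolding square_integrable_def using w(2)[of n]
    by (auto intro!: Bochner_Integration.integrable_bound[OF wi] simp: abs_le_square_iff)
  have "(\<lambda>n. LINT x|lborel. (h n x - g x)\<^sup>2) \<longlonglongrightarrow> (LINT x|(lborel :: 'a measure). 0)"
  proof (rule Bochner_Integration.integral_dominated_convergence[where w="\<lambda>x. 4 * (w x)\<^sup>2"])
    show "integrable lborel (\<lambda>x. 4 * (w x)\<^sup>2)" using wi by simp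
    show "AE x in lborel. (\<lambda>n. (h n x - g x)\<^sup>2) \<longlonglongrightarrow> (0::real)"
      using tendsto_power[OF tendsto_diff[OF lim tendsto_const], where n=2] by (intro AE_I2) (metis diff_self power_zero_numeral)
    show "AE x in lborel. norm ((h n x - g x)\<^sup>2) \<le> 4 * (w x)\<^sup>2" for n
    proof (intro AE_I2)
      fix x
      have "\<bar>h n x - g x\<bar> \<le> \<bar>2 * w x\<bar>" using w(2)[of n x] gw[of x] by linarith
      then have "(h n x - g x)\<^sup>2 \<le> (2 * w x)\<^sup>2" by (simp add: abs_le_square_iff)
      then show "norm ((h n x - g x)\<^sup>2) \<le> 4 * (w x)\<^sup>2" by (simp add: power_mult_distrib)
    qed
  qed simp_all
  then have "(\<lambda>n. (norm (to_L2 (h n) - to_L2 g))\<^sup>2) \<longlonglongrightarrow> 0"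
    by (simp add: diff_to_L2[OF hs g] norm_to_L2[OF square_integrable_diff[OF hs g]])
  then have "(\<lambda>n. sqrt ((norm (to_L2 (h n) - to_L2 g))\<^sup>2)) \<longlonglongrightarrow> sqrt 0"
    by (rule tendsto_real_sqrt)
  then have "(\<lambda>n. norm (to_L2 (h n) - to_L2 g)) \<longlonglongrightarrow> 0" by simp
  then show "(\<lambda>n. to_L2 (h n)) \<longlonglongrightarrow> to_L2 g"
    by (simp add: tendsto_norm_zero_iff LIM_zero_iff)
qed

lemma add_to_L2:
  assumes "square_integrable f" "square_integrable g"
  shows "to_L2 (\<lambda>x. f x + g x) = to_L2 f + to_L2 g"
  using assms by (simp add: plus_L2.abs_eq l2_eq_def)

lemma scaleR_to_L2:
  assumes "square_integrable f"
  shows "to_L2 (\<lambda>x. c * f x) = c *\<^sub>R to_L2 f"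
  using assms by (simp add: scaleR_L2.abs_eq l2_eq_def)

lemma square_integrable_sum:
  "(\<And>i. i \<in> I \<Longrightarrow> square_integrable (f i)) \<Longrightarrow> square_integrable (\<lambda>x. \<Sum>i\<in>I. f i x)"
  by (induction I rule: infinite_finite_induct)
    (auto intro: square_integrable_zero square_integrable_add)

lemma square_integrable_indicator:
  "A \<in> sets borel \<Longrightarrow> emeasure lborel A < \<infinity> \<Longrightarrow> square_integrable (indicator A)"
proof -
  assume A: "A \<in> sets borel" "emeasure lborel A < \<infinity>"
  have "(\<lambda>x::'a. (indicator A x :: real)\<^sup>2) = indicator A"
    by (auto simp: indicator_def power2_eq_square)
  then show ?thesis using A by (simp add: square_integrable_def)
qed

lemma closed_span_indicators:
  fixes W :: "'a::euclidean_space L2 set"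
  assumes W: "subspace W" "closed W"
    and ind: "\<And>A. A \<in> sets borel \<Longrightarrow> emeasure lborel A < \<infinity> \<Longrightarrow> to_L2 (indicator A) \<in> W"
  shows "W = UNIV"
proof -
  have "to_L2 f \<in> W" if f: "square_integrable f" for f
  proof -
    have fm: "f \<in> borel_measurable lborel" using f by (simp add: square_integrable_def)
    from borel_measurable_implies_sequence_metric[OF this, of 0] obtain s where
      s: "\<And>i. simple_function lborel (s i)" "\<And>x. (\<lambda>i. s i x) \<longlonglongrightarrow> f x"
        "\<And>i x. \<bar>s i x\<bar> \<le> 2 * \<bar>f x\<bar>"
      by (auto simp: dist_norm)
    have sm [measurable]: "s i \<in> borel_measurable lborel" for i
      by (rule borel_measurable_simple_function[OF s(1)])
    have "to_L2 (s i) \<in> W" for i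
    proof -
      have si: "square_integrable (s i)"
        unfolding square_integrable_def
      proof (intro conjI sm)
        have "integrable lborel (\<lambda>x. 4 * (f x)\<^sup>2)" using f by (simp add: square_integrable_def)
        then show "integrable lborel (\<lambda>x. (s i x)\<^sup>2)"
        proof (rule Bochner_Integration.integrable_bound)
          show "AE x in lborel. norm ((s i x)\<^sup>2) \<le> norm (4 * (f x)\<^sup>2)"
          proof (rule AE_I2)
            fix x
            have "\<bar>s i x\<bar> \<le> \<bar>2 * f x\<bar>" using s(3)[of i x] by (simp add: abs_mult)
            then have "(s i x)\<^sup>2 \<le> (2 * f x)\<^sup>2" by (simp only: abs_le_square_iff)
            then show "norm ((s i x)\<^sup>2) \<le> norm (4 * (f x)\<^sup>2)" by (simp add: power_mult_distrib)
          qed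
        qed simp
      qed
      define Y where "Y = range (s i) - {0}"
      have fY: "finite Y" using simple_functionD(1)[OF s(1)[of i]] by (simp add: Y_def)
      define E where "E y = {x. s i x = y}" for y
      have Em: "E y \<in> sets borel" for y
      proof -
        have "E y = s i -` {y} \<inter> space lborel" by (auto simp: E_def)
        also have "\<dots> \<in> sets lborel" by measurable
        finally show ?thesis by simp
      qed
      have Ef: "emeasure lborel (E y) < \<infinity>" if "y \<in> Y" for y
      proof -
        have y: "y \<noteq> 0" using that by (simp add: Y_def)
        have "ennreal (y\<^sup>2) * emeasure lborel (E y) = (\<integral>\<^sup>+x. ennreal (y\<^sup>2) * indicator (E y) x \<partial>lborel)"
          using Em by (simp add: nn_integral_cmult_indicator)
        also have "\<dots> \<le> (\<integral>\<^sup>+x. ennreal ((s i x)\<^sup>2) \<partial>lborel)"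
          by (intro nn_integral_mono) (auto simp: indicator_def E_def)
        also have "\<dots> < \<infinity>" unfolding nn_norm_L2[OF si] by simp
        finally show ?thesis using y by (auto simp: ennreal_mult_less_top)
      qed
      have Es: "square_integrable (\<lambda>x. y * indicator (E y) x)" "to_L2 (\<lambda>x. y * indicator (E y) x) \<in> W" if "y \<in> Y" for y
      proof -
        note q = square_integrable_indicator[OF Em Ef[OF that]]
        show "square_integrable (\<lambda>x. y * indicator (E y) x)" using q by (rule square_integrable_scale)
        show "to_L2 (\<lambda>x. y * indicator (E y) x) \<in> W"
          unfolding scaleR_to_L2[OF q] by (intro subspace_scale W ind Em Ef that)
      qed
      have "to_L2 (\<lambda>x. \<Sum>y\<in>Z. y * indicator (E y) x) \<in> W" if "Z \<subseteq> Y" for Z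
        using finite_subset[OF that fY] that
      proof (induction Z)
        case empty
        have "to_L2 (\<lambda>x. 0) = (0 :: 'a L2)" by (simp add: zero_L2_def)
        then show ?case by (simp add: subspace_0[OF W(1)])
      next
        case (insert y Z)
        have "square_integrable (\<lambda>x. \<Sum>y\<in>Z. y * indicator (E y) x)"
          using insert.prems by (intro square_integrable_sum Es) auto
        then have "to_L2 (\<lambda>x. y * indicator (E y) x + (\<Sum>y\<in>Z. y * indicator (E y) x)) \<in> W"
          using insert Es[of y] by (subst add_to_L2) (auto intro: subspace_add[OF W(1)])
        then show ?case by (simp only: sum.insert[OF insert.hyps(1,2)])
      qed
      moreover have "s i = (\<lambda>x. \<Sum>y\<in>Y. y * indicator (E y) x)"
      proof
        fix x
        show "s i x = (\<Sum>y\<in>Y. y * indicator (E y) x)"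
        proof (cases "s i x = 0")
          case True
          then have "(\<Sum>y\<in>Y. y * indicator (E y) x) = 0"
            by (intro sum.neutral) (auto simp: Y_def E_def indicator_def)
          then show ?thesis using True by simp
        next
          case False
          then have "s i x \<in> Y" by (simp add: Y_def)
          have "(\<Sum>y\<in>Y. y * indicator (E y) x) = (\<Sum>y\<in>Y. if y = s i x then y else 0)"
            by (intro sum.cong) (auto simp: E_def indicator_def)
          then show ?thesis using fY \<open>s i x \<in> Y\<close> by simp
        qed
      qed
      ultimately show ?thesis by (metis order_refl)
    qed
    moreover have "(\<lambda>i. to_L2 (s i)) \<longlonglongrightarrow> to_L2 f"
      using L2_tendsto_dominated(2)[of s f "\<lambda>x. 2 * f x"] s fm
        square_integrable_scale[OF f, of 2] by (simp add: abs_mult)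
    ultimately show ?thesis
      by (rule closed_sequentially[OF W(2), of "\<lambda>i. to_L2 (s i)"])
  qed
  then show ?thesis by (metis UNIV_eq_I to_L2_rep square_integrable_rep)
qed

lemma subspace_closure:
  fixes S :: "'b::real_normed_vector set"
  assumes "subspace S"
  shows "subspace (closure S)"
proof (rule subspaceI)
  show "0 \<in> closure S" using assms closure_subset subspace_0 by blast
next
  fix x y assume "x \<in> closure S" "y \<in> closure S"
  then obtain p q where "\<And>n. p n \<in> S" "p \<longlonglongrightarrow> x" "\<And>n. q n \<in> S" "q \<longlonglongrightarrow> y"
    unfolding closure_sequential by blast
  then show "x + y \<in> closure S"
    unfolding closure_sequential
    by (intro exI[of _ "\<lambda>n. p n + q n"]) (simp add: subspace_add[OF assms] tendsto_add)
next
  fix c x assume "x \<in> closure S"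
  then obtain p where "\<And>n. p n \<in> S" "p \<longlonglongrightarrow> x"
    unfolding closure_sequential by blast
  then show "c *\<^sub>R x \<in> closure S"
    unfolding closure_sequential
    by (intro exI[of _ "\<lambda>n. c *\<^sub>R p n"]) (simp add: subspace_scale[OF assms] tendsto_scaleR)
qed

lemma L2_separable: "\<exists>C :: 'a::euclidean_space L2 set. countable C \<and> closure C = UNIV"
proof -
  obtain B :: "'a set set" where B: "countable B" "topological_basis B"
    using ex_countable_basis by blast
  define G where "G = (\<lambda>F. \<Inter>F) ` {F. finite F \<and> F \<subseteq> B}"
  have cG: "countable G"
    unfolding G_def using B(1) by (intro countable_image countable_Collect_finite_subset)
  have BG: "B \<subseteq> G"
  proof
    fix b assume "b \<in> B"
    then show "b \<in> G" unfolding G_def by (intro image_eqI[of _ _ "{b}"]) auto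
  qed
  have Gopen: "open b" if "b \<in> G" for b
    using that topological_basis_open[OF B(2)] by (auto simp: G_def)
  have IG: "Int_stable G"
  proof (rule Int_stableI)
    fix a b assume "a \<in> G" "b \<in> G"
    then obtain F F' where "finite F" "F \<subseteq> B" "a = \<Inter>F" "finite F'" "F' \<subseteq> B" "b = \<Inter>F'"
      by (auto simp: G_def)
    then show "a \<inter> b \<in> G" unfolding G_def by (intro image_eqI[of _ _ "F \<union> F'"]) auto
  qed
  have GS: "sets (borel :: 'a measure) = sigma_sets UNIV G"
  proof
    show "sets (borel :: 'a measure) \<subseteq> sigma_sets UNIV G"
      unfolding borel_eq_countable_basis[OF B] using BG by (simp add: sigma_sets_mono')
    show "sigma_sets UNIV G \<subseteq> sets (borel :: 'a measure)"
      using sets.sigma_sets_subset[of G "borel :: 'a measure"] Gopen by (auto simp: subset_eq)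
  qed
  define K where "K n = ball (0::'a) (real n)" for n
  have Kf: "emeasure lborel (A \<inter> K n) < \<infinity>" for A n
  proof -
    have "emeasure lborel (A \<inter> K n) \<le> emeasure lborel (K n)"
      by (rule emeasure_mono) (auto simp: K_def)
    also have "\<dots> < \<infinity>" unfolding K_def by (rule emeasure_bounded_finite) simp
    finally show ?thesis .
  qed
  define V where "V = (\<lambda>(A, n). to_L2 (indicator (A \<inter> K n))) ` (insert UNIV G \<times> (UNIV :: nat set))"
  have cV: "countable V" using cG by (simp add: V_def)
  define W where "W = closure (span V)"
  have W: "subspace W" "closed W"
    unfolding W_def by (rule subspace_closure, simp, simp)
  have sq: "square_integrable (indicator (A \<inter> K n))" if "A \<in> sets borel" for A n
    using that by (intro square_integrable_indicator Kf) (auto simp: K_def)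
  have VW: "V \<subseteq> W" unfolding W_def using span_superset closure_subset by blast
  have P: "\<forall>n. to_L2 (indicator (A \<inter> K n)) \<in> W" if "A \<in> sigma_sets UNIV G" for A
    using IG subset_UNIV[of G, folded Pow_UNIV] that
  proof (induction rule: sigma_sets_induct_disjoint)
    case (basic A)
    then show ?case using VW by (auto simp: V_def)
  next
    case empty
    have "to_L2 (\<lambda>x. 0) = (0 :: 'a L2)" by (simp add: zero_L2_def)
    then show ?case by (simp add: subspace_0[OF W(1)])
  next
    case (compl A)
    show ?case
    proof
      fix n
      have A: "A \<in> sets borel" using compl GS by simp
      have "to_L2 (indicator (UNIV \<inter> K n)) - to_L2 (indicator (A \<inter> K n)) \<in> W"
        by (intro subspace_diff[OF W(1)] compl(2)[rule_format] subsetD[OF VW])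
          (force simp: V_def)
      also have "to_L2 (indicator (UNIV \<inter> K n)) - to_L2 (indicator (A \<inter> K n))
          = to_L2 (\<lambda>x. indicator (UNIV \<inter> K n) x - indicator (A \<inter> K n) x)"
        by (intro diff_to_L2 sq A) simp
      also have "(\<lambda>x. indicator (UNIV \<inter> K n) x - indicator (A \<inter> K n) x :: real) = indicator ((UNIV - A) \<inter> K n)"
        by (auto simp: indicator_def)
      finally show "to_L2 (indicator ((UNIV - A) \<inter> K n)) \<in> W" .
    qed
  next
    case (union A)
    show ?case
    proof
      fix n
      have A: "A i \<in> sets borel" for i using union GS by auto
      define h where "h m x = (\<Sum>i<m. indicator (A i \<inter> K n) x :: real)" for m x
      have hs: "square_integrable (h m)" for m
        unfolding h_def[abs_def] by (intro square_integrable_sum sq A)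
      have hW: "to_L2 (h m) \<in> W" for m
      proof (induction m)
        case 0
        have "to_L2 (\<lambda>x. 0) = (0 :: 'a L2)" by (simp add: zero_L2_def)
        then show ?case by (simp add: h_def[abs_def] subspace_0[OF W(1)])
      next
        case (Suc m)
        have "to_L2 (h (Suc m)) = to_L2 (h m) + to_L2 (indicator (A m \<inter> K n))"
          using add_to_L2[OF hs[of m] sq[OF A[of m]]] by (simp add: h_def[abs_def])
        then show ?case using Suc union by (simp add: subspace_add[OF W(1)])
      qed
      have heq: "h m = indicator ((\<Union>i<m. A i) \<inter> K n)" for m
      proof
        fix x
        have "disjoint_family_on (\<lambda>i. A i \<inter> K n) {..<m}"
          using union(1) by (fastforce simp: disjoint_family_on_def)
        then have "(\<Sum>i<m. indicator (A i \<inter> K n) x :: real) = indicator (\<Union>i<m. A i \<inter> K n) x"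
          by (subst indicator_UN_disjoint) auto
        then show "h m x = indicator ((\<Union>i<m. A i) \<inter> K n) x" by (simp add: h_def Int_UN_distrib2)
      qed
      have "(\<lambda>m. to_L2 (h m)) \<longlonglongrightarrow> to_L2 (indicator ((\<Union>i. A i) \<inter> K n))"
      proof (rule L2_tendsto_dominated(2))
        show "h m \<in> borel_measurable lborel" for m using hs[of m] by (simp add: square_integrable_def)
        have "(\<Union>i. A i) \<inter> K n \<in> sets lborel" using A by (auto simp: K_def)
        then show "indicat_real ((\<Union>i. A i) \<inter> K n) \<in> borel_measurable lborel" by simp
        show "square_integrable (indicator (UNIV \<inter> K n))" by (rule sq) simp
        show "\<bar>h m x\<bar> \<le> \<bar>indicator (UNIV \<inter> K n) x\<bar>" for m x
          unfolding heq by (auto simp: indicator_def)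
        show "(\<lambda>m. h m x) \<longlonglongrightarrow> indicator ((\<Union>i. A i) \<inter> K n) x" for x
        proof (cases "x \<in> (\<Union>i. A i) \<inter> K n")
          case True
          then obtain i where "x \<in> A i" "x \<in> K n" by auto
          then have "\<forall>\<^sub>F m in sequentially. h m x = 1"
            unfolding heq by (intro eventually_sequentiallyI[of "Suc i"]) (auto simp: indicator_def)
          then show ?thesis using True by (simp add: tendsto_eventually)
        next
          case False
          then have "h m x = 0" for m unfolding heq by (auto simp: indicator_def)
          then show ?thesis using False by simp
        qed
      qed
      then show "to_L2 (indicator ((\<Union>i. A i) \<inter> K n)) \<in> W"
        by (rule closed_sequentially[OF W(2) hW])
    qed
  qed
  have "W = UNIV"
  proof (rule closed_span_indicators[OF W])
    fix A :: "'a set" assume A: "A \<in> sets borel" "emeasure lborel A < \<infinity>"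
    have "(\<lambda>n. to_L2 (indicator (A \<inter> K n))) \<longlonglongrightarrow> to_L2 (indicator A)"
    proof (rule L2_tendsto_dominated(2))
      show "indicat_real (A \<inter> K n) \<in> borel_measurable lborel" for n
        using sq[OF A(1), of n] by (simp add: square_integrable_def)
      show "indicat_real A \<in> borel_measurable lborel" using A by simp
      show "square_integrable (indicator A)" using A by (rule square_integrable_indicator)
      show "\<bar>indicator (A \<inter> K n) x\<bar> \<le> \<bar>indicator A x :: real\<bar>" for n x by (auto simp: indicator_def)
      show "(\<lambda>n. indicator (A \<inter> K n) x) \<longlonglongrightarrow> (indicator A x :: real)" for x
      proof -
        obtain m where "norm x < real m" using reals_Archimedean2 by blast
        then have "\<forall>\<^sub>F n in sequentially. indicator (A \<inter> K n) x = (indicator A x :: real)"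
          by (intro eventually_sequentiallyI[of m]) (auto simp: indicator_def K_def)
        then show ?thesis by (rule tendsto_eventually)
      qed
    qed
    moreover have "\<And>n. to_L2 (indicator (A \<inter> K n)) \<in> W" using P A GS by blast
    ultimately show "to_L2 (indicator A) \<in> W"
      by - (rule closed_sequentially[OF W(2), of "\<lambda>n. to_L2 (indicator (A \<inter> K n))"])
  qed
  define C where "C = (\<lambda>l :: (rat \<times> 'a L2) list. \<Sum>(q, v)\<leftarrow>l. of_rat q *\<^sub>R v) ` lists (UNIV \<times> V)"
  have cC: "countable C" using cV by (simp add: C_def)
  have C0: "0 \<in> C" unfolding C_def by (intro image_eqI[of _ _ "[]"]) auto
  have C1: "of_rat q *\<^sub>R v + c \<in> C" if vc: "v \<in> V" "c \<in> C" for q v c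
  proof -
    obtain l where "l \<in> lists (UNIV \<times> V)" "c = (\<Sum>(q, v)\<leftarrow>l. of_rat q *\<^sub>R v)"
      using vc(2) unfolding C_def by blast
    then show ?thesis
      unfolding C_def using vc(1) by (intro image_eqI[of _ _ "(q, v) # l"]) auto
  qed
  have "span V \<subseteq> closure C"
  proof
    fix x assume "x \<in> span V"
    then show "x \<in> closure C"
    proof (induction rule: span_induct_alt)
      case base
      then show ?case using C0 closure_subset by blast
    next
      case (step c v y)
      then obtain z where z: "\<And>n. z n \<in> C" "z \<longlonglongrightarrow> y"
        unfolding closure_sequential by blast
      have "c \<in> closure (\<rat> :: real set)" by (simp add: Rats_closure_real)
      then obtain r where r: "\<And>n. r n \<in> \<rat>" "r \<longlonglongrightarrow> c"
        unfolding closure_sequential by blast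
      have "r n *\<^sub>R v + z n \<in> C" for n
        using r(1)[of n] C1[OF step(1) z(1)] by (auto elim!: Rats_cases)
      moreover have "(\<lambda>n. r n *\<^sub>R v + z n) \<longlonglongrightarrow> c *\<^sub>R v + y"
        by (intro tendsto_intros r z)
      ultimately show ?case unfolding closure_sequential
        by (intro exI[of _ "\<lambda>n. r n *\<^sub>R v + z n"]) simp
    qed
  qed
  then have "closure C = UNIV"
    using \<open>W = UNIV\<close> unfolding W_def by (metis closure_closure closure_mono top.extremum_unique)
  with cC show ?thesis by blast
qed

instance L2 :: (euclidean_space) second_countable_topology
proof
  obtain C :: "'a L2 set" where C: "countable C" "closure C = UNIV"
    using L2_separable by blast
  define B where "B = (\<lambda>(c, q). ball c (of_rat q)) ` (C \<times> (UNIV :: rat set))"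
  have "topological_basis B"
  proof (rule topological_basisI)
    fix b assume "b \<in> B" then show "open b" by (auto simp: B_def)
  next
    fix U :: "'a L2 set" and x assume "open U" "x \<in> U"
    then obtain e where e: "0 < e" "ball x e \<subseteq> U" by (meson openE)
    obtain q where q: "0 < real_of_rat q" "real_of_rat q < e / 2"
      using of_rat_dense[of 0 "e / 2"] e by auto
    have "x \<in> closure C" using C by simp
    then obtain c where c: "c \<in> C" "dist c x < of_rat q"
      using q(1) unfolding closure_approachable by blast
    have "ball c (of_rat q) \<subseteq> U"
    proof
      fix y assume "y \<in> ball c (of_rat q)"
      then have "dist x y < e"
        using c q dist_triangle[of x y c] by (simp add: dist_commute)
      then show "y \<in> U" using e by auto
    qed
    then show "\<exists>b\<in>B. x \<in> b \<and> b \<subseteq> U"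
      using c unfolding B_def by (intro bexI[of _ "ball c (of_rat q)"]) auto
  qed
  moreover have "countable B" using C by (simp add: B_def)
  ultimately show "\<exists>B :: 'a L2 set set. countable B \<and> open = generate_topology B"
    by (metis topological_basis_imp_subbasis)
qed

instance L2 :: (euclidean_space) banach ..


section \<open>Smooth functions and domains\<close>

definition pd :: "'n::finite \<Rightarrow> (real^'n \<Rightarrow> real) \<Rightarrow> real^'n \<Rightarrow> real" where
  "pd i f x = frechet_derivative f (at x) (axis i 1)"

text \<open>Functions of class \<open>C\<^sup>k\<close>; meant for open \<open>S\<close>.\<close>

fun Ck_on :: "nat \<Rightarrow> (real^'n::finite) set \<Rightarrow> (real^'n \<Rightarrow> real) \<Rightarrow> bool" where
  "Ck_on 0 S f \<longleftrightarrow> continuous_on S f"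
| "Ck_on (Suc k) S f \<longleftrightarrow> (\<forall>x\<in>S. f differentiable (at x)) \<and> (\<forall>i. Ck_on k S (pd i f))"

definition smooth_on :: "(real^'n::finite) set \<Rightarrow> (real^'n \<Rightarrow> real) \<Rightarrow> bool" where
  "smooth_on S f \<longleftrightarrow> (\<forall>k. Ck_on k S f)"

definition smooth_upto_boundary :: "(real^'n::finite) set \<Rightarrow> (real^'n \<Rightarrow> real) \<Rightarrow> bool" where
  "smooth_upto_boundary D f \<longleftrightarrow> (\<exists>U. open U \<and> closure D \<subseteq> U \<and> smooth_on U f)"

text \<open>Near each boundary point, \<open>D\<close> is the region above the graph, in a unit direction \<open>e\<close>, of a
  \<open>C\<^sup>2\<close> function \<open>\<gamma>\<close> of the component orthogonal to \<open>e\<close>.\<close>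

definition C2_boundary :: "(real^'n::finite) set \<Rightarrow> bool" where
  "C2_boundary D \<longleftrightarrow> (\<forall>x\<in>frontier D. \<exists>r>0. \<exists>e \<gamma>. norm e = 1 \<and> Ck_on 2 UNIV \<gamma> \<and>
     D \<inter> ball x r = {y \<in> ball x r. y \<bullet> e > \<gamma> (y - (y \<bullet> e) *\<^sub>R e)})"

definition bounded_C2_domain :: "(real^'n::finite) set \<Rightarrow> bool" where
  "bounded_C2_domain D \<longleftrightarrow>
     open D \<and> connected D \<and> D \<noteq> {} \<and> bounded D \<and> C2_boundary D"

definition test_functions :: "(real^'n::finite) set \<Rightarrow> (real^'n \<Rightarrow> real) set" where
  "test_functions D = {\<phi>. smooth_on UNIV \<phi> \<and> compact (closure {x. \<phi> x \<noteq> 0}) \<and>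
     closure {x. \<phi> x \<noteq> 0} \<subseteq> D}"


section \<open>Sobolev spaces\<close>

text \<open>\<open>L\<^sup>2(D)\<close> is identified, through extension by zero, with the closed subspace of functions
  vanishing almost everywhere outside \<open>D\<close>.\<close>

definition L2_on :: "'a::euclidean_space set \<Rightarrow> 'a L2 set" where
  "L2_on D = {f. AE x in lborel. x \<notin> D \<longrightarrow> rep_L2 f x = 0}"

text \<open>The weak derivative is taken on \<open>D\<close> only: the test functions are supported in \<open>D\<close>.\<close>

definition has_weak_pd ::
  "(real^'n::finite) set \<Rightarrow> 'n \<Rightarrow> (real^'n) L2 \<Rightarrow> (real^'n) L2 \<Rightarrow> bool" where
  "has_weak_pd D i f g \<longleftrightarrow> g \<in> L2_on D \<and>
     (\<forall>\<phi>\<in>test_functions D. f \<bullet> to_L2 (pd i \<phi>) = - (g \<bullet> to_L2 \<phi>))"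

definition weak_pd :: "(real^'n::finite) set \<Rightarrow> 'n \<Rightarrow> (real^'n) L2 \<Rightarrow> (real^'n) L2" where
  "weak_pd D i f = (THE g. has_weak_pd D i f g)"

definition H1 :: "(real^'n::finite) set \<Rightarrow> (real^'n) L2 set" where
  "H1 D = {f \<in> L2_on D. \<forall>i. \<exists>g. has_weak_pd D i f g}"

definition H2 :: "(real^'n::finite) set \<Rightarrow> (real^'n) L2 set" where
  "H2 D = {f \<in> H1 D. \<forall>i. weak_pd D i f \<in> H1 D}"

text \<open>The closure of the test functions in the norm of \<open>H\<^sup>1(D)\<close>.\<close>

definition H10 :: "(real^'n::finite) set \<Rightarrow> (real^'n) L2 set" where
  "H10 D = {f \<in> H1 D. \<exists>\<phi>. (\<forall>n::nat. \<phi> n \<in> test_functions D) \<and>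
     (\<lambda>n. to_L2 (\<phi> n)) \<longlonglongrightarrow> f \<and>
     (\<forall>i. (\<lambda>n. to_L2 (pd i (\<phi> n))) \<longlonglongrightarrow> weak_pd D i f)}"


section \<open>The elliptic operator and its square root\<close>

definition mult_on :: "'a::euclidean_space set \<Rightarrow> ('a \<Rightarrow> real) \<Rightarrow> 'a L2 \<Rightarrow> 'a L2" where
  "mult_on D c f = to_L2 (\<lambda>x. indicator D x * (c x * rep_L2 f x))"

definition elliptic_coefficients ::
  "(real^'n::finite) set \<Rightarrow> ('n \<Rightarrow> 'n \<Rightarrow> real^'n \<Rightarrow> real) \<Rightarrow> (real^'n \<Rightarrow> real) \<Rightarrow> bool" where
  "elliptic_coefficients D a b \<longleftrightarrow>
     (\<forall>i j. smooth_upto_boundary D (a i j)) \<and> smooth_upto_boundary D b \<and>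
     (\<forall>x\<in>D. \<forall>i j. a i j x = a j i x) \<and>
     (\<exists>a0 a1. 0 < a0 \<and> a0 \<le> a1 \<and>
       (\<forall>x\<in>D. \<forall>\<xi>::real^'n.
          a0 * (1 + (norm \<xi>)\<^sup>2) \<le> (\<Sum>i\<in>UNIV. \<Sum>j\<in>UNIV. a i j x * \<xi> $ i * \<xi> $ j) + b x \<and>
          (\<Sum>i\<in>UNIV. \<Sum>j\<in>UNIV. a i j x * \<xi> $ i * \<xi> $ j) + b x \<le> a1 * (1 + (norm \<xi>)\<^sup>2)))"

text \<open>The operator \<open>A\<close>, on its domain \<^term>\<open>H2 D \<inter> H10 D\<close>.\<close>

definition elliptic_op ::
  "(real^'n::finite) set \<Rightarrow> ('n \<Rightarrow> 'n \<Rightarrow> real^'n \<Rightarrow> real) \<Rightarrow> (real^'n \<Rightarrow> real) \<Rightarrow>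
    (real^'n) L2 \<Rightarrow> (real^'n) L2" where
  "elliptic_op D a b u =
     (\<Sum>i\<in>UNIV. \<Sum>j\<in>UNIV. weak_pd D i (mult_on D (a i j) (weak_pd D j u))) - mult_on D b u"

text \<open>The duality pairing between \<open>A u \<in> H\<^sup>-\<^sup>1\<close> and \<open>g \<in> H\<^sub>0\<^sup>1\<close>, where \<open>A\<close> is extended to \<open>u \<in> H\<^sub>0\<^sup>1\<close>.\<close>

definition elliptic_pairing ::
  "(real^'n::finite) set \<Rightarrow> ('n \<Rightarrow> 'n \<Rightarrow> real^'n \<Rightarrow> real) \<Rightarrow> (real^'n \<Rightarrow> real) \<Rightarrow>
    (real^'n) L2 \<Rightarrow> (real^'n) L2 \<Rightarrow> real" where
  "elliptic_pairing D a b u g =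
     - (\<Sum>i\<in>UNIV. \<Sum>j\<in>UNIV. mult_on D (a i j) (weak_pd D j u) \<bullet> weak_pd D i g)
     - mult_on D b u \<bullet> g"

text \<open>\<open>T\<close>, with domain \<open>S\<close>, is a (possibly unbounded) self-adjoint operator in the closed
  subspace \<open>H\<close>: it is densely defined and coincides, as a graph, with its adjoint.\<close>

definition selfadjoint_on :: "'h::real_inner set \<Rightarrow> 'h set \<Rightarrow> ('h \<Rightarrow> 'h) \<Rightarrow> bool" where
  "selfadjoint_on H S T \<longleftrightarrow>
     subspace S \<and> S \<subseteq> H \<and> H \<subseteq> closure S \<and> T ` S \<subseteq> H \<and>
     (\<forall>x\<in>S. \<forall>y\<in>S. T (x + y) = T x + T y) \<and> (\<forall>c. \<forall>x\<in>S. T (c *\<^sub>R x) = c *\<^sub>R T x) \<and>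
     (\<forall>y\<in>H. \<forall>z\<in>H. (y \<in> S \<and> z = T y) \<longleftrightarrow> (\<forall>x\<in>S. T x \<bullet> y = x \<bullet> z))"

text \<open>\<open>B\<close>, with domain \<open>R\<close>, is the nonnegative self-adjoint square root of the operator \<open>T\<close> with
  domain \<open>S\<close>. Domains matter: \<open>B\<^sup>2\<close> is defined on the \<open>x \<in> R\<close> with \<open>B x \<in> R\<close>.\<close>

definition is_sqrt_on ::
  "'h::real_inner set \<Rightarrow> 'h set \<Rightarrow> ('h \<Rightarrow> 'h) \<Rightarrow> 'h set \<Rightarrow> ('h \<Rightarrow> 'h) \<Rightarrow> bool" where
  "is_sqrt_on H S T R B \<longleftrightarrow>
     selfadjoint_on H R B \<and> (\<forall>x\<in>R. 0 \<le> B x \<bullet> x) \<and>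
     {x \<in> R. B x \<in> R} = S \<and> (\<forall>x\<in>S. B (B x) = T x)"

definition eta1 :: "(real^'n::finite) set \<Rightarrow> ((real^'n) L2 \<Rightarrow> (real^'n) L2) \<Rightarrow> real" where
  "eta1 D B = Inf {(norm (B g))\<^sup>2 / (norm g)\<^sup>2 | g. g \<in> H10 D \<and> g \<noteq> 0}"

definition pseudo_energy :: "('h::real_inner \<Rightarrow> 'h) \<Rightarrow> real \<Rightarrow> 'h \<times> 'h \<Rightarrow> real" where
  "pseudo_energy B l = (\<lambda>(u, v). (norm (B u))\<^sup>2 + (norm (v + l *\<^sub>R u))\<^sup>2)"


section \<open>The trace\<close>

definition orthonormal_basis_on :: "'h::real_inner set \<Rightarrow> 'h set \<Rightarrow> bool" where
  "orthonormal_basis_on H E \<longleftrightarrow>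
     (\<forall>e\<in>E. norm e = 1) \<and> pairwise orthogonal E \<and> closure (span E) = H"

text \<open>Meant for nonnegative operators; the value (possibly infinite) is then independent of the
  orthonormal basis.\<close>

definition trace_on :: "'h::real_inner set \<Rightarrow> ('h \<Rightarrow> 'h) \<Rightarrow> ennreal" where
  "trace_on H T = (\<Sum>\<^sub>\<infinity>e\<in>(SOME E. orthonormal_basis_on H E). ennreal (T e \<bullet> e))"


section \<open>Martingales and covariation\<close>

text \<open>All processes are indexed by \<open>t \<ge> 0\<close>; their values at negative times are never used. A
  filtration on \<open>[0,\<infinity>)\<close> is regarded as one on the real line (say, with \<open>F t = F 0\<close> for \<open>t < 0\<close>)
  in order to use the library's notions of filtration and stopping time.\<close>

definition filtered_prob_space :: "'w measure \<Rightarrow> (real \<Rightarrow> 'w measure) \<Rightarrow> bool" where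
  "filtered_prob_space P F \<longleftrightarrow>
     prob_space P \<and> complete_measure P \<and> filtration (space P) F \<and> (\<forall>t. subalgebra P (F t))"

definition adapted :: "(real \<Rightarrow> 'w measure) \<Rightarrow> (real \<Rightarrow> 'w \<Rightarrow> 'b::topological_space) \<Rightarrow> bool" where
  "adapted F X \<longleftrightarrow> (\<forall>t\<ge>0. X t \<in> borel_measurable (F t))"

definition predictable_sigma :: "'w measure \<Rightarrow> (real \<Rightarrow> 'w measure) \<Rightarrow> (real \<times> 'w) measure" where
  "predictable_sigma P F = sigma ({0..} \<times> space P)
     ({{0} \<times> A | A. A \<in> sets (F 0)} \<union> {{s<..t} \<times> A | s t A. 0 \<le> s \<and> s \<le> t \<and> A \<in> sets (F s)})"

definition predictable ::
  "'w measure \<Rightarrow> (real \<Rightarrow> 'w measure) \<Rightarrow> (real \<Rightarrow> 'w \<Rightarrow> 'b::topological_space) \<Rightarrow> bool" where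
  "predictable P F X \<longleftrightarrow> (\<lambda>(t, \<omega>). X t \<omega>) \<in> borel_measurable (predictable_sigma P F)"

definition continuous_paths :: "'w measure \<Rightarrow> (real \<Rightarrow> 'w \<Rightarrow> 'b::topological_space) \<Rightarrow> bool" where
  "continuous_paths P X \<longleftrightarrow> (AE \<omega> in P. continuous_on {0..} (\<lambda>t. X t \<omega>))"

text \<open>The last clause says that \<open>E(X t | F s) = X s\<close>.\<close>

definition martingale ::
  "'w measure \<Rightarrow> (real \<Rightarrow> 'w measure) \<Rightarrow>
    (real \<Rightarrow> 'w \<Rightarrow> 'b::{banach, second_countable_topology}) \<Rightarrow> bool" where
  "martingale P F X \<longleftrightarrow> adapted F X \<and> (\<forall>t\<ge>0. integrable P (X t)) \<and>
     (\<forall>s\<ge>0. \<forall>t\<ge>s. \<forall>A\<in>sets (F s). (LINT \<omega>:A|P. X t \<omega>) = (LINT \<omega>:A|P. X s \<omega>))"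

text \<open>Finite stopping times are enough: any localizing sequence \<open>\<tau>\<^sub>n\<close> may be replaced by
  \<open>min \<tau>\<^sub>n n\<close>.\<close>

definition local_martingale ::
  "'w measure \<Rightarrow> (real \<Rightarrow> 'w measure) \<Rightarrow> (real \<Rightarrow> 'w \<Rightarrow> real) \<Rightarrow> bool" where
  "local_martingale P F X \<longleftrightarrow> adapted F X \<and>
     (\<exists>\<tau> :: nat \<Rightarrow> 'w \<Rightarrow> real.
        (\<forall>n. stopping_time F (\<tau> n)) \<and> (\<forall>n. \<forall>\<omega>\<in>space P. 0 \<le> \<tau> n \<omega>) \<and>
        (AE \<omega> in P. incseq (\<lambda>n. \<tau> n \<omega>) \<and> filterlim (\<lambda>n. \<tau> n \<omega>) at_top sequentially) \<and>
        (\<forall>n. martingale P F (\<lambda>t \<omega>. X (min t (\<tau> n \<omega>)) \<omega> - X 0 \<omega>)))"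

text \<open>\<open>V = \<langle>X, Y\<rangle>\<close> for continuous local martingales \<open>X\<close> and \<open>Y\<close>: the continuous adapted process
  with paths of locally bounded variation (differences of two nondecreasing functions), starting
  at \<open>0\<close>, that turns \<open>X Y - V\<close> into a local martingale.\<close>

definition has_bracket ::
  "'w measure \<Rightarrow> (real \<Rightarrow> 'w measure) \<Rightarrow> (real \<Rightarrow> 'w \<Rightarrow> real) \<Rightarrow> (real \<Rightarrow> 'w \<Rightarrow> real) \<Rightarrow>
    (real \<Rightarrow> 'w \<Rightarrow> real) \<Rightarrow> bool" where
  "has_bracket P F X Y V \<longleftrightarrow>
     adapted F V \<and> (AE \<omega> in P. V 0 \<omega> = 0) \<and> continuous_paths P V \<and>
     (AE \<omega> in P. \<exists>p q. mono_on {0..} p \<and> mono_on {0..} q \<and> (\<forall>t\<ge>0. V t \<omega> = p t - q t)) \<and>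
     local_martingale P F (\<lambda>t \<omega>. X t \<omega> * Y t \<omega> - V t \<omega>)"

definition nonneg_bounded_op_on :: "'h::real_inner set \<Rightarrow> ('h \<Rightarrow> 'h) \<Rightarrow> bool" where
  "nonneg_bounded_op_on H T \<longleftrightarrow> T ` H \<subseteq> H \<and>
     (\<forall>x\<in>H. \<forall>y\<in>H. T (x + y) = T x + T y) \<and> (\<forall>c. \<forall>x\<in>H. T (c *\<^sub>R x) = c *\<^sub>R T x) \<and>
     (\<exists>K. \<forall>x\<in>H. norm (T x) \<le> K * norm x) \<and>
     (\<forall>x\<in>H. \<forall>y\<in>H. T x \<bullet> y = x \<bullet> T y) \<and> (\<forall>x\<in>H. 0 \<le> T x \<bullet> x)"

definition covariation_operator ::
  "'w measure \<Rightarrow> (real \<Rightarrow> 'w measure) \<Rightarrow> 'h::real_inner set \<Rightarrow> (real \<Rightarrow> 'w \<Rightarrow> 'h) \<Rightarrow>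
    (real \<Rightarrow> 'w \<Rightarrow> 'h \<Rightarrow> 'h) \<Rightarrow> bool" where
  "covariation_operator P F H M Q \<longleftrightarrow>
     (\<forall>t\<ge>0. \<forall>\<omega>\<in>space P. nonneg_bounded_op_on H (Q t \<omega>)) \<and>
     (\<forall>g\<in>H. \<forall>h\<in>H.
        (\<lambda>(t, \<omega>). Q t \<omega> g \<bullet> h) \<in> borel_measurable (restrict_space borel {0..} \<Otimes>\<^sub>M P) \<and>
        adapted F (\<lambda>t \<omega>. Q t \<omega> g \<bullet> h) \<and>
        (AE \<omega> in P. \<forall>t\<ge>0. set_integrable lborel {0..t} (\<lambda>s. Q s \<omega> g \<bullet> h)) \<and>
        has_bracket P F (\<lambda>t \<omega>. M t \<omega> \<bullet> g) (\<lambda>t \<omega>. M t \<omega> \<bullet> h)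
          (\<lambda>t \<omega>. LINT s:{0..t}|lborel. Q s \<omega> g \<bullet> h))"


section \<open>Solutions of the damped wave equation\<close>

text \<open>
  The map \<open>(u; v) \<mapsto> (B u, v)\<close> is an isometry of the energy space \<open>H\<^sub>0\<^sup>1 \<times> H\<close>, with norm
  \<open>(\<parallel>u\<parallel>\<^sub>1\<^sup>2 + \<parallel>v\<parallel>\<^sup>2)\<^sup>1\<^sup>/\<^sup>2\<close>, into \<open>H \<times> H\<close> with the library's product norm. Hence measurability and
  continuity of a process in the energy space are those of its image under this map.

  The first integral equation is tested against smooth functions with compact support, the second
  one against all of \<open>H\<^sub>0\<^sup>1\<close>.
\<close>

definition energy_embedding :: "('h \<Rightarrow> 'h) \<Rightarrow> 'h \<times> 'h \<Rightarrow> 'h \<times> 'h" where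
  "energy_embedding B = (\<lambda>(u, v). (B u, v))"

definition continuous_wave_solution ::
  "'w measure \<Rightarrow> (real \<Rightarrow> 'w measure) \<Rightarrow> (real^'n::finite) set \<Rightarrow>
    ('n \<Rightarrow> 'n \<Rightarrow> real^'n \<Rightarrow> real) \<Rightarrow> (real^'n \<Rightarrow> real) \<Rightarrow> ((real^'n) L2 \<Rightarrow> (real^'n) L2) \<Rightarrow>
    real \<Rightarrow> (real \<Rightarrow> 'w \<Rightarrow> (real^'n) L2) \<Rightarrow> (real \<Rightarrow> 'w \<Rightarrow> (real^'n) L2) \<Rightarrow>
    (real^'n) L2 \<Rightarrow> (real^'n) L2 \<Rightarrow>
    (real \<Rightarrow> 'w \<Rightarrow> (real^'n) L2) \<Rightarrow> (real \<Rightarrow> 'w \<Rightarrow> (real^'n) L2) \<Rightarrow> bool" where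
  "continuous_wave_solution P F D a b B \<alpha> f M u0 v0 u v \<longleftrightarrow>
     (\<forall>t\<ge>0. \<forall>\<omega>\<in>space P. u t \<omega> \<in> H10 D \<and> v t \<omega> \<in> L2_on D) \<and>
     adapted F (\<lambda>t \<omega>. energy_embedding B (u t \<omega>, v t \<omega>)) \<and>
     continuous_paths P (\<lambda>t \<omega>. energy_embedding B (u t \<omega>, v t \<omega>)) \<and>
     (AE \<omega> in P. \<forall>t\<ge>0.
        (\<forall>\<phi>\<in>test_functions D.
           u t \<omega> \<bullet> to_L2 \<phi> = u0 \<bullet> to_L2 \<phi> + (LINT s:{0..t}|lborel. v s \<omega> \<bullet> to_L2 \<phi>)) \<and>
        (\<forall>g\<in>H10 D.
           v t \<omega> \<bullet> g = v0 \<bullet> g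
             + (LINT s:{0..t}|lborel. elliptic_pairing D a b (u s \<omega>) g)
             - 2 * \<alpha> * (LINT s:{0..t}|lborel. v s \<omega> \<bullet> g)
             + (LINT s:{0..t}|lborel. f s \<omega> \<bullet> g)
             + M t \<omega> \<bullet> g))"

end

theory Submission
  imports Defs
begin

text \<open>
  Write \<open>c = lam / 2\<close> (this is the rate \<open>\<alpha>1\<close>) and \<open>w = v + lam u\<close>. Formally, the Ito formula gives
  \<open>d (\<parallel>B u\<parallel>\<^sup>2 + \<parallel>w\<parallel>\<^sup>2) = (- 2 lam \<parallel>B u\<parallel>\<^sup>2 - 2 (2 \<alpha> - lam) (w, w - lam u) + 2 (w, f) + Tr Q) dt + 2 (w, dM)\<close>:
  the terms \<open>(B u, B v)\<close> cancel because the coupling between \<open>u\<close> and \<open>v\<close> is skew. The spectral gap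
  \<open>4 \<alpha> lam \<le> \<eta>\<close> absorbs the cross term \<open>(w, u)\<close>, Young's inequality absorbs \<open>(w, f)\<close>, and the drift is at
  most \<open>- c e + (2 / c) \<parallel>f\<parallel>\<^sup>2 + Tr Q\<close>. Gronwall's lemma then yields the claim.

  Two things stand between this computation and a proof: \<open>A u\<close> and \<open>B v\<close> are not elements of \<open>H\<close>, and the
  expectation of the energy is not known to be finite.

  The first is cured by the resolvent \<open>R = (I + \<epsilon> B\<^sup>2)\<^sup>-\<^sup>1\<close>, obtained in the locale \<open>closed_selfadjoint\<close> by
  projecting on the graph of \<open>B\<close>. It commutes with \<open>B\<close>, and \<open>R\<close>, \<open>S = B R\<close> and \<open>K = (I - R) / \<epsilon> = B\<^sup>2 R\<close> are
  bounded, so that \<open>R u\<close> and \<open>R v\<close> solve the equation in \<open>H\<close>. Besides the spectral gap and \<open>\<parallel>R\<parallel> \<le> 1\<close>, the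
  energy computation rests on the identity \<open>S x \<bullet> S y = K x \<bullet> R y\<close> (locale \<open>regularized_wave\<close>). Testing the equation with elements of
  the range of \<open>R\<close> requires the pairing of \<open>A u\<close> with \<open>g\<close> to be \<open>- (B u, B g)\<close> only for \<open>g\<close> in the domain of
  \<open>A\<close>, where it is an integration by parts (\<open>elliptic_pairing_eq_sqrt\<close>).

  For the regularized equation, the Ito formula reduces to the martingale property. The process
  \<open>z = R w - R M\<close> is pathwise continuously differentiable, and in \<open>\<parallel>R w\<parallel>\<^sup>2 = \<parallel>z\<parallel>\<^sup>2 + 2 (z, R M) + \<parallel>R M\<parallel>\<^sup>2\<close> the first term is treated pathwise. In the
  second one, \<open>E (z' s, R M t) = E (z' s, R M s)\<close> for almost all \<open>s \<le> t\<close> by the martingale property, whence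
  \<open>E (z t, R M t)\<close> is the integral of \<open>E (z' s, R M s)\<close>. The third one is governed by
  \<open>E \<parallel>R M t\<parallel>\<^sup>2 - E \<parallel>R M s\<parallel>\<^sup>2 = E \<parallel>R (M t - M s)\<parallel>\<^sup>2 \<le> E \<parallel>M t - M s\<parallel>\<^sup>2\<close>, the integral of \<open>E (Tr Q)\<close> over \<open>[s, t]\<close>:
  the contraction \<open>R\<close> is discarded before traces are taken. Finiteness of all expectations follows from a
  crude pathwise Gronwall estimate for \<open>\<parallel>S u\<parallel>\<^sup>2 + \<parallel>z\<parallel>\<^sup>2\<close>, with a constant depending on \<open>\<epsilon>\<close>
  (\<open>smooth_energy_growth\<close>). The resulting bound (\<open>regularized_energy_estimate\<close>) is uniform in \<open>\<epsilon>\<close>, because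
  \<open>\<parallel>R\<parallel> \<le> 1\<close>, and Fatou's lemma lets \<open>\<epsilon>\<close> tend to \<open>0\<close>.

  The identity \<open>E \<parallel>M t\<parallel>\<^sup>2 = \<integral> E (Tr Q)\<close> (\<open>covariation_second_moment\<close>) is Parseval's identity combined with
  its scalar version \<open>bracket_second_moment\<close>, where the bracket is only known to compensate \<open>N\<^sup>2\<close> up to
  localization.
\<close>

section \<open>Orthogonal projections and orthonormal sequences\<close>

text \<open>
  A minimizing sequence for the distance to \<open>K\<close> is Cauchy by the parallelogram identity; at the
  minimizer, the first variation of the distance vanishes.
\<close>

lemma orthogonal_projection_exists:
  fixes K :: "'a::{real_inner, complete_space} set"
  assumes K: "subspace K" "closed K"
  obtains p where "p \<in> K" "\<And>k. k \<in> K \<Longrightarrow> (x - p) \<bullet> k = 0"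
proof -
  define d where "d = (INF k\<in>K. (norm (x - k))\<^sup>2)"
  have bdd: "bdd_below ((\<lambda>k. (norm (x - k))\<^sup>2) ` K)" by (rule bdd_belowI[of _ 0]) auto
  have ne: "K \<noteq> {}" using subspace_0[OF K(1)] by auto
  have dle: "d \<le> (norm (x - k))\<^sup>2" if "k \<in> K" for k
    unfolding d_def using bdd that by (rule cINF_lower)
  have "\<exists>k\<in>K. (norm (x - k))\<^sup>2 < d + 1 / (real n + 1)" for n :: nat
  proof (rule ccontr)
    assume "\<not> ?thesis"
    then have "d + 1 / (real n + 1) \<le> d"
      unfolding d_def[symmetric] by (subst (2) d_def, intro cINF_greatest ne) force
    then show False by (simp add: field_simps)
  qed
  then obtain y where y: "\<And>n. y n \<in> K" "\<And>n::nat. (norm (x - y n))\<^sup>2 < d + 1 / (real n + 1)" by metis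
  have par: "(norm (y m - y n))\<^sup>2 \<le> 2 / (real m + 1) + 2 / (real n + 1)" for m n
  proof -
    have "(norm (y m - y n))\<^sup>2 = 2 * (norm (x - y m))\<^sup>2 + 2 * (norm (x - y n))\<^sup>2
        - 4 * (norm (x - (1/2) *\<^sub>R (y m + y n)))\<^sup>2"
      by (simp add: power2_norm_eq_inner inner_diff inner_add inner_commute algebra_simps)
    moreover have "d \<le> (norm (x - (1/2) *\<^sub>R (y m + y n)))\<^sup>2"
      by (intro dle subspace_scale subspace_add K y)
    ultimately have "(norm (y m - y n))\<^sup>2 \<le> 2 * (d + 1 / (real m + 1)) + 2 * (d + 1 / (real n + 1)) - 4 * d"
      using less_imp_le[OF y(2)[of m]] less_imp_le[OF y(2)[of n]]
      by (simp only:) (intro diff_mono add_mono mult_left_mono; simp)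
    then show ?thesis by simp
  qed
  have "Cauchy y"
    unfolding Cauchy_iff
  proof (intro allI impI)
    fix e :: real assume e: "0 < e"
    obtain N :: nat where N: "4 / e\<^sup>2 < real N" using reals_Archimedean2 by blast
    show "\<exists>M. \<forall>m\<ge>M. \<forall>n\<ge>M. norm (y m - y n) < e"
    proof (intro exI allI impI)
      fix m n assume "N \<le> m" "N \<le> n"
      then have "2 / (real m + 1) \<le> 2 / (real N + 1)" "2 / (real n + 1) \<le> 2 / (real N + 1)"
        by (auto intro!: divide_left_mono mult_pos_pos)
      moreover have "4 / (real N + 1) < e\<^sup>2" using N e by (simp add: field_simps) (smt (verit) mult_pos_pos zero_less_power)
      ultimately have "(norm (y m - y n))\<^sup>2 < e\<^sup>2" using par[of m n] by simp
      then show "norm (y m - y n) < e" using e power_less_imp_less_base by fastforce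
    qed
  qed
  then obtain p where p: "y \<longlonglongrightarrow> p" using Cauchy_convergent convergent_def by blast
  have pK: "p \<in> K" by (rule closed_sequentially[OF K(2) y(1) p])
  have "(norm (x - p))\<^sup>2 \<le> d + 0"
  proof (rule LIMSEQ_le)
    show "(\<lambda>n. (norm (x - y n))\<^sup>2) \<longlonglongrightarrow> (norm (x - p))\<^sup>2" by (intro tendsto_intros p)
    have "(\<lambda>n. 1 / (real n + 1)) \<longlonglongrightarrow> 0"
      using LIMSEQ_inverse_real_of_nat by (simp add: inverse_eq_divide add.commute)
    then show "(\<lambda>n. d + 1 / (real n + 1)) \<longlonglongrightarrow> d + 0" by (intro tendsto_intros)
    show "\<exists>N. \<forall>n\<ge>N. (norm (x - y n))\<^sup>2 \<le> d + 1 / (real n + 1)" using y(2) less_imp_le by blast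
  qed
  then have min: "(norm (x - p))\<^sup>2 \<le> (norm (x - k))\<^sup>2" if "k \<in> K" for k
    using order_trans[OF _ dle[OF that]] by simp
  have "(x - p) \<bullet> k = 0" if k: "k \<in> K" for k
  proof (cases "k = 0")
    case False
    define t where "t = ((x - p) \<bullet> k) / (k \<bullet> k)"
    have kk: "k \<bullet> k > 0" using False by simp
    have "p + t *\<^sub>R k \<in> K" by (intro subspace_add subspace_scale K pK k)
    from min[OF this] have "(norm (x - p))\<^sup>2 \<le> (norm ((x - p) - t *\<^sub>R k))\<^sup>2" by (simp add: algebra_simps)
    also have "\<dots> = (norm (x - p))\<^sup>2 - 2 * t * ((x - p) \<bullet> k) + t\<^sup>2 * (k \<bullet> k)"
      by (simp only: power2_norm_eq_inner) (simp add: inner_diff inner_commute algebra_simps power2_eq_square)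
    also have "\<dots> = (norm (x - p))\<^sup>2 - ((x - p) \<bullet> k)\<^sup>2 / (k \<bullet> k)"
      using kk by (simp add: t_def power2_eq_square field_simps)
    finally have "((x - p) \<bullet> k)\<^sup>2 \<le> 0" using kk by (simp add: field_simps)
    then show ?thesis by simp
  qed simp
  with pK show thesis by (rule that)
qed

text \<open>
  A maximal orthonormal subset of \<open>H\<close> spans a dense subspace: otherwise the normalized difference
  between a point and its projection could be added. This makes the choice of a basis in \<^const>\<open>trace_on\<close>
  meaningful.
\<close>

lemma orthonormal_basis_on_exists:
  fixes H :: "'a::{real_inner, complete_space} set"
  assumes H: "subspace H" "closed H"
  shows "\<exists>E. orthonormal_basis_on H E"
proof -
  define A where "A = {E. E \<subseteq> H \<and> (\<forall>e\<in>E. norm e = 1) \<and> pairwise orthogonal E}"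
  have "\<forall>C\<in>chains A. \<Union>C \<in> A"
  proof
    fix C assume C: "C \<in> chains A"
    have "pairwise orthogonal (\<Union>C)"
    proof (rule pairwiseI)
      fix x y assume "x \<in> \<Union>C" "y \<in> \<Union>C" "x \<noteq> y"
      then obtain X Y where XY: "x \<in> X" "X \<in> C" "y \<in> Y" "Y \<in> C" by auto
      then have "X \<subseteq> Y \<or> Y \<subseteq> X" using C by (auto simp: chains_def chain_subset_def)
      moreover have "pairwise orthogonal X" "pairwise orthogonal Y" using XY C by (auto simp: chains_def A_def)
      ultimately show "orthogonal x y" using XY \<open>x \<noteq> y\<close> by (meson pairwiseD subsetD)
    qed
    then show "\<Union>C \<in> A" using C by (auto simp: chains_def A_def)
  qed
  from Zorn_Lemma[OF this] obtain E where E: "E \<in> A" and max: "\<And>X. X \<in> A \<Longrightarrow> E \<subseteq> X \<Longrightarrow> X = E" by blast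
  have E': "E \<subseteq> H" "\<forall>e\<in>E. norm e = 1" "pairwise orthogonal E" using E by (simp_all add: A_def)
  have EH: "closure (span E) \<subseteq> H" by (rule closure_minimal[OF span_minimal[OF E'(1) H(1)] H(2)])
  have "H \<subseteq> closure (span E)"
  proof
    fix x assume x: "x \<in> H"
    obtain p where p: "p \<in> closure (span E)" "\<And>k. k \<in> closure (span E) \<Longrightarrow> (x - p) \<bullet> k = 0"
      by (rule orthogonal_projection_exists[of "closure (span E)" x]) (auto intro: subspace_closure)
    show "x \<in> closure (span E)"
    proof (rule ccontr)
      assume "x \<notin> closure (span E)"
      then have xp: "x - p \<noteq> 0" using p(1) by auto
      define y where "y = (x - p) /\<^sub>R norm (x - p)"
      have orth: "y \<bullet> k = 0" if "k \<in> E" for k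
      proof -
        have "k \<in> closure (span E)" using that closure_subset span_base by blast
        from p(2)[OF this] show ?thesis by (simp add: y_def)
      qed
      have y1: "norm y = 1" using xp by (simp add: y_def)
      have "y \<in> H" unfolding y_def using x p(1) EH by (intro subspace_scale subspace_diff H) auto
      then have "insert y E \<in> A"
        using E' y1 orth unfolding A_def by (auto simp: pairwise_insert orthogonal_def inner_commute)
      then have "y \<in> E" using max[of "insert y E"] by blast
      then have "y \<bullet> y = 0" by (rule orth)
      then show False using y1 by simp
    qed
  qed
  then have "closure (span E) = H" using EH by (rule antisym[rotated])
  with E' show ?thesis unfolding orthonormal_basis_on_def by blast
qed

text \<open>
  The balls of radius \<open>1 / 2\<close> around orthonormal vectors are disjoint.
\<close>

lemma countable_orthonormal:
  fixes E :: "'a::{real_inner, second_countable_topology} set"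
  assumes "\<forall>e\<in>E. norm e = 1" "pairwise orthogonal E"
  shows "countable E"
proof -
  have far: "dist x y > 1" if "x \<in> E" "y \<in> E" "x \<noteq> y" for x y
  proof -
    have "x \<bullet> y = 0" using assms(2) that by (auto simp: pairwise_def orthogonal_def)
    then have "(norm (x - y))\<^sup>2 = 2"
      using assms(1) that by (simp add: power2_norm_eq_inner inner_diff inner_commute norm_eq_sqrt_inner)
    then have "1 < (norm (x - y))\<^sup>2" by simp
    then show ?thesis unfolding dist_norm by (smt (verit) norm_ge_zero power_le_one)
  qed
  have disj: "disjoint ((\<lambda>e. ball e (1/2)) ` E)"
  proof (clarsimp simp: disjoint_def pairwise_def)
    fix x y assume xy: "x \<in> E" "y \<in> E" "ball x (1/2) \<noteq> ball y (1/2)"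
    then have "1 < dist x y" using far by auto
    then show "disjnt (ball x (1/2)) (ball y (1/2))"
      by (auto simp: disjnt_iff) (smt (verit) dist_commute dist_triangle field_sum_of_halves)
  qed
  have "countable ((\<lambda>e. ball e (1/2)) ` E)"
    by (rule countable_disjoint_open_subsets) (use disj in auto)
  moreover have "inj_on (\<lambda>e. ball e (1/2)) E"
  proof (rule inj_onI)
    fix x y assume xy: "x \<in> E" "y \<in> E" "ball x (1/2) = ball y (1/2)"
    then have "x \<in> ball y (1/2)" by (metis centre_in_ball half_gt_zero zero_less_one)
    then show "x = y" using far[of x y] xy by (force simp: dist_commute)
  qed
  ultimately show ?thesis by (rule countable_image_inj_on)
qed

text \<open>
  Zero vectors are admitted, so that finite and infinite bases can be enumerated by the same index
  set \<open>\<nat>\<close>; they contribute nothing to the expansions below.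
\<close>

definition orthonormal_seq :: "'a::real_inner set \<Rightarrow> (nat \<Rightarrow> 'a) \<Rightarrow> bool" where
  "orthonormal_seq H e \<longleftrightarrow> (\<forall>n. e n = 0 \<or> norm (e n) = 1) \<and> (\<forall>m n. m \<noteq> n \<longrightarrow> e m \<bullet> e n = 0)
    \<and> closure (span (range e)) = H"

lemma orthonormal_basis_on_enumerate:
  fixes E :: "'a::{real_inner, second_countable_topology} set"
  assumes E: "orthonormal_basis_on H E"
  obtains e where "orthonormal_seq H e"
    "\<And>g :: 'a \<Rightarrow> ennreal. g 0 = 0 \<Longrightarrow> (\<Sum>\<^sub>\<infinity>x\<in>E. g x) = (\<Sum>n. g (e n))"
proof -
  have n1: "norm x = 1" if "x \<in> E" for x using E that by (auto simp: orthonormal_basis_on_def)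
  have cE: "countable E" using E by (auto simp: orthonormal_basis_on_def intro: countable_orthonormal)
  define I where "I = to_nat_on E ` E"
  define e where "e n = (if n \<in> I then from_nat_into E n else 0)" for n
  have eI: "e (to_nat_on E x) = x" if "x \<in> E" for x using that cE by (auto simp: e_def I_def)
  have eE: "e n \<in> E" if "n \<in> I" for n using that cE by (auto simp: e_def I_def)
  have inj: "m = n" if "m \<in> I" "n \<in> I" "e m = e n" for m n
    using that cE by (auto simp: e_def I_def)
  have sp: "span (range e) = span E"
  proof (rule span_eq[THEN iffD2], intro conjI)
    show "range e \<subseteq> span E"
    proof
      fix x assume "x \<in> range e"
      then obtain n where "x = e n" by auto
      then show "x \<in> span E" using eE[of n] by (cases "n \<in> I") (auto simp: span_base span_zero e_def)
    qed
    show "E \<subseteq> span (range e)" by (metis eI rangeI span_base subsetI)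
  qed
  have "e m \<bullet> e n = 0" if "m \<noteq> n" for m n
  proof (cases "m \<in> I \<and> n \<in> I")
    case True
    then have "e m \<noteq> e n" "e m \<in> E" "e n \<in> E" using inj that eE by auto
    then show ?thesis using E by (auto simp: orthonormal_basis_on_def pairwise_def orthogonal_def)
  qed (auto simp: e_def)
  then have "orthonormal_seq H e"
    using E eE n1 unfolding orthonormal_seq_def sp
    by (auto simp: orthonormal_basis_on_def e_def split: if_splits)
  moreover have "(\<Sum>\<^sub>\<infinity>x\<in>E. g x) = (\<Sum>n. g (e n))" if g: "g 0 = 0" for g :: "'a \<Rightarrow> ennreal"
  proof -
    have "(\<Sum>\<^sub>\<infinity>x\<in>E. g x) = (\<Sum>\<^sub>\<infinity>x\<in>E. (g \<circ> e) (to_nat_on E x))"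
      by (intro infsum_cong) (simp add: eI)
    also have "\<dots> = (\<Sum>\<^sub>\<infinity>n\<in>I. (g \<circ> e) n)"
      unfolding I_def using cE by (subst infsum_reindex) (auto simp: comp_def)
    also have "\<dots> = (\<Sum>\<^sub>\<infinity>n\<in>UNIV. (g \<circ> e) n)"
      by (intro infsum_cong_neutral) (auto simp: e_def g)
    also have "\<dots> = (\<Sum>n. (g \<circ> e) n)"
      by (rule sums_unique[OF has_sum_imp_sums[OF has_sum_infsum]]) (simp add: nonneg_summable_on_complete)
    finally show ?thesis by (simp add: comp_def)
  qed
  ultimately show thesis by (rule that)
qed

lemma orthonormal_seq_partial_sum:
  assumes e: "orthonormal_seq H e" and y: "y \<in> span (e ` {..<n})"
  shows "(x - (\<Sum>k<n. (x \<bullet> e k) *\<^sub>R e k)) \<bullet> y = 0"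
proof -
  have ee: "e k \<bullet> e j = (if k = j then (if e j = 0 then 0 else 1) else 0)" for k j
    using e by (auto simp: orthonormal_seq_def norm_eq_sqrt_inner)
  show ?thesis
    using y
  proof (induction rule: span_induct_alt)
    case (step c v y)
    then obtain j where j: "v = e j" "j < n" by auto
    have "(\<Sum>k<n. (x \<bullet> e k) * (e k \<bullet> e j)) = (x \<bullet> e j) * (e j \<bullet> e j)"
      using j(2) by (subst sum.remove[of _ j]) (auto simp: ee)
    then have "(x - (\<Sum>k<n. (x \<bullet> e k) *\<^sub>R e k)) \<bullet> v = 0"
      by (auto simp: j inner_diff_left inner_sum_left ee)
    then show ?case using step by (simp add: inner_add_right)
  qed simp
qed

text \<open>
  The partial sums are the best approximations from the spans of the first \<open>n\<close> vectors, and the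
  union of these spans is dense.
\<close>

lemma orthonormal_expansion:
  assumes e: "orthonormal_seq H e" and x: "x \<in> H"
  shows "(\<lambda>k. (x \<bullet> e k) *\<^sub>R e k) sums x"
proof -
  define S where "S n = (\<Sum>k<n. (x \<bullet> e k) *\<^sub>R e k)" for n
  have Ssp: "S n \<in> span (e ` {..<n})" for n
    unfolding S_def by (intro span_sum span_scale span_base) auto
  have best: "norm (x - S n) \<le> norm (x - y)" if y: "y \<in> span (e ` {..<n})" for n y
  proof -
    have "S n - y \<in> span (e ` {..<n})" using Ssp y by (rule span_diff)
    then have "(x - S n) \<bullet> (S n - y) = 0" unfolding S_def by (rule orthonormal_seq_partial_sum[OF e])
    then have "(norm ((x - S n) + (S n - y)))\<^sup>2 = (norm (x - S n))\<^sup>2 + (norm (S n - y))\<^sup>2"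
      by (intro norm_add_Pythagorean) (simp add: orthogonal_def)
    then have "(norm (x - S n))\<^sup>2 \<le> (norm (x - y))\<^sup>2" by simp
    then show ?thesis by (rule power2_le_imp_le) simp
  qed
  have "S \<longlonglongrightarrow> x"
  proof (rule LIMSEQ_I)
    fix r :: real assume r: "0 < r"
    have "x \<in> closure (span (range e))" using e x by (simp add: orthonormal_seq_def)
    then obtain y where y: "y \<in> span (range e)" "dist y x < r"
      using r unfolding closure_approachable by blast
    then obtain F c where "finite F" "F \<subseteq> range e" "y = (\<Sum>a\<in>F. c a *\<^sub>R a)"
      using y(1) by (simp only: span_explicit mem_Collect_eq) (elim exE conjE)
    then have F: "finite F" "F \<subseteq> range e" "y \<in> span F"
      by (simp_all add: span_sum span_scale span_base)
    from finite_subset_image[OF F(1,2)] obtain J where J: "finite J" "F = e ` J" by blast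
    define N where "N = Suc (Max (insert 0 J))"
    show "\<exists>no. \<forall>n\<ge>no. norm (S n - x) < r"
    proof (intro exI allI impI)
      fix n assume n: "N \<le> n"
      have "F \<subseteq> e ` {..<n}"
      proof
        fix y assume "y \<in> F"
        then obtain j where j: "j \<in> J" "y = e j" using J by auto
        then have "j \<le> Max (insert 0 J)" using J by (intro Max_ge) auto
        then show "y \<in> e ` {..<n}" using j n by (auto simp: N_def)
      qed
      then have "y \<in> span (e ` {..<n})" using F span_mono by blast
      from best[OF this] show "norm (S n - x) < r" using y(2) by (simp add: dist_norm norm_minus_commute)
    qed
  qed
  then show ?thesis by (simp add: sums_def S_def[abs_def])
qed

lemma orthonormal_parseval:
  assumes e: "orthonormal_seq H e" and x: "x \<in> H"
  shows "(\<lambda>k. (x \<bullet> e k) * (y \<bullet> e k)) sums (x \<bullet> y)"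
    and "(\<Sum>k. ennreal ((x \<bullet> e k)\<^sup>2)) = ennreal ((norm x)\<^sup>2)"
proof -
  have 1: "(\<lambda>k. (x \<bullet> e k) * (y \<bullet> e k)) sums (x \<bullet> y)" for y
    using bounded_linear.sums[OF bounded_linear_inner_left[of y] orthonormal_expansion[OF e x]]
    by (simp add: inner_commute)
  then show "(\<lambda>k. (x \<bullet> e k) * (y \<bullet> e k)) sums (x \<bullet> y)" .
  have "(\<lambda>k. (x \<bullet> e k)\<^sup>2) sums (norm x)\<^sup>2"
    using 1[of x] by (simp add: power2_norm_eq_inner) (simp add: power2_eq_square)
  then have "(\<lambda>k. ennreal ((x \<bullet> e k)\<^sup>2)) sums ennreal ((norm x)\<^sup>2)"
    by (subst sums_ennreal) auto
  then show "(\<Sum>k. ennreal ((x \<bullet> e k)\<^sup>2)) = ennreal ((norm x)\<^sup>2)" by (rule sums_unique[symmetric])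
qed

lemma orthonormal_bessel:
  assumes e: "orthonormal_seq H e"
  shows "(norm (\<Sum>k<n. (x \<bullet> e k) *\<^sub>R e k))\<^sup>2 \<le> (norm x)\<^sup>2"
proof -
  let ?S = "\<Sum>k<n. (x \<bullet> e k) *\<^sub>R e k"
  have "?S \<in> span (e ` {..<n})" by (intro span_sum span_scale span_base) auto
  then have "(x - ?S) \<bullet> ?S = 0" by (rule orthonormal_seq_partial_sum[OF e])
  then have "(norm ((x - ?S) + ?S))\<^sup>2 = (norm (x - ?S))\<^sup>2 + (norm ?S)\<^sup>2"
    by (intro norm_add_Pythagorean) (simp add: orthogonal_def)
  then show ?thesis by simp
qed

section \<open>The resolvent of a squared self-adjoint operator\<close>

text \<open>
  The operator \<open>(I + \<epsilon> B\<^sup>2)\<^sup>-\<^sup>1\<close> in weak form. This defines it on the whole space, not only on the subspace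
  \<open>H\<close> in which \<open>B\<close> is self-adjoint: there it is preceded by the orthogonal projection onto \<open>H\<close>.
\<close>

definition resolvent :: "'h::real_inner set \<Rightarrow> ('h \<Rightarrow> 'h) \<Rightarrow> real \<Rightarrow> 'h \<Rightarrow> 'h" where
  "resolvent V B \<epsilon> h = (THE x. x \<in> V \<and> (\<forall>g\<in>V. x \<bullet> g + \<epsilon> * (B x \<bullet> B g) = h \<bullet> g))"

locale closed_selfadjoint =
  fixes H V :: "'h::{real_inner, complete_space} set" and B :: "'h \<Rightarrow> 'h"
  assumes selfadjoint: "selfadjoint_on H V B" and closed_H: "closed H" and subspace_H: "subspace H"
begin

lemma subspace_V: "subspace V" and V_le_H: "V \<subseteq> H" and dense_V: "H \<subseteq> closure V"
  and B_in_H: "x \<in> V \<Longrightarrow> B x \<in> H"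
  and B_add: "x \<in> V \<Longrightarrow> y \<in> V \<Longrightarrow> B (x + y) = B x + B y"
  and B_scale: "x \<in> V \<Longrightarrow> B (c *\<^sub>R x) = c *\<^sub>R B x"
  using selfadjoint by (auto simp: selfadjoint_on_def)

lemma adjoint_iff:
  "y \<in> H \<Longrightarrow> z \<in> H \<Longrightarrow> (y \<in> V \<and> z = B y) \<longleftrightarrow> (\<forall>x\<in>V. B x \<bullet> y = x \<bullet> z)"
  using selfadjoint unfolding selfadjoint_on_def by blast

lemma B_sym: "x \<in> V \<Longrightarrow> y \<in> V \<Longrightarrow> B x \<bullet> y = x \<bullet> B y"
  using adjoint_iff[of y "B y"] V_le_H B_in_H by blast

lemma B_diff: "x \<in> V \<Longrightarrow> y \<in> V \<Longrightarrow> B (x - y) = B x - B y"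
  using B_add[of x "- y"] B_scale[of y "-1"] subspace_neg[OF subspace_V, of y] by simp

lemma closed_graph: "closed ((\<lambda>x. (x, c *\<^sub>R B x)) ` V)" if "c \<noteq> 0"
  unfolding closed_sequential_limits
proof (intro allI impI, elim conjE)
  fix s l assume s: "\<forall>n. s n \<in> (\<lambda>x. (x, c *\<^sub>R B x)) ` V" and l: "s \<longlonglongrightarrow> l"
  obtain x where x: "\<And>n. x n \<in> V" "\<And>n. s n = (x n, c *\<^sub>R B (x n))" using s by (auto simp: image_iff) metis
  obtain y w where yw: "l = (y, w)" by (cases l)
  have "x \<longlonglongrightarrow> y" using tendsto_fst[OF l] by (simp add: x yw)
  moreover have "(\<lambda>n. (1 / c) *\<^sub>R (c *\<^sub>R B (x n))) \<longlonglongrightarrow> (1 / c) *\<^sub>R w"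
    using tendsto_snd[OF l] by (intro tendsto_intros) (simp add: x yw)
  ultimately have lim: "x \<longlonglongrightarrow> y" "(\<lambda>n. B (x n)) \<longlonglongrightarrow> (1 / c) *\<^sub>R w" using that by simp_all
  have H: "y \<in> H" "(1 / c) *\<^sub>R w \<in> H"
    using closed_sequentially[OF closed_H _ lim(1)] closed_sequentially[OF closed_H _ lim(2)] x(1) V_le_H B_in_H
    by auto
  have "\<forall>g\<in>V. B g \<bullet> y = g \<bullet> ((1 / c) *\<^sub>R w)"
  proof
    fix g assume g: "g \<in> V"
    have "(\<lambda>n. B g \<bullet> x n) \<longlonglongrightarrow> B g \<bullet> y" "(\<lambda>n. g \<bullet> B (x n)) \<longlonglongrightarrow> g \<bullet> ((1 / c) *\<^sub>R w)"
      by (intro tendsto_intros lim)+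
    then show "B g \<bullet> y = g \<bullet> ((1 / c) *\<^sub>R w)" using B_sym[OF g x(1)] LIMSEQ_unique by simp
  qed
  then have "y \<in> V" "(1 / c) *\<^sub>R w = B y" using adjoint_iff[OF H] by auto
  then show "l \<in> (\<lambda>x. (x, c *\<^sub>R B x)) ` V"
    using that by (auto simp: yw intro!: image_eqI[of _ _ y] dest: arg_cong[of _ _ "\<lambda>z. c *\<^sub>R z"])
qed

text \<open>
  The graph of \<open>\<surd>\<epsilon> B\<close> is a closed subspace of the product space. Projecting \<open>(h, 0)\<close> onto it gives
  \<open>(x, \<surd>\<epsilon> B x)\<close>, and orthogonality of the difference to \<open>(g, \<surd>\<epsilon> B g)\<close> is the weak equation.
\<close>

lemma resolvent_ex1:
  assumes e: "0 < \<epsilon>"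
  shows "\<exists>!x. x \<in> V \<and> (\<forall>g\<in>V. x \<bullet> g + \<epsilon> * (B x \<bullet> B g) = h \<bullet> g)"
proof -
  define d where "d = sqrt \<epsilon>"
  have d: "d \<noteq> 0" "d * d = \<epsilon>" using e by (auto simp: d_def)
  let ?G = "(\<lambda>x. (x, d *\<^sub>R B x)) ` V"
  have "subspace ?G"
  proof (rule subspaceI)
    have 0: "0 \<in> V" by (rule subspace_0[OF subspace_V])
    have "B 0 = 0" using B_scale[OF 0, of 0] by simp
    then show "0 \<in> ?G" using 0 by (intro image_eqI[of _ _ 0]) (auto simp: zero_prod_def)
  next
    fix x y assume "x \<in> ?G" "y \<in> ?G"
    then show "x + y \<in> ?G"
      using subspace_add[OF subspace_V] by (force simp: B_add scaleR_add_right)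
  next
    fix c x assume "x \<in> ?G"
    then show "c *\<^sub>R x \<in> ?G"
      using subspace_scale[OF subspace_V] by (force simp: B_scale)
  qed
  then obtain p where p: "p \<in> ?G" "\<And>k. k \<in> ?G \<Longrightarrow> ((h, 0) - p) \<bullet> k = 0"
    using orthogonal_projection_exists[OF _ closed_graph[OF d(1)], of "(h, 0)"] by metis
  obtain x where x: "x \<in> V" "p = (x, d *\<^sub>R B x)" using p(1) by auto
  have "x \<bullet> g + \<epsilon> * (B x \<bullet> B g) = h \<bullet> g" if g: "g \<in> V" for g
  proof -
    have "((h, 0) - p) \<bullet> (g, d *\<^sub>R B g) = 0" by (rule p(2)) (use g in auto)
    then show ?thesis using d(2)[symmetric] by (simp add: x(2) inner_diff_left mult.assoc)
  qed
  moreover have "y = z" if y: "y \<in> V" "\<forall>g\<in>V. y \<bullet> g + \<epsilon> * (B y \<bullet> B g) = h \<bullet> g"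
    and z: "z \<in> V" "\<forall>g\<in>V. z \<bullet> g + \<epsilon> * (B z \<bullet> B g) = h \<bullet> g" for y z
  proof -
    have yz: "y - z \<in> V" using y z subspace_V by (simp add: subspace_diff)
    have "(y - z) \<bullet> (y - z) + \<epsilon> * (B (y - z) \<bullet> B (y - z)) = 0"
      using y(2)[rule_format, OF yz] z(2)[rule_format, OF yz] y(1) z(1)
      by (simp only: B_diff inner_diff_left) (simp add: algebra_simps)
    moreover have "0 \<le> \<epsilon> * (B (y - z) \<bullet> B (y - z))" "0 \<le> (y - z) \<bullet> (y - z)" using e by simp_all
    ultimately have "(y - z) \<bullet> (y - z) = 0" by linarith
    then show ?thesis by simp
  qed
  ultimately show ?thesis using x(1) by blast
qed

context
  fixes \<epsilon> :: real
  assumes eps: "0 < \<epsilon>"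
begin

lemma resolvent_in_V: "resolvent V B \<epsilon> h \<in> V"
  and resolvent_weak: "g \<in> V \<Longrightarrow>
    resolvent V B \<epsilon> h \<bullet> g + \<epsilon> * (B (resolvent V B \<epsilon> h) \<bullet> B g) = h \<bullet> g"
  using theI'[OF resolvent_ex1[OF eps, of h]] unfolding resolvent_def by blast+

lemma resolvent_eqI:
  assumes "x \<in> V" "\<And>g. g \<in> V \<Longrightarrow> x \<bullet> g + \<epsilon> * (B x \<bullet> B g) = h \<bullet> g"
  shows "resolvent V B \<epsilon> h = x"
  using resolvent_ex1[OF eps, of h] resolvent_in_V resolvent_weak assms by blast

lemma resolvent_energy:
  "(norm (resolvent V B \<epsilon> h))\<^sup>2 + \<epsilon> * (norm (B (resolvent V B \<epsilon> h)))\<^sup>2 = h \<bullet> resolvent V B \<epsilon> h"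
  using resolvent_weak[OF resolvent_in_V, of h h] by (simp add: power2_norm_eq_inner)

lemma norm_resolvent_le: "norm (resolvent V B \<epsilon> h) \<le> norm h"
proof -
  have "(norm (resolvent V B \<epsilon> h))\<^sup>2 \<le> h \<bullet> resolvent V B \<epsilon> h"
    using resolvent_energy[of h] eps by (smt (verit) mult_nonneg_nonneg zero_le_power2)
  also have "\<dots> \<le> norm h * norm (resolvent V B \<epsilon> h)" by (rule norm_cauchy_schwarz)
  finally show ?thesis by (cases "resolvent V B \<epsilon> h = 0") (auto simp: power2_eq_square)
qed

lemma norm_B_resolvent_le: "norm (B (resolvent V B \<epsilon> h)) \<le> norm h * (1 / sqrt \<epsilon>)"
proof -
  have "\<epsilon> * (norm (B (resolvent V B \<epsilon> h)))\<^sup>2 \<le> h \<bullet> resolvent V B \<epsilon> h"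
    using resolvent_energy[of h] by (smt (verit) zero_le_power2)
  also have "\<dots> \<le> norm h * norm (resolvent V B \<epsilon> h)" by (rule norm_cauchy_schwarz)
  also have "\<dots> \<le> norm h * norm h" by (intro mult_left_mono norm_resolvent_le) simp
  finally have "(norm (B (resolvent V B \<epsilon> h)))\<^sup>2 \<le> (norm h * (1 / sqrt \<epsilon>))\<^sup>2"
    using eps by (simp add: field_simps power2_eq_square)
  then show ?thesis using eps by (auto intro: power2_le_imp_le)
qed

lemma resolvent_add: "resolvent V B \<epsilon> (h + k) = resolvent V B \<epsilon> h + resolvent V B \<epsilon> k"
proof (rule resolvent_eqI)
  fix g assume "g \<in> V"
  then show "(resolvent V B \<epsilon> h + resolvent V B \<epsilon> k) \<bullet> g + \<epsilon> * (B (resolvent V B \<epsilon> h + resolvent V B \<epsilon> k) \<bullet> B g)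
      = (h + k) \<bullet> g"
    using resolvent_weak[of g h] resolvent_weak[of g k]
    by (simp add: B_add resolvent_in_V inner_add_left algebra_simps)
qed (intro subspace_add subspace_V resolvent_in_V)

lemma resolvent_scale: "resolvent V B \<epsilon> (c *\<^sub>R h) = c *\<^sub>R resolvent V B \<epsilon> h"
proof (rule resolvent_eqI)
  fix g assume "g \<in> V"
  then show "(c *\<^sub>R resolvent V B \<epsilon> h) \<bullet> g + \<epsilon> * (B (c *\<^sub>R resolvent V B \<epsilon> h) \<bullet> B g) = (c *\<^sub>R h) \<bullet> g"
    using arg_cong[OF resolvent_weak[of g h], of "\<lambda>x. c * x"]
    by (simp add: B_scale resolvent_in_V algebra_simps)
qed (intro subspace_scale subspace_V resolvent_in_V)

lemma bounded_linear_resolvent: "bounded_linear (resolvent V B \<epsilon>)"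
  using norm_resolvent_le by (intro bounded_linear_intro[where K=1] resolvent_add resolvent_scale) simp

lemma bounded_linear_B_resolvent: "bounded_linear (\<lambda>h. B (resolvent V B \<epsilon> h))"
  by (intro bounded_linear_intro[where K="1 / sqrt \<epsilon>"] norm_B_resolvent_le)
    (simp_all add: resolvent_add resolvent_scale B_add B_scale resolvent_in_V)

lemma resolvent_sym: "resolvent V B \<epsilon> h \<bullet> k = h \<bullet> resolvent V B \<epsilon> k"
  using resolvent_weak[OF resolvent_in_V, of h k] resolvent_weak[OF resolvent_in_V, of k h]
  by (simp add: inner_commute)

text \<open>
  The weak equation says that \<open>B (R h)\<close> belongs to the domain of the adjoint of \<open>B\<close>, which is \<open>B\<close>
  itself.
\<close>

lemma B_resolvent_eq:
  assumes h: "h \<in> H"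
  shows "B (resolvent V B \<epsilon> h) \<in> V" (is "?b \<in> V")
    and "B (B (resolvent V B \<epsilon> h)) = (1 / \<epsilon>) *\<^sub>R (h - resolvent V B \<epsilon> h)" (is "_ = ?k")
proof -
  have H: "?b \<in> H" "?k \<in> H"
    using B_in_H resolvent_in_V V_le_H h by (auto intro!: subspace_scale subspace_diff subspace_H)
  have "\<forall>x\<in>V. B x \<bullet> ?b = x \<bullet> ?k"
  proof
    fix g assume "g \<in> V"
    from resolvent_weak[OF this, of h] eps show "B g \<bullet> ?b = g \<bullet> ?k"
      by (simp add: inner_diff_right field_simps inner_commute)
  qed
  then show "?b \<in> V" "B ?b = ?k" using adjoint_iff[OF H] by auto
qed

lemma resolvent_B_commute:
  assumes h: "h \<in> V"
  shows "B (resolvent V B \<epsilon> h) = resolvent V B \<epsilon> (B h)"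
proof -
  note R = B_resolvent_eq[OF subsetD[OF V_le_H h]]
  have d: "h - resolvent V B \<epsilon> h \<in> V" by (intro subspace_diff subspace_V h resolvent_in_V)
  have "resolvent V B \<epsilon> (B h) = B (resolvent V B \<epsilon> h)"
  proof (rule resolvent_eqI)
    fix g assume g: "g \<in> V"
    have "\<epsilon> * (B (B (resolvent V B \<epsilon> h)) \<bullet> B g) = (h - resolvent V B \<epsilon> h) \<bullet> B g"
      using eps by (simp add: R(2))
    also have "\<dots> = (B h - B (resolvent V B \<epsilon> h)) \<bullet> g"
      using B_sym[OF d g] by (simp add: B_diff h resolvent_in_V)
    finally show "B (resolvent V B \<epsilon> h) \<bullet> g + \<epsilon> * (B (B (resolvent V B \<epsilon> h)) \<bullet> B g) = B h \<bullet> g"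
      by (simp add: inner_diff_left)
  qed (rule R(1))
  then show ?thesis by simp
qed

text \<open>
  Testing the weak equation with \<open>h - R h\<close> shows \<open>\<parallel>h - R h\<parallel>\<^sup>2 = \<epsilon> (B R h, B (h - R h))\<close>, and
  \<open>\<parallel>B R h\<parallel> = \<parallel>R B h\<parallel> \<le> \<parallel>B h\<parallel>\<close>.
\<close>

lemma norm_resolvent_diff_le:
  assumes h: "h \<in> V"
  shows "norm (h - resolvent V B \<epsilon> h) \<le> sqrt \<epsilon> * norm (B h)"
proof -
  let ?x = "resolvent V B \<epsilon> h" and ?r = "h - resolvent V B \<epsilon> h"
  have r: "?r \<in> V" by (intro subspace_diff subspace_V h resolvent_in_V)
  have "(norm ?r)\<^sup>2 = \<epsilon> * (B ?x \<bullet> B ?r)"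
    using resolvent_weak[OF r, of h] by (simp add: power2_norm_eq_inner inner_diff_left)
  also have "B ?x \<bullet> B ?r \<le> (norm (B h))\<^sup>2"
  proof -
    have "norm (B ?x) \<le> norm (B h)" using norm_resolvent_le[of "B h"] by (simp add: resolvent_B_commute h)
    moreover have "B ?x \<bullet> B h \<le> norm (B ?x) * norm (B h)" by (rule norm_cauchy_schwarz)
    ultimately have "B ?x \<bullet> B h \<le> norm (B h) * norm (B h)"
      by (meson mult_right_mono norm_ge_zero order_trans)
    moreover have "B ?x \<bullet> B ?r = B ?x \<bullet> B h - B ?x \<bullet> B ?x"
      by (simp add: B_diff h resolvent_in_V eps inner_diff_right)
    ultimately show ?thesis
      using inner_ge_zero[of "B ?x"] unfolding power2_eq_square by linarith
  qed
  finally have "(norm ?r)\<^sup>2 \<le> (sqrt \<epsilon> * norm (B h))\<^sup>2"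
    using eps by (simp add: power_mult_distrib mult_left_mono)
  then show ?thesis by (rule power2_le_imp_le) (simp add: less_imp_le[OF eps])
qed

end

text \<open>
  Convergence on the domain of \<open>B\<close> extends to its closure because resolvents are contractions.
\<close>

lemma resolvent_tendsto:
  assumes h: "h \<in> H"
  shows "(\<lambda>n. resolvent V B (1 / Suc n) h) \<longlonglongrightarrow> h"
proof (rule LIMSEQ_I)
  fix r :: real assume r: "0 < r"
  obtain g where g: "g \<in> V" "dist g h < r / 4"
    using dense_V h r unfolding closure_approachable subset_iff by (metis divide_pos_pos zero_less_numeral)
  have "(\<lambda>n. sqrt (1 / Suc n) * norm (B g)) \<longlonglongrightarrow> sqrt 0 * norm (B g)"
    using LIMSEQ_inverse_real_of_nat by (intro tendsto_intros tendsto_real_sqrt) (simp add: inverse_eq_divide)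
  then have "\<forall>\<^sub>F n in sequentially. sqrt (1 / Suc n) * norm (B g) < r / 4"
    using r by (intro order_tendstoD(2)[where y="sqrt 0 * norm (B g)"]) auto
  then obtain N where N: "\<And>n. n \<ge> N \<Longrightarrow> sqrt (1 / Suc n) * norm (B g) < r / 4"
    unfolding eventually_sequentially by blast
  show "\<exists>N. \<forall>n\<ge>N. norm (resolvent V B (1 / Suc n) h - h) < r"
  proof (intro exI allI impI)
    fix n assume n: "N \<le> n"
    have e: "0 < 1 / real (Suc n)" by simp
    let ?R = "resolvent V B (1 / Suc n)"
    have "norm (?R h - h) \<le> norm (?R h - ?R g) + norm (?R g - g) + norm (g - h)"
      using norm_triangle_ineq[of "(?R h - ?R g) + (?R g - g)" "g - h"]
        norm_triangle_ineq[of "?R h - ?R g" "?R g - g"] by simp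
    moreover have "norm (?R h - ?R g) \<le> norm (g - h)"
      using norm_resolvent_le[OF e, of "h - g"] linear_diff[OF bounded_linear.linear[OF bounded_linear_resolvent[OF e]], of h g]
      by (simp add: norm_minus_commute)
    moreover have "norm (?R g - g) < r / 4"
      using norm_resolvent_diff_le[OF e g(1)] N[OF n] by (simp add: norm_minus_commute)
    ultimately show "norm (?R h - h) < r" using g(2) r by (simp add: dist_norm)
  qed
qed

end

section \<open>The elliptic form and the square root of the elliptic operator\<close>

lemma
  fixes D :: "'a::euclidean_space set"
  assumes w: "(\<lambda>x. indicator D x * c x) \<in> borel_measurable borel"
    and C: "\<And>x. \<bar>indicator D x * c x\<bar> \<le> C"
  shows square_integrable_mult_on: "square_integrable f \<Longrightarrow> square_integrable (\<lambda>x. indicator D x * (c x * f x))"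
    and inner_mult_on_commute: "mult_on D c u \<bullet> v = u \<bullet> mult_on D c v"
    and bounded_linear_mult_on: "bounded_linear (mult_on D c)"
    and mult_on_in_L2_on: "mult_on D c u \<in> L2_on D"
proof -
  note [measurable] = w
  have C0: "0 \<le> C" using C[of undefined] by (meson abs_ge_zero order_trans)
  have le: "(indicator D x * (c x * y))\<^sup>2 \<le> C\<^sup>2 * y\<^sup>2" for x and y :: real
  proof -
    have "(indicator D x * c x)\<^sup>2 \<le> C\<^sup>2" using C[of x] C0 by (simp only: abs_le_square_iff[symmetric] abs_of_nonneg)
    then have "(indicator D x * c x)\<^sup>2 * y\<^sup>2 \<le> C\<^sup>2 * y\<^sup>2" by (rule mult_right_mono) simp
    then show ?thesis by (simp add: power_mult_distrib mult.assoc)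
  qed
  show sq: "square_integrable (\<lambda>x. indicator D x * (c x * f x))" if f: "square_integrable f" for f
  proof -
    have [measurable]: "f \<in> borel_measurable borel" using f by (simp add: square_integrable_def)
    have m: "(\<lambda>x. indicator D x * c x * f x) \<in> borel_measurable borel" by measurable
    have "integrable lborel (\<lambda>x. C\<^sup>2 * (f x)\<^sup>2)" using f by (simp add: square_integrable_def)
    then have "integrable lborel (\<lambda>x. (indicator D x * (c x * f x))\<^sup>2)"
      by (rule Bochner_Integration.integrable_bound) (use m le in \<open>auto simp: mult.assoc\<close>)
    then show ?thesis using m by (simp add: square_integrable_def mult.assoc)
  qed
  have inner: "mult_on D c u \<bullet> v = (LINT x|lborel. indicator D x * c x * (rep_L2 u x * rep_L2 v x))" for u v
    using inner_to_L2[OF sq[OF square_integrable_rep[of u]] square_integrable_rep[of v]]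
    by (simp add: mult_on_def mult_ac)
  have comm: "mult_on D c u \<bullet> v = u \<bullet> mult_on D c v" for u v
    using inner[of u v] inner[of v u] by (simp add: inner_commute mult_ac)
  then show "mult_on D c u \<bullet> v = u \<bullet> mult_on D c v" .
  show "bounded_linear (mult_on D c)"
  proof (rule bounded_linear_intro)
    show "mult_on D c (x + y) = mult_on D c x + mult_on D c y" for x y
    proof -
      have "(mult_on D c (x + y) - (mult_on D c x + mult_on D c y)) \<bullet> z = 0" for z
        by (simp add: inner_diff_left inner_add_left comm)
      from this[of "mult_on D c (x + y) - (mult_on D c x + mult_on D c y)"] show ?thesis by simp
    qed
    show "mult_on D c (r *\<^sub>R x) = r *\<^sub>R mult_on D c x" for r x
    proof -
      have "(mult_on D c (r *\<^sub>R x) - r *\<^sub>R mult_on D c x) \<bullet> z = 0" for z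
        by (simp add: inner_diff_left comm)
      from this[of "mult_on D c (r *\<^sub>R x) - r *\<^sub>R mult_on D c x"] show ?thesis by simp
    qed
    show "norm (mult_on D c x) \<le> norm x * C" for x
    proof (rule power2_le_imp_le)
      have "(norm (mult_on D c x))\<^sup>2 = (LINT y|lborel. (indicator D y * (c y * rep_L2 x y))\<^sup>2)"
        unfolding mult_on_def by (rule norm_to_L2[OF sq]) simp
      also have "\<dots> \<le> (LINT y|lborel. C\<^sup>2 * (rep_L2 x y)\<^sup>2)"
        using sq[of "rep_L2 x"] square_integrable_rep[of x] le
        by (intro integral_mono) (auto simp: square_integrable_def)
      also have "\<dots> = (norm x * C)\<^sup>2" by (simp add: norm_L2_rep power_mult_distrib)
      finally show "(norm (mult_on D c x))\<^sup>2 \<le> (norm x * C)\<^sup>2" .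
    qed (simp add: C0)
  qed
  show "mult_on D c u \<in> L2_on D"
    using rep_to_L2[OF sq[OF square_integrable_rep[of u]]] by (auto simp: L2_on_def mult_on_def)
qed

text \<open>
  \<open>L\<^sup>2(D)\<close> is the kernel of the restriction to the complement of \<open>D\<close>, a bounded operator; hence it is a closed
  subspace.
\<close>

lemma L2_on_kernel:
  assumes D: "D \<in> sets borel"
  shows "bounded_linear (mult_on (- D) (\<lambda>x. 1))" "L2_on D = {f. mult_on (- D) (\<lambda>x. 1) f = 0}"
proof -
  have w: "(\<lambda>x. indicator (- D) x * 1 :: real) \<in> borel_measurable borel" using D by measurable
  have C: "\<bar>indicator (- D) x * 1 :: real\<bar> \<le> 1" for x by (auto simp: indicator_def)
  show "bounded_linear (mult_on (- D) (\<lambda>x. 1))" by (rule bounded_linear_mult_on[OF w C])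
  have "mult_on (- D) (\<lambda>x. 1) f = 0 \<longleftrightarrow> f \<in> L2_on D" for f
  proof -
    note sq = square_integrable_mult_on[OF w C square_integrable_rep[of f]]
    have "mult_on (- D) (\<lambda>x. 1) f = 0 \<longleftrightarrow> l2_eq (\<lambda>x. indicator (- D) x * (1 * rep_L2 f x)) (\<lambda>x. 0)"
      unfolding mult_on_def zero_L2_def using Quotient_rel_abs2[OF Quotient_L2]
      using Quotient_rel[OF Quotient_L2, of "\<lambda>x. indicator (- D) x * (1 * rep_L2 f x)" "\<lambda>x. 0"] sq
      by (auto simp: l2_eq_def square_integrable_zero)
    also have "\<dots> \<longleftrightarrow> (AE x in lborel. x \<notin> D \<longrightarrow> rep_L2 f x = 0)"
      using sq by (auto simp: l2_eq_def square_integrable_zero indicator_def elim!: eventually_mono)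
    finally show ?thesis by (simp add: L2_on_def)
  qed
  then show "L2_on D = {f. mult_on (- D) (\<lambda>x. 1) f = 0}" by auto
qed

lemma
  assumes D: "D \<in> sets borel"
  shows closed_L2_on: "closed (L2_on D)" and subspace_L2_on: "subspace (L2_on D)"
proof -
  note k = L2_on_kernel[OF D]
  show "closed (L2_on D)"
    unfolding k(2) using linear_continuous_on[OF k(1)]
    by (intro closed_Collect_eq) auto
  show "subspace (L2_on D)"
    unfolding k(2) by (rule linear_subspace_kernel) (rule bounded_linear.linear[OF k(1)])
qed

lemma pd_cong:
  assumes "open S" "x \<in> S" "\<And>y. y \<in> S \<Longrightarrow> f y = g y"
  shows "pd i f x = pd i g x"
proof -
  have "(f has_derivative D) (at x) \<longleftrightarrow> (g has_derivative D) (at x)" for D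
    using assms by (metis has_derivative_transform_within_open)
  then show ?thesis by (simp add: pd_def frechet_derivative_def)
qed

lemma Ck_on_cong:
  assumes "open S" "\<And>y. y \<in> S \<Longrightarrow> f y = g y"
  shows "Ck_on k S f \<longleftrightarrow> Ck_on k S g"
  using assms(2)
proof (induction k arbitrary: f g)
  case 0
  then show ?case by (simp cong: continuous_on_cong)
next
  case (Suc k)
  have "f differentiable at x \<longleftrightarrow> g differentiable at x" if "x \<in> S" for x
    using assms(1) that Suc.prems unfolding differentiable_def
    by (metis has_derivative_transform_within_open)
  moreover have "Ck_on k S (pd i f) \<longleftrightarrow> Ck_on k S (pd i g)" for i
    by (rule Suc.IH) (rule pd_cong[OF assms(1) _ Suc.prems])
  ultimately show ?case by auto
qed

lemma Ck_on_subset: "Ck_on k S f \<Longrightarrow> T \<subseteq> S \<Longrightarrow> Ck_on k T f"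
  by (induction k arbitrary: f) (auto intro: continuous_on_subset)

text \<open>
  A product of a function that is smooth near the closure of \<open>D\<close> with a test function of \<open>D\<close> is smooth
  on the whole space: it is so near the closure of \<open>D\<close>, and it vanishes off the support of the test
  function. The lemmas on \<^const>\<open>Ck_on\<close> serve this gluing argument.
\<close>

lemma Ck_on_Un: "open S \<Longrightarrow> open T \<Longrightarrow> Ck_on k S f \<Longrightarrow> Ck_on k T f \<Longrightarrow> Ck_on k (S \<union> T) f"
  by (induction k arbitrary: f) (auto intro: continuous_on_open_Un)

lemma Ck_on_SucD: "Ck_on (Suc k) S f \<Longrightarrow> Ck_on k S f"
  by (induction k arbitrary: f)
    (auto intro!: continuous_at_imp_continuous_on differentiable_imp_continuous_within)

lemma pd_mult:
  assumes "f differentiable at x" "g differentiable at x"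
  shows "pd i (\<lambda>x. f x * g x) x = f x * pd i g x + pd i f x * g x"
proof -
  have "((\<lambda>x. f x * g x) has_derivative
      (\<lambda>h. f x * frechet_derivative g (at x) h + frechet_derivative f (at x) h * g x)) (at x)"
    using assms by (intro has_derivative_mult) (simp_all add: frechet_derivative_works[symmetric])
  from fun_cong[OF frechet_derivative_at[OF this], of "axis i 1"] show ?thesis by (simp only: pd_def)
qed

lemma pd_add:
  assumes "f differentiable at x" "g differentiable at x"
  shows "pd i (\<lambda>x. f x + g x) x = pd i f x + pd i g x"
proof -
  have "((\<lambda>x. f x + g x) has_derivative
      (\<lambda>h. frechet_derivative f (at x) h + frechet_derivative g (at x) h)) (at x)"
    using assms by (intro has_derivative_add) (simp_all add: frechet_derivative_works[symmetric])
  from fun_cong[OF frechet_derivative_at[OF this], of "axis i 1"] show ?thesis by (simp only: pd_def)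
qed

lemma Ck_on_add:
  assumes "open S"
  shows "Ck_on k S f \<Longrightarrow> Ck_on k S g \<Longrightarrow> Ck_on k S (\<lambda>x. f x + g x)"
proof (induction k arbitrary: f g)
  case 0
  then show ?case by (auto intro: continuous_on_add)
next
  case (Suc k)
  have "Ck_on k S (pd i (\<lambda>x. f x + g x)) \<longleftrightarrow> Ck_on k S (\<lambda>x. pd i f x + pd i g x)" for i
    using Suc.prems by (intro Ck_on_cong assms pd_add) auto
  then show ?case using Suc by auto
qed

lemma Ck_on_mult:
  assumes "open S"
  shows "Ck_on k S f \<Longrightarrow> Ck_on k S g \<Longrightarrow> Ck_on k S (\<lambda>x. f x * g x)"
proof (induction k arbitrary: f g)
  case 0
  then show ?case by (auto intro: continuous_on_mult)
next
  case (Suc k)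
  have "Ck_on k S (pd i (\<lambda>x. f x * g x)) \<longleftrightarrow> Ck_on k S (\<lambda>x. f x * pd i g x + pd i f x * g x)" for i
    using Suc.prems by (intro Ck_on_cong assms pd_mult) auto
  moreover have "Ck_on k S (\<lambda>x. f x * pd i g x + pd i f x * g x)" for i
    using Suc.prems Ck_on_SucD[OF Suc.prems(1)] Ck_on_SucD[OF Suc.prems(2)]
    by (intro Ck_on_add assms Suc.IH) auto
  ultimately show ?case using Suc.prems by auto
qed

lemma Ck_on_zero: "Ck_on k S (\<lambda>x. 0)"
proof (induction k)
  case (Suc k)
  have "pd i (\<lambda>x. 0) = (\<lambda>x. 0)" for i :: 'a by (simp add: pd_def[abs_def])
  then show ?case using Suc by simp
qed simp

lemma continuous_compact_support_square_integrable:
  fixes f :: "'a::euclidean_space \<Rightarrow> real"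
  assumes f: "continuous_on UNIV f" and K: "compact K" and z: "\<And>x. x \<notin> K \<Longrightarrow> f x = 0"
  shows "square_integrable f"
proof -
  have "integrable lborel (\<lambda>x. indicator K x *\<^sub>R (f x)\<^sup>2)"
    using continuous_on_subset[OF f] by (intro borel_integrable_compact K continuous_intros) auto
  also have "(\<lambda>x. indicator K x *\<^sub>R (f x)\<^sup>2) = (\<lambda>x. (f x)\<^sup>2)"
    using z by (auto simp: indicator_def fun_eq_iff)
  finally show ?thesis
    unfolding square_integrable_def using borel_measurable_continuous_onI[OF f] by simp
qed

lemma test_function_support:
  assumes "\<phi> \<in> test_functions D"
  obtains K where "compact K" "K \<subseteq> D" "\<And>x. x \<in> - K \<Longrightarrow> \<phi> x = 0" "\<And>k. Ck_on k UNIV \<phi>"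
proof -
  define K where "K = closure {x. \<phi> x \<noteq> 0}"
  have "\<phi> x = 0" if "x \<in> - K" for x
    using that closure_subset[of "{x. \<phi> x \<noteq> 0}", folded K_def] by auto
  then show thesis
    using assms unfolding test_functions_def smooth_on_def mem_Collect_eq K_def[symmetric]
    by (intro that[of K]) blast+
qed

lemma pd_const_zero: "pd i (\<lambda>x. 0) x = 0"
  by (simp add: pd_def)

lemma
  assumes \<phi>: "\<phi> \<in> test_functions D"
  shows test_function_zero: "x \<notin> D \<Longrightarrow> \<phi> x = 0"
    and test_function_differentiable: "\<phi> differentiable at x"
    and square_integrable_test: "square_integrable \<phi>"
    and square_integrable_pd_test: "square_integrable (pd i \<phi>)"
proof -
  from \<phi> obtain K where K: "compact K" "K \<subseteq> D" and z: "\<And>x. x \<in> - K \<Longrightarrow> \<phi> x = 0"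
    and s: "\<And>k. Ck_on k UNIV \<phi>" by (rule test_function_support) blast
  have oK: "open (- K)" using compact_imp_closed[OF K(1)] by (simp add: open_Compl)
  have pz: "pd i \<phi> x = 0" if "x \<in> - K" for x i
    using pd_cong[OF oK that z, where i=i] by (simp only: pd_const_zero)
  show "\<phi> x = 0" if "x \<notin> D" using that K by (intro z) auto
  have "Ck_on (Suc 0) UNIV \<phi>" "Ck_on 0 UNIV \<phi>" by (rule s)+
  then have c: "continuous_on UNIV \<phi>" "continuous_on UNIV (pd i \<phi>)" and "\<phi> differentiable at x" by simp_all
  then show "\<phi> differentiable at x" by simp
  show "square_integrable \<phi>" by (rule continuous_compact_support_square_integrable[OF c(1) K(1)]) (simp add: z)
  show "square_integrable (pd i \<phi>)" by (rule continuous_compact_support_square_integrable[OF c(2) K(1)]) (simp add: pz)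
qed

lemma continuous_near_closure_bounded:
  fixes c :: "'a::euclidean_space \<Rightarrow> real"
  assumes D: "open D" "bounded D" and c: "continuous_on U c" "closure D \<subseteq> U"
  shows "(\<lambda>x. indicator D x * c x) \<in> borel_measurable borel" "\<exists>C. \<forall>x. \<bar>indicator D x * c x\<bar> \<le> C"
proof -
  have cD: "continuous_on D c" using c closure_subset continuous_on_subset by (metis order_trans)
  have "(\<lambda>x. indicator D x *\<^sub>R c x) \<in> borel_measurable borel"
    by (rule borel_measurable_continuous_on_indicator[OF _ cD]) (use D in simp)
  then show "(\<lambda>x. indicator D x * c x) \<in> borel_measurable borel" by simp
  have "compact (c ` closure D)"
    using D c continuous_on_subset by (intro compact_continuous_image) (auto simp: compact_closure)
  then obtain C where C: "\<And>y. y \<in> c ` closure D \<Longrightarrow> norm y \<le> C"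
    using compact_imp_bounded bounded_iff by metis
  have "\<bar>indicator D x * c x\<bar> \<le> max C 0" for x
    using C[of "c x"] closure_subset by (cases "x \<in> D") force+
  then show "\<exists>C. \<forall>x. \<bar>indicator D x * c x\<bar> \<le> C" by blast
qed

lemma smooth_upto_boundaryD:
  assumes "smooth_upto_boundary D c"
  obtains U where "open U" "closure D \<subseteq> U" "\<And>k. Ck_on k U c" "continuous_on U c"
    "\<And>i. continuous_on U (pd i c)" "\<And>x. x \<in> U \<Longrightarrow> c differentiable at x"
proof -
  obtain U where U: "open U" "closure D \<subseteq> U" "\<And>k. Ck_on k U c"
    using assms unfolding smooth_upto_boundary_def smooth_on_def by blast
  have "Ck_on (Suc 0) U c" "Ck_on 0 U c" by (rule U)+
  then have "continuous_on U c" "\<And>i. continuous_on U (pd i c)" "\<And>x. x \<in> U \<Longrightarrow> c differentiable at x" by simp_all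
  then show thesis by (rule that[OF U])
qed

lemma smooth_mult_test_function:
  assumes c: "smooth_upto_boundary D c" and \<phi>: "\<phi> \<in> test_functions D"
  shows "(\<lambda>x. c x * \<phi> x) \<in> test_functions D"
    and "pd i (\<lambda>x. c x * \<phi> x) x = indicator D x * (c x * pd i \<phi> x + pd i c x * \<phi> x)"
proof -
  from \<phi> obtain K where K: "compact K" "K \<subseteq> D" and z0: "\<And>x. x \<in> - K \<Longrightarrow> \<phi> x = 0"
    and s: "\<And>k. Ck_on k UNIV \<phi>" by (rule test_function_support) blast
  have oK: "open (- K)" using compact_imp_closed[OF K(1)] by (simp add: open_Compl)
  from c obtain U where U: "open U" "closure D \<subseteq> U" "\<And>k. Ck_on k U c" "continuous_on U c"
    "\<And>i. continuous_on U (pd i c)" "\<And>x. x \<in> U \<Longrightarrow> c differentiable at x"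
    by (rule smooth_upto_boundaryD) blast
  have DU: "D \<subseteq> U" using U(2) closure_subset by blast
  have z: "c x * \<phi> x = 0" if "x \<in> - K" for x using z0[OF that] by simp
  have "Ck_on k (U \<union> - K) (\<lambda>x. c x * \<phi> x)" for k
  proof (rule Ck_on_Un)
    show "Ck_on k U (\<lambda>x. c x * \<phi> x)"
      by (rule Ck_on_mult[OF U(1) U(3) Ck_on_subset[OF s subset_UNIV]])
    show "Ck_on k (- K) (\<lambda>x. c x * \<phi> x)"
      using Ck_on_cong[where k=k and f="\<lambda>x. c x * \<phi> x" and g="\<lambda>x. 0", OF oK z] Ck_on_zero by blast
  qed (rule U(1), rule oK)
  moreover have "U \<union> - K = UNIV" using DU K by blast
  ultimately have sm: "smooth_on UNIV (\<lambda>x. c x * \<phi> x)" by (simp add: smooth_on_def)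
  have sub: "closure {x. c x * \<phi> x \<noteq> 0} \<subseteq> K"
    using z compact_imp_closed[OF K(1)] by (intro closure_minimal) auto
  then have "compact (closure {x. c x * \<phi> x \<noteq> 0})" 
    by (metis Int_absorb1 compact_Int_closed[OF K(1) closed_closure])
  then show "(\<lambda>x. c x * \<phi> x) \<in> test_functions D"
    using sm sub K(2) by (auto simp: test_functions_def)
  show "pd i (\<lambda>x. c x * \<phi> x) x = indicator D x * (c x * pd i \<phi> x + pd i c x * \<phi> x)"
  proof (cases "x \<in> D")
    case True
    then show ?thesis using U(6) DU test_function_differentiable[OF \<phi>] by (auto simp: pd_mult)
  next
    case False
    then have "x \<in> - K" using K by auto
    then have "pd i (\<lambda>x. c x * \<phi> x) x = pd i (\<lambda>x. 0) x" by (rule pd_cong[OF oK _ z])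
    then show ?thesis using False by (simp add: pd_const_zero)
  qed
qed

lemma smooth_upto_boundary_mult_on:
  fixes D :: "(real^'n::finite) set"
  assumes D: "open D" "bounded D" and c: "smooth_upto_boundary D c"
  obtains C where "(\<lambda>x. indicator D x * c x) \<in> borel_measurable borel" "\<And>x. \<bar>indicator D x * c x\<bar> \<le> C"
    "\<And>i. (\<lambda>x. indicator D x * pd i c x) \<in> borel_measurable borel"
    "\<And>i x. \<bar>indicator D x * pd i c x\<bar> \<le> C"
proof -
  from c obtain U where U: "open U" "closure D \<subseteq> U" "continuous_on U c" "\<And>i. continuous_on U (pd i c)"
    by (rule smooth_upto_boundaryD) metis
  note m = continuous_near_closure_bounded[OF D U(3,2)] and m' = continuous_near_closure_bounded[OF D U(4,2)]
  obtain C where C: "\<And>x. \<bar>indicator D x * c x\<bar> \<le> C" using m(2) by auto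
  from m'(2) obtain C' where C': "\<And>i x. \<bar>indicator D x * pd i c x\<bar> \<le> C' i" by metis
  have "C' i \<le> (MAX i. C' i)" for i by (rule Max_ge) auto
  then show thesis
    using C C' by (intro that[of "max C (MAX i. C' i)"] m(1) m'(1)) (meson max.coboundedI1 max.coboundedI2 order_trans)+
qed

text \<open>
  The Leibniz rule for weak derivatives. Since \<open>c \<phi>\<close> is again a test function, \<open>c \<partial>\<phi> = \<partial>(c \<phi>) - \<phi> \<partial>c\<close> moves
  the derivative to \<open>w\<close>. It ensures that the weak derivatives in \<^const>\<open>elliptic_op\<close> exist.
\<close>

lemma has_weak_pd_mult_on:
  fixes D :: "(real^'n::finite) set"
  assumes D: "open D" "bounded D" and c: "smooth_upto_boundary D c" and w: "has_weak_pd D i w g"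
  shows "has_weak_pd D i (mult_on D c w) (mult_on D c g + mult_on D (pd i c) w)"
proof -
  from D c obtain C where C: "(\<lambda>x. indicator D x * c x) \<in> borel_measurable borel" "\<And>x. \<bar>indicator D x * c x\<bar> \<le> C"
    "\<And>i. (\<lambda>x. indicator D x * pd i c x) \<in> borel_measurable borel"
    "\<And>i x. \<bar>indicator D x * pd i c x\<bar> \<le> C" by (rule smooth_upto_boundary_mult_on) blast
  note mc = C(1,2) and mp = C(3)[of i] C(4)[where i=i]
  have Dm: "D \<in> sets borel" using D by simp
  show ?thesis
    unfolding has_weak_pd_def
  proof (intro conjI ballI)
    show "mult_on D c g + mult_on D (pd i c) w \<in> L2_on D"
      by (intro subspace_add subspace_L2_on Dm mult_on_in_L2_on[OF mc] mult_on_in_L2_on[OF mp])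
    fix \<phi> assume \<phi>: "\<phi> \<in> test_functions D"
    note sq = square_integrable_test[OF \<phi>] square_integrable_pd_test[OF \<phi>, where i=i]
    note ip = inner_to_L2[OF square_integrable_rep]
    note cphi = smooth_mult_test_function[OF c \<phi>]
    have l2: "to_L2 h = to_L2 k" if "h = k" for h k :: "real^'n \<Rightarrow> real" using that by simp
    have sq2: "square_integrable (\<lambda>x. indicator D x * (pd i c x * \<phi> x))"
      by (rule square_integrable_mult_on[OF mp sq(1)])
    have mult: "mult_on D h v \<bullet> to_L2 \<psi> = v \<bullet> to_L2 (\<lambda>x. indicator D x * (h x * \<psi> x))"
      if "square_integrable \<psi>" and h: "(\<lambda>x. indicator D x * h x) \<in> borel_measurable borel"
        "\<And>x. \<bar>indicator D x * h x\<bar> \<le> C" for h v \<psi>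
      using inner_to_L2[OF square_integrable_rep square_integrable_mult_on[OF h that(1)], of v]
        inner_to_L2[OF square_integrable_mult_on[OF h square_integrable_rep] that(1), of v]
      by (simp add: mult_on_def mult_ac)
    have "mult_on D c w \<bullet> to_L2 (pd i \<phi>) = w \<bullet> to_L2 (\<lambda>x. indicator D x * (c x * pd i \<phi> x))"
      by (rule mult[OF sq(2) mc])
    also have "(\<lambda>x. indicator D x * (c x * pd i \<phi> x))
        = (\<lambda>x. pd i (\<lambda>x. c x * \<phi> x) x - indicator D x * (pd i c x * \<phi> x))"
      unfolding cphi(2) by (auto simp: fun_eq_iff distrib_left)
    also have "to_L2 \<dots> = to_L2 (pd i (\<lambda>x. c x * \<phi> x)) - to_L2 (\<lambda>x. indicator D x * (pd i c x * \<phi> x))"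
      using diff_to_L2[OF square_integrable_pd_test[OF cphi(1)] sq2] by simp
    also have "w \<bullet> (to_L2 (pd i (\<lambda>x. c x * \<phi> x)) - to_L2 (\<lambda>x. indicator D x * (pd i c x * \<phi> x)))
        = - (g \<bullet> to_L2 (\<lambda>x. c x * \<phi> x)) - mult_on D (pd i c) w \<bullet> to_L2 \<phi>"
      using w cphi(1) mult[OF sq(1) mp] by (auto simp: has_weak_pd_def inner_diff_right)
    also have "(\<lambda>x. c x * \<phi> x) = (\<lambda>x. indicator D x * (c x * \<phi> x))"
      using test_function_zero[OF \<phi>] by (auto simp: fun_eq_iff indicator_def)
    also have "g \<bullet> to_L2 \<dots> = mult_on D c g \<bullet> to_L2 \<phi>" by (rule mult[OF sq(1) mc, symmetric])
    finally show "mult_on D c w \<bullet> to_L2 (pd i \<phi>) = - ((mult_on D c g + mult_on D (pd i c) w) \<bullet> to_L2 \<phi>)"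
      by (simp add: inner_add_left)
  qed
qed

lemma has_weak_pd_unique:
  assumes dense: "L2_on D \<subseteq> closure (to_L2 ` test_functions D)" and D: "D \<in> sets borel"
    and g: "has_weak_pd D i f g"
  shows "weak_pd D i f = g"
  unfolding weak_pd_def
proof (rule the_equality[where P="has_weak_pd D i f", OF g])
  fix h assume h: "has_weak_pd D i f h"
  have gh: "h - g \<in> L2_on D"
    using g h by (auto simp: has_weak_pd_def intro: subspace_diff[OF subspace_L2_on[OF D]])
  have "to_L2 ` test_functions D \<subseteq> {x. (h - g) \<bullet> x = 0}"
    using g h by (auto simp: has_weak_pd_def inner_diff_left)
  then have "closure (to_L2 ` test_functions D) \<subseteq> {x. (h - g) \<bullet> x = 0}"
    by (rule closure_minimal) (rule closed_hyperplane)
  then have "(h - g) \<bullet> (h - g) = 0" using dense gh by blast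
  then show "h = g" by simp
qed

text \<open>
  The definition of the weak derivative is extended from test functions to \<open>H\<^sub>0\<^sup>1\<close> by density.
\<close>

lemma weak_pd_integration_by_parts:
  assumes W: "has_weak_pd D i W g" and u: "u \<in> H10 D"
  shows "g \<bullet> u = - (W \<bullet> weak_pd D i u)"
proof -
  obtain \<phi> where \<phi>: "\<And>n::nat. \<phi> n \<in> test_functions D" "(\<lambda>n. to_L2 (\<phi> n)) \<longlonglongrightarrow> u"
    "(\<lambda>n. to_L2 (pd i (\<phi> n))) \<longlonglongrightarrow> weak_pd D i u"
    using u unfolding H10_def by blast
  have "(\<lambda>n. g \<bullet> to_L2 (\<phi> n)) \<longlonglongrightarrow> g \<bullet> u" "(\<lambda>n. - (W \<bullet> to_L2 (pd i (\<phi> n)))) \<longlonglongrightarrow> - (W \<bullet> weak_pd D i u)"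
    by (intro tendsto_intros \<phi>)+
  moreover have "g \<bullet> to_L2 (\<phi> n) = - (W \<bullet> to_L2 (pd i (\<phi> n)))" for n
    using W \<phi>(1) by (auto simp: has_weak_pd_def)
  ultimately show ?thesis using LIMSEQ_unique by simp
qed

lemma elliptic_pairing_eq_op:
  fixes D :: "(real^'n::finite) set"
  assumes D: "open D" "bounded D" and coeff: "elliptic_coefficients D a b"
    and dense: "L2_on D \<subseteq> closure (to_L2 ` test_functions D)"
    and u: "u \<in> H10 D" and g: "g \<in> H2 D"
  shows "elliptic_pairing D a b u g = elliptic_op D a b g \<bullet> u"
proof -
  have Dm: "D \<in> sets borel" using D by simp
  have sm: "smooth_upto_boundary D (a i j)" "smooth_upto_boundary D b" for i j
    using coeff by (auto simp: elliptic_coefficients_def)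
  have comm: "mult_on D c v \<bullet> w = v \<bullet> mult_on D c w" if c: "smooth_upto_boundary D c" for c v w
    using D c by (rule smooth_upto_boundary_mult_on) (rule inner_mult_on_commute)
  have sym: "mult_on D (a i j) = mult_on D (a j i)" for i j
  proof (rule ext)
    fix f
    have "(\<lambda>x. indicator D x * (a i j x * rep_L2 f x)) = (\<lambda>x. indicator D x * (a j i x * rep_L2 f x))"
      using coeff by (auto simp: elliptic_coefficients_def indicator_def fun_eq_iff)
    then show "mult_on D (a i j) f = mult_on D (a j i) f" by (simp only: mult_on_def)
  qed
  have parts: "weak_pd D i (mult_on D (a i j) (weak_pd D j g)) \<bullet> u
      = - (mult_on D (a i j) (weak_pd D j g) \<bullet> weak_pd D i u)" for i j
  proof -
    have "weak_pd D j g \<in> H1 D" using g by (simp add: H2_def)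
    then obtain h where "has_weak_pd D i (weak_pd D j g) h" by (auto simp: H1_def)
    from has_weak_pd_mult_on[OF D sm(1) this]
    obtain h' where h': "has_weak_pd D i (mult_on D (a i j) (weak_pd D j g)) h'" by blast
    show ?thesis
      using weak_pd_integration_by_parts[OF h' u] has_weak_pd_unique[OF dense Dm h'] by simp
  qed
  have "elliptic_op D a b g \<bullet> u
      = - (\<Sum>i\<in>UNIV. \<Sum>j\<in>UNIV. mult_on D (a i j) (weak_pd D j g) \<bullet> weak_pd D i u) - mult_on D b g \<bullet> u"
    by (simp add: elliptic_op_def inner_diff_left inner_sum_left parts sum_negf)
  also have "(\<Sum>i\<in>UNIV. \<Sum>j\<in>UNIV. mult_on D (a i j) (weak_pd D j g) \<bullet> weak_pd D i u)
      = (\<Sum>i\<in>UNIV. \<Sum>j\<in>UNIV. mult_on D (a j i) (weak_pd D i u) \<bullet> weak_pd D j g)"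
    by (intro sum.cong refl) (subst comm[OF sm(1)], subst sym, rule inner_commute)
  also have "\<dots> = (\<Sum>j\<in>UNIV. \<Sum>i\<in>UNIV. mult_on D (a j i) (weak_pd D i u) \<bullet> weak_pd D j g)"
    by (rule sum.swap)
  also have "mult_on D b g \<bullet> u = mult_on D b u \<bullet> g" by (subst comm[OF sm(2)]) (rule inner_commute)
  finally show ?thesis by (simp add: elliptic_pairing_def)
qed

text \<open>
  A self-adjoint operator is densely defined, and the domain \<open>H\<^sub>0\<^sup>1\<close> is contained in the closure of the
  test functions.
\<close>

lemma test_functions_dense:
  assumes sa: "selfadjoint_on (L2_on D) (H10 D) B"
  shows "L2_on D \<subseteq> closure (to_L2 ` test_functions D)"
proof -
  have "H10 D \<subseteq> closure (to_L2 ` test_functions D)"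
  proof
    fix x assume "x \<in> H10 D"
    then obtain \<phi> where \<phi>: "\<And>n::nat. \<phi> n \<in> test_functions D" "(\<lambda>n. to_L2 (\<phi> n)) \<longlonglongrightarrow> x"
      unfolding H10_def by blast
    then show "x \<in> closure (to_L2 ` test_functions D)"
      unfolding closure_sequential by (intro exI[of _ "\<lambda>n. to_L2 (\<phi> n)"]) auto
  qed
  then show "L2_on D \<subseteq> closure (to_L2 ` test_functions D)"
    using sa by (auto simp: selfadjoint_on_def) (metis (no_types) closure_closure closure_mono subset_iff)
qed

text \<open>
  For \<open>g\<close> in the domain of \<open>B\<^sup>2 = - A\<close>, the pairing is \<open>(A g, u) = - (B\<^sup>2 g, u)\<close>, by symmetry of the
  coefficients and integration by parts, and one factor \<open>B\<close> is moved to \<open>u\<close>.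
\<close>

lemma elliptic_pairing_eq_sqrt:
  fixes D :: "(real^'n::finite) set"
  assumes D: "open D" "bounded D" and coeff: "elliptic_coefficients D a b"
    and sqrt: "is_sqrt_on (L2_on D) (H2 D \<inter> H10 D) (\<lambda>u. - elliptic_op D a b u) (H10 D) B"
    and u: "u \<in> H10 D" and g: "g \<in> H10 D" "B g \<in> H10 D"
  shows "elliptic_pairing D a b u g = - (B u \<bullet> B g)"
proof -
  have sa: "selfadjoint_on (L2_on D) (H10 D) B" using sqrt by (simp add: is_sqrt_on_def)
  note dense = test_functions_dense[OF sa]
  have g2: "g \<in> H2 D \<inter> H10 D" using sqrt g by (auto simp: is_sqrt_on_def)
  then have "elliptic_op D a b g = - B (B g)" using sqrt by (auto simp: is_sqrt_on_def)
  moreover have "B (B g) \<bullet> u = B g \<bullet> B u"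
  proof -
    have H: "u \<in> L2_on D" "B u \<in> L2_on D" using sa u by (auto simp: selfadjoint_on_def)
    then have "(u \<in> H10 D \<and> B u = B u) \<longleftrightarrow> (\<forall>x\<in>H10 D. B x \<bullet> u = x \<bullet> B u)"
      using sa unfolding selfadjoint_on_def by blast
    then show ?thesis using u g(2) by blast
  qed
  ultimately show ?thesis
    using elliptic_pairing_eq_op[OF D coeff dense u] g2 by (simp add: inner_commute)
qed

section \<open>Second moments of Hilbert space valued martingales\<close>

text \<open>
  Altering a process on a null set, and freezing it at negative times, makes all its paths continuous
  on the real line, and then it is a pointwise limit of processes that are constant on small time
  intervals. Joint measurability is what Fubini's theorem needs. The modification may fail to be
  adapted, since the null set need not belong to the filtration.
\<close>

lemma continuous_modification:
  fixes X :: "real \<Rightarrow> 'w \<Rightarrow> 'b::{real_normed_vector, second_countable_topology}"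
  assumes X: "\<And>t. 0 \<le> t \<Longrightarrow> X t \<in> borel_measurable P" "continuous_paths P X"
  obtains X' where "\<And>\<omega>. continuous_on UNIV (\<lambda>t. X' t \<omega>)"
    "(\<lambda>(t, \<omega>). X' t \<omega>) \<in> borel_measurable (borel \<Otimes>\<^sub>M P)"
    "AE \<omega> in P. \<forall>t\<ge>0. X' t \<omega> = X t \<omega>"
proof -
  obtain N where N: "N \<in> null_sets P" "\<And>\<omega>. \<omega> \<in> space P \<Longrightarrow> \<omega> \<notin> N \<Longrightarrow> continuous_on {0..} (\<lambda>t. X t \<omega>)"
    using X(2) unfolding continuous_paths_def eventually_ae_filter by blast
  define X' where "X' t \<omega> = (if \<omega> \<in> space P - N then X (max 0 t) \<omega> else 0)" for t \<omega>
  have cont: "continuous_on UNIV (\<lambda>t. X' t \<omega>)" for \<omega>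
  proof (cases "\<omega> \<in> space P - N")
    case True
    then have "continuous_on {0..} (\<lambda>t. X t \<omega>)" using N by auto
    then have "continuous_on UNIV (\<lambda>t. X (max 0 t) \<omega>)"
      by (rule continuous_on_compose2) (auto intro!: continuous_intros)
    then show ?thesis using True by (simp add: X'_def[abs_def])
  next
    case False
    then have "(\<lambda>t. X' t \<omega>) = (\<lambda>t. 0)" by (auto simp: X'_def)
    then show ?thesis by (simp only: continuous_on_const)
  qed
  have m: "X' t \<in> borel_measurable P" for t
  proof -
    have [measurable]: "N \<in> sets P" "X (max 0 t) \<in> borel_measurable P" using N X by auto
    show ?thesis unfolding X'_def[abs_def] by measurable
  qed
  have m2: "(\<lambda>(t, \<omega>). X' t \<omega>) \<in> borel_measurable (borel \<Otimes>\<^sub>M P)"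
  proof (rule borel_measurable_LIMSEQ_metric)
    fix n :: nat
    have f: "(\<lambda>x. X' (real_of_int i / real n) (snd x)) \<in> borel_measurable (borel \<Otimes>\<^sub>M P)" for i
      by (rule measurable_compose[OF measurable_snd m])
    have g: "(\<lambda>x. \<lfloor>real n * fst x\<rfloor>) \<in> measurable (borel \<Otimes>\<^sub>M P) (count_space UNIV)"
      by measurable
    show "(\<lambda>x. X' (real_of_int \<lfloor>real n * fst x\<rfloor> / real n) (snd x)) \<in> borel_measurable (borel \<Otimes>\<^sub>M P)"
      using measurable_compose_countable'[OF f g] by simp
  next
    fix x :: "real \<times> 'w"
    obtain t :: real and \<omega> :: 'w where x: "x = (t, \<omega>)" by (cases x)
    have "(\<lambda>n. real_of_int \<lfloor>real n * t\<rfloor> / real n) \<longlonglongrightarrow> t"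
    proof (rule LIMSEQ_I)
      fix r :: real assume r: "0 < r"
      obtain k :: nat where k: "1 / r < real k" using reals_Archimedean2 by blast
      show "\<exists>no. \<forall>n\<ge>no. norm (real_of_int \<lfloor>real n * t\<rfloor> / real n - t) < r"
      proof (intro exI allI impI)
        fix n assume n: "Suc k \<le> n"
        have "\<bar>real_of_int \<lfloor>real n * t\<rfloor> - real n * t\<bar> \<le> 1" by linarith
        moreover have "1 < r * real n"
          using k n r by (simp add: field_simps) (smt (verit) mult_left_mono of_nat_mono Suc_leD)
        ultimately have "\<bar>real_of_int \<lfloor>real n * t\<rfloor> - real n * t\<bar> < r * real n" by linarith
        moreover have "real_of_int \<lfloor>real n * t\<rfloor> / real n - t = (real_of_int \<lfloor>real n * t\<rfloor> - real n * t) / real n"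
          using n by (simp add: field_simps)
        ultimately show "norm (real_of_int \<lfloor>real n * t\<rfloor> / real n - t) < r"
          using n by (simp add: pos_divide_less_eq)
      qed
    qed
    then show "(\<lambda>n. X' (real_of_int \<lfloor>real n * fst x\<rfloor> / real n) (snd x)) \<longlonglongrightarrow> (case x of (t, \<omega>) \<Rightarrow> X' t \<omega>)"
      using continuous_on_tendsto_compose[OF cont, of _ t] by (simp add: x)
  qed
  have "AE \<omega> in P. \<omega> \<notin> N" using N(1) by (rule AE_not_in)
  then have "AE \<omega> in P. \<forall>t\<ge>0. X' t \<omega> = X t \<omega>"
    using AE_space by eventually_elim (simp add: X'_def)
  with cont m2 show thesis by (rule that)
qed

lemma integrable_mult_of_squares:
  fixes f g :: "'a \<Rightarrow> real"
  assumes [measurable]: "f \<in> borel_measurable M" "g \<in> borel_measurable M"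
    and i: "integrable M (\<lambda>x. (f x)\<^sup>2)" "integrable M (\<lambda>x. (g x)\<^sup>2)"
  shows "integrable M (\<lambda>x. f x * g x)"
proof (rule Bochner_Integration.integrable_bound[OF Bochner_Integration.integrable_add[OF i]])
  have "\<bar>x * y\<bar> \<le> x\<^sup>2 + y\<^sup>2" for x y :: real
  proof -
    have "2 * (\<bar>x\<bar> * \<bar>y\<bar>) \<le> \<bar>x\<bar>\<^sup>2 + \<bar>y\<bar>\<^sup>2"
      using sum_squares_bound[of "\<bar>x\<bar>" "\<bar>y\<bar>"] by simp
    moreover have "0 \<le> \<bar>x\<bar> * \<bar>y\<bar>" by simp
    ultimately show ?thesis by (simp only: abs_mult power2_abs)
  qed
  then show "AE x in M. norm (f x * g x) \<le> norm ((f x)\<^sup>2 + (g x)\<^sup>2)" by simp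
qed simp

lemma bounded_linear_borel_measurable:
  fixes T :: "'a::real_normed_vector \<Rightarrow> 'b::real_normed_vector"
  assumes "bounded_linear T"
  shows "T \<in> borel_measurable borel"
  by (rule borel_measurable_continuous_onI) (rule linear_continuous_on[OF assms])

locale filtered = prob_space P for P :: "'w measure" +
  fixes F :: "real \<Rightarrow> 'w measure"
  assumes filtered: "filtered_prob_space P F"
begin

lemma space_filtration: "space (F t) = space P"
  and filtration_mono: "s \<le> t \<Longrightarrow> sets (F s) \<subseteq> sets (F t)"
  and subalgebra_filtration: "subalgebra P (F t)"
  using filtered by (auto simp: filtered_prob_space_def filtration_def)

lemma filtration_measurable_P: "f \<in> measurable (F t) N \<Longrightarrow> f \<in> measurable P N"
  by (rule measurable_from_subalg[OF subalgebra_filtration])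

lemma martingaleD:
  assumes "martingale P F X"
  shows "0 \<le> t \<Longrightarrow> X t \<in> borel_measurable (F t)" "0 \<le> t \<Longrightarrow> integrable P (X t)"
    "0 \<le> s \<Longrightarrow> s \<le> t \<Longrightarrow> A \<in> sets (F s) \<Longrightarrow> (LINT \<omega>:A|P. X t \<omega>) = (LINT \<omega>:A|P. X s \<omega>)"
  using assms unfolding martingale_def adapted_def by blast+

lemma martingale_bounded_linear:
  fixes M :: "real \<Rightarrow> 'w \<Rightarrow> 'b::{banach, second_countable_topology}"
    and T :: "'b \<Rightarrow> 'c::{banach, second_countable_topology}"
  assumes M: "martingale P F M" and T: "bounded_linear T"
  shows "martingale P F (\<lambda>t \<omega>. T (M t \<omega>))"
proof -
  note D = martingaleD[OF M]
  note Tm = bounded_linear_borel_measurable[OF T]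
  have set_int: "(LINT \<omega>:A|P. T (M t \<omega>)) = T (LINT \<omega>:A|P. M t \<omega>)" if "0 \<le> t" "A \<in> sets (F s)" for t s A
  proof -
    have A: "A \<in> sets P" using that subalgebra_filtration[of s] by (auto simp: subalgebra_def)
    have "T (LINT \<omega>:A|P. M t \<omega>) = (LINT \<omega>|P. T (indicator A \<omega> *\<^sub>R M t \<omega>))"
      unfolding set_lebesgue_integral_def
      by (rule integral_bounded_linear[OF T, symmetric]) (rule integrable_mult_indicator[OF A D(2)[OF that(1)]])
    then show ?thesis by (simp add: set_lebesgue_integral_def linear_scale[OF bounded_linear.linear[OF T]])
  qed
  show ?thesis
    unfolding martingale_def adapted_def
  proof (intro conjI allI impI ballI)
    show "(\<lambda>\<omega>. T (M t \<omega>)) \<in> borel_measurable (F t)" if "0 \<le> t" for t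
      by (rule measurable_compose[OF D(1)[OF that] Tm])
    show "integrable P (\<lambda>\<omega>. T (M t \<omega>))" if "0 \<le> t" for t
      by (rule integrable_bounded_linear[OF T D(2)[OF that]])
    show "(LINT \<omega>:A|P. T (M t \<omega>)) = (LINT \<omega>:A|P. T (M s \<omega>))"
      if "0 \<le> s" "s \<le> t" "A \<in> sets (F s)" for s t A
      using set_int[OF that(1,3)] set_int[OF order_trans[OF that(1,2)] that(3)] D(3)[OF that] by simp
  qed
qed

text \<open>
  \<open>X s\<close> is a version of the conditional expectation of \<open>X t\<close> given \<open>F s\<close>.
\<close>

lemma martingale_mult_expectation:
  fixes X :: "real \<Rightarrow> 'w \<Rightarrow> real"
  assumes X: "martingale P F X" and st: "0 \<le> s" "s \<le> t"
    and \<xi>: "\<xi> \<in> borel_measurable (F s)" and i: "integrable P (\<lambda>\<omega>. \<xi> \<omega> * X t \<omega>)"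
  shows "expectation (\<lambda>\<omega>. \<xi> \<omega> * X t \<omega>) = expectation (\<lambda>\<omega>. \<xi> \<omega> * X s \<omega>)"
proof -
  interpret finite_measure_subalgebra P "F s" by unfold_locales (rule subalgebra_filtration)
  note D = martingaleD[OF X]
  have t: "0 \<le> t" using st by simp
  have [measurable]: "X t \<in> borel_measurable P" "X s \<in> borel_measurable P" "\<xi> \<in> borel_measurable P"
    "real_cond_exp P (F s) (X t) \<in> borel_measurable P"
    using D(2)[OF t] D(2)[OF st(1)] filtration_measurable_P[OF \<xi>] by auto
  have "AE \<omega> in P. real_cond_exp P (F s) (X t) \<omega> = X s \<omega>"
    by (rule real_cond_exp_charact[OF D(3)[OF st] D(2)[OF t] D(2)[OF st(1)] D(1)[OF st(1)]])
  then have "expectation (\<lambda>\<omega>. \<xi> \<omega> * real_cond_exp P (F s) (X t) \<omega>) = expectation (\<lambda>\<omega>. \<xi> \<omega> * X s \<omega>)"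
    by (intro integral_cong_AE) auto
  with real_cond_exp_intg(2)[OF i \<xi>] show ?thesis by simp
qed

text \<open>
  The scalar statement is applied to the coordinates, and the partial sums of the orthonormal expansion
  of \<open>\<xi>\<close> are dominated by \<open>\<parallel>\<xi>\<parallel>\<close> (Bessel).
\<close>

lemma martingale_inner_expectation:
  fixes M :: "real \<Rightarrow> 'w \<Rightarrow> 'b::{real_inner, banach, second_countable_topology}"
  assumes M: "martingale P F M" and st: "0 \<le> s" "s \<le> t"
    and \<xi>: "\<xi> \<in> borel_measurable (F s)" "integrable P (\<lambda>\<omega>. (norm (\<xi> \<omega>))\<^sup>2)"
    and Mi: "integrable P (\<lambda>\<omega>. (norm (M t \<omega>))\<^sup>2)" "integrable P (\<lambda>\<omega>. (norm (M s \<omega>))\<^sup>2)"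
  shows "expectation (\<lambda>\<omega>. \<xi> \<omega> \<bullet> M t \<omega>) = expectation (\<lambda>\<omega>. \<xi> \<omega> \<bullet> M s \<omega>)"
proof -
  note D = martingaleD[OF M]
  have t: "0 \<le> t" using st by simp
  have \<xi>P[measurable]: "\<xi> \<in> borel_measurable P" by (rule filtration_measurable_P[OF \<xi>(1)])
  have Mm[measurable]: "M t \<in> borel_measurable P" "M s \<in> borel_measurable P" using D(2)[OF t] D(2)[OF st(1)] by auto
  obtain e :: "nat \<Rightarrow> 'b" where e: "orthonormal_seq UNIV e"
    using orthonormal_basis_on_exists[of "UNIV :: 'b set"] orthonormal_basis_on_enumerate
    by (metis closed_UNIV subspace_UNIV)
  let ?p = "\<lambda>n \<omega>. \<Sum>k<n. (\<xi> \<omega> \<bullet> e k) *\<^sub>R e k"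
  have pm: "?p n \<in> borel_measurable P" for n by measurable
  have lim: "(\<lambda>n. expectation (\<lambda>\<omega>. ?p n \<omega> \<bullet> M r \<omega>)) \<longlonglongrightarrow> expectation (\<lambda>\<omega>. \<xi> \<omega> \<bullet> M r \<omega>)"
    if [measurable]: "M r \<in> borel_measurable P" and Mr: "integrable P (\<lambda>\<omega>. (norm (M r \<omega>))\<^sup>2)" for r
  proof (rule integral_dominated_convergence[where w="\<lambda>\<omega>. norm (\<xi> \<omega>) * norm (M r \<omega>)"])
    show "integrable P (\<lambda>\<omega>. norm (\<xi> \<omega>) * norm (M r \<omega>))"
      using \<xi>(2) Mr by (intro integrable_mult_of_squares) auto
    show "AE \<omega> in P. (\<lambda>n. ?p n \<omega> \<bullet> M r \<omega>) \<longlonglongrightarrow> \<xi> \<omega> \<bullet> M r \<omega>"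
      using orthonormal_expansion[OF e] by (intro AE_I2 tendsto_intros) (simp add: sums_def)
    show "AE \<omega> in P. norm (?p n \<omega> \<bullet> M r \<omega>) \<le> norm (\<xi> \<omega>) * norm (M r \<omega>)" for n
    proof (rule AE_I2)
      fix \<omega>
      have "norm (?p n \<omega>) \<le> norm (\<xi> \<omega>)"
        using orthonormal_bessel[OF e] by (rule power2_le_imp_le) simp
      then show "norm (?p n \<omega> \<bullet> M r \<omega>) \<le> norm (\<xi> \<omega>) * norm (M r \<omega>)"
        using Cauchy_Schwarz_ineq2[of "?p n \<omega>" "M r \<omega>"]
        by (simp only: real_norm_def) (meson mult_right_mono norm_ge_zero order_trans)
    qed
  qed (measurable)
  have comp: "integrable P (\<lambda>\<omega>. (\<xi> \<omega> \<bullet> e k) * (e k \<bullet> M r \<omega>))"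
    if [measurable]: "M r \<in> borel_measurable P" and Mr: "integrable P (\<lambda>\<omega>. (norm (M r \<omega>))\<^sup>2)" for k r
  proof (rule Bochner_Integration.integrable_bound[where f="\<lambda>\<omega>. norm (\<xi> \<omega>) * norm (M r \<omega>)"])
    show "integrable P (\<lambda>\<omega>. norm (\<xi> \<omega>) * norm (M r \<omega>))"
      using \<xi>(2) Mr by (intro integrable_mult_of_squares) auto
    have "norm (e k) \<le> 1" using e by (auto simp: orthonormal_seq_def) (metis norm_zero order_refl zero_le_one)
    then have "\<bar>x \<bullet> e k\<bar> \<le> norm x" for x
      using Cauchy_Schwarz_ineq2[of x "e k"] by (meson mult_left_le norm_ge_zero order_trans)
    then have "\<bar>x \<bullet> e k\<bar> * \<bar>e k \<bullet> y\<bar> \<le> norm x * norm y" for x y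
      by (intro mult_mono) (auto simp: inner_commute)
    then show "AE \<omega> in P. norm ((\<xi> \<omega> \<bullet> e k) * (e k \<bullet> M r \<omega>)) \<le> norm (norm (\<xi> \<omega>) * norm (M r \<omega>))"
      by (simp add: abs_mult)
  qed measurable
  have "expectation (\<lambda>\<omega>. ?p n \<omega> \<bullet> M t \<omega>) = expectation (\<lambda>\<omega>. ?p n \<omega> \<bullet> M s \<omega>)" for n
  proof -
    have "expectation (\<lambda>\<omega>. (\<xi> \<omega> \<bullet> e k) * (e k \<bullet> M t \<omega>)) = expectation (\<lambda>\<omega>. (\<xi> \<omega> \<bullet> e k) * (e k \<bullet> M s \<omega>))" for k
    proof (rule martingale_mult_expectation[OF martingale_bounded_linear[OF M bounded_linear_inner_right] st])
      show "(\<lambda>\<omega>. \<xi> \<omega> \<bullet> e k) \<in> borel_measurable (F s)" using \<xi>(1) by measurable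
    qed (rule comp[OF Mm(1) Mi(1)])
    then show ?thesis
      by (simp add: inner_sum_left Bochner_Integration.integral_sum[OF comp[OF Mm(1) Mi(1)]]
          Bochner_Integration.integral_sum[OF comp[OF Mm(2) Mi(2)]])
  qed
  then show ?thesis using LIMSEQ_unique[OF lim[OF Mm(1) Mi(1)]] lim[OF Mm(2) Mi(2)] by simp
qed

text \<open>
  \<open>N\<^sup>2\<close> is a submartingale: \<open>E (1\<^sub>A (N t - N s)\<^sup>2) \<ge> 0\<close>, and the mixed term is \<open>E (1\<^sub>A N s\<^sup>2)\<close>.
\<close>

lemma martingale_square_mono:
  fixes N :: "real \<Rightarrow> 'w \<Rightarrow> real"
  assumes N: "martingale P F N" and st: "0 \<le> s" "s \<le> t" and A: "A \<in> sets (F s)"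
    and i: "integrable P (\<lambda>\<omega>. (N s \<omega>)\<^sup>2)" "integrable P (\<lambda>\<omega>. (N t \<omega>)\<^sup>2)"
  shows "(\<integral>\<^sup>+\<omega>. ennreal ((N s \<omega>)\<^sup>2) * indicator A \<omega> \<partial>P) \<le> (\<integral>\<^sup>+\<omega>. ennreal ((N t \<omega>)\<^sup>2) * indicator A \<omega> \<partial>P)"
proof -
  note D = martingaleD[OF N]
  have t: "0 \<le> t" using st by simp
  have AP[measurable]: "A \<in> sets P" using A subalgebra_filtration[of s] by (auto simp: subalgebra_def)
  have Nm[measurable]: "N t \<in> borel_measurable P" "N s \<in> borel_measurable P" using D(2)[OF t] D(2)[OF st(1)] by auto
  let ?x = "\<lambda>\<omega>. indicator A \<omega> * N s \<omega>"
  have xm: "?x \<in> borel_measurable (F s)" using A D(1)[OF st(1)] by measurable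
  have iA: "integrable P (\<lambda>\<omega>. indicator A \<omega> * (N r \<omega>)\<^sup>2)" if "integrable P (\<lambda>\<omega>. (N r \<omega>)\<^sup>2)" for r
    using integrable_mult_indicator[OF AP that] by simp
  have ix: "integrable P (\<lambda>\<omega>. ?x \<omega> * N r \<omega>)"
    if "N r \<in> borel_measurable P" "integrable P (\<lambda>\<omega>. (N r \<omega>)\<^sup>2)" for r
  proof (rule integrable_mult_of_squares[OF _ that(1) _ that(2)])
    have "(\<lambda>\<omega>. (?x \<omega>)\<^sup>2) = (\<lambda>\<omega>. indicator A \<omega> * (N s \<omega>)\<^sup>2)" by (auto simp: indicator_def fun_eq_iff)
    then show "integrable P (\<lambda>\<omega>. (?x \<omega>)\<^sup>2)" using iA[OF i(1)] by simp
  qed measurable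
  have "expectation (\<lambda>\<omega>. ?x \<omega> * N t \<omega>) = expectation (\<lambda>\<omega>. ?x \<omega> * N s \<omega>)"
    by (rule martingale_mult_expectation[OF N st xm ix[OF Nm(1) i(2)]])
  also have "\<dots> = expectation (\<lambda>\<omega>. indicator A \<omega> * (N s \<omega>)\<^sup>2)" by (simp add: power2_eq_square mult.assoc)
  finally have cross: "expectation (\<lambda>\<omega>. ?x \<omega> * N t \<omega>) = expectation (\<lambda>\<omega>. indicator A \<omega> * (N s \<omega>)\<^sup>2)" .
  have "0 \<le> expectation (\<lambda>\<omega>. indicator A \<omega> * (N t \<omega> - N s \<omega>)\<^sup>2)" by (intro integral_nonneg_AE AE_I2) auto
  also have "(\<lambda>\<omega>. indicator A \<omega> * (N t \<omega> - N s \<omega>)\<^sup>2)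
      = (\<lambda>\<omega>. indicator A \<omega> * (N t \<omega>)\<^sup>2 + indicator A \<omega> * (N s \<omega>)\<^sup>2 - 2 * (?x \<omega> * N t \<omega>))"
    by (auto simp: fun_eq_iff power2_eq_square algebra_simps)
  also have "expectation \<dots> = expectation (\<lambda>\<omega>. indicator A \<omega> * (N t \<omega>)\<^sup>2)
      + expectation (\<lambda>\<omega>. indicator A \<omega> * (N s \<omega>)\<^sup>2) - 2 * expectation (\<lambda>\<omega>. ?x \<omega> * N t \<omega>)"
    using iA[OF i(1)] iA[OF i(2)] ix[OF Nm(1) i(2)] by simp
  finally have "expectation (\<lambda>\<omega>. indicator A \<omega> * (N s \<omega>)\<^sup>2) \<le> expectation (\<lambda>\<omega>. indicator A \<omega> * (N t \<omega>)\<^sup>2)"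
    using cross by simp
  moreover have "(\<integral>\<^sup>+\<omega>. ennreal ((N r \<omega>)\<^sup>2) * indicator A \<omega> \<partial>P) = ennreal (expectation (\<lambda>\<omega>. indicator A \<omega> * (N r \<omega>)\<^sup>2))"
    if "integrable P (\<lambda>\<omega>. (N r \<omega>)\<^sup>2)" for r
    by (subst nn_integral_eq_integral[symmetric, OF iA[OF that]]) (auto intro!: nn_integral_cong simp: indicator_def)
  ultimately show ?thesis using i by (simp add: ennreal_leI)
qed

text \<open>
  Optional stopping for the submartingale \<open>N\<^sup>2\<close>. The time \<open>min t \<tau>\<close> is rounded up to the grid
  \<open>t i / n\<close>; on the event that the rounded time is \<open>t i / n\<close>, which belongs to the \<sigma>-algebra of that time,
  \<open>N\<^sup>2\<close> increases in the mean up to time \<open>t\<close>. Fatou's lemma passes to the limit \<open>n \<rightarrow> \<infinity>\<close>.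
\<close>

lemma martingale_stopped_square_le:
  fixes N :: "real \<Rightarrow> 'w \<Rightarrow> real"
  assumes N: "martingale P F N" and \<tau>: "stopping_time F \<tau>" "\<And>\<omega>. \<omega> \<in> space P \<Longrightarrow> 0 \<le> \<tau> \<omega>"
    and i: "\<And>s. 0 \<le> s \<Longrightarrow> integrable P (\<lambda>\<omega>. (N s \<omega>)\<^sup>2)" and t: "0 < t"
    and cont: "continuous_paths P N"
  shows "(\<integral>\<^sup>+\<omega>. ennreal ((N (min t (\<tau> \<omega>)) \<omega>)\<^sup>2) \<partial>P) \<le> (\<integral>\<^sup>+\<omega>. ennreal ((N t \<omega>)\<^sup>2) \<partial>P)"
proof -
  note D = martingaleD[OF N]
  have Nm: "N s \<in> borel_measurable P" if "0 \<le> s" for s using D(2)[OF that] by auto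
  define r where "r n i = t * real i / real n" for n i :: nat
  define J where "J n \<omega> = min n (nat \<lceil>real n * \<tau> \<omega> / t\<rceil>)" for n \<omega>
  have r0: "0 \<le> r n i" for n i using t by (simp add: r_def)
  have rt: "r n i \<le> t" if "i \<le> n" for n i using t that by (cases "n = 0") (auto simp: r_def field_simps)
  have rmono: "r n i \<le> r n j" if "i \<le> j" for n i j
    using t that by (auto simp: r_def intro!: divide_right_mono mult_left_mono)
  have J_le: "J n \<omega> \<le> i \<longleftrightarrow> \<tau> \<omega> \<le> r n i" if "i < n" for n i \<omega>
  proof -
    have "J n \<omega> \<le> i \<longleftrightarrow> real n * \<tau> \<omega> / t \<le> real i" 
      using that by (simp add: J_def min_le_iff_disj nat_le_iff ceiling_le_iff not_le)
    then show ?thesis using t that by (simp add: r_def field_simps)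
  qed
  have Jset: "{\<omega> \<in> space P. J n \<omega> \<le> i} \<in> sets (F (r n i))" for n i
  proof (cases "i < n")
    case True
    then show ?thesis
      using stopping_timeD[OF \<tau>(1), of "r n i"] by (simp add: J_le pred_def space_filtration)
  next
    case False
    then have "{\<omega> \<in> space P. J n \<omega> \<le> i} = space (F (r n i))" by (auto simp: J_def space_filtration)
    then show ?thesis by (simp only: sets.top)
  qed
  define A where "A n i = {\<omega> \<in> space P. J n \<omega> = i}" for n i
  have A: "A n i \<in> sets (F (r n i))" for n i
  proof (cases i)
    case 0
    then show ?thesis using Jset[of n 0] by (simp add: A_def)
  next
    case (Suc j)
    have "{\<omega> \<in> space P. J n \<omega> \<le> j} \<in> sets (F (r n i))"
      using Jset[of n j] filtration_mono[OF rmono[of j i n]] Suc by auto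
    then have "{\<omega> \<in> space P. J n \<omega> \<le> i} - {\<omega> \<in> space P. J n \<omega> \<le> j} \<in> sets (F (r n i))"
      using Jset by auto
    also have "{\<omega> \<in> space P. J n \<omega> \<le> i} - {\<omega> \<in> space P. J n \<omega> \<le> j} = A n i" by (auto simp: A_def Suc)
    finally show ?thesis .
  qed
  have AP: "A n i \<in> sets P" for n i using A subalgebra_filtration[of "r n i"] by (auto simp: subalgebra_def)
  have decomp: "(\<integral>\<^sup>+\<omega>. g (J n \<omega>) \<omega> \<partial>P) = (\<Sum>i\<le>n. \<integral>\<^sup>+\<omega>. g i \<omega> * indicator (A n i) \<omega> \<partial>P)"
    if g: "\<And>i. i \<le> n \<Longrightarrow> g i \<in> borel_measurable P" for g :: "nat \<Rightarrow> 'w \<Rightarrow> ennreal" and n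
  proof -
    have "(\<integral>\<^sup>+\<omega>. g (J n \<omega>) \<omega> \<partial>P) = (\<integral>\<^sup>+\<omega>. (\<Sum>i\<le>n. g i \<omega> * indicator (A n i) \<omega>) \<partial>P)"
    proof (rule nn_integral_cong)
      fix \<omega> assume \<omega>: "\<omega> \<in> space P"
      have "J n \<omega> \<le> n" by (simp add: J_def)
      have "(\<Sum>i\<le>n. g i \<omega> * indicator (A n i) \<omega>) = (\<Sum>i\<le>n. if i = J n \<omega> then g i \<omega> else 0)"
        using \<omega> by (intro sum.cong) (auto simp: A_def indicator_def)
      also have "\<dots> = g (J n \<omega>) \<omega>" using \<open>J n \<omega> \<le> n\<close> by simp
      finally show "g (J n \<omega>) \<omega> = (\<Sum>i\<le>n. g i \<omega> * indicator (A n i) \<omega>)" by simp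
    qed
    also have "\<dots> = (\<Sum>i\<le>n. \<integral>\<^sup>+\<omega>. g i \<omega> * indicator (A n i) \<omega> \<partial>P)"
      using g AP by (intro nn_integral_sum) auto
    finally show ?thesis .
  qed
  have disc: "(\<integral>\<^sup>+\<omega>. ennreal ((N (r n (J n \<omega>)) \<omega>)\<^sup>2) \<partial>P) \<le> (\<integral>\<^sup>+\<omega>. ennreal ((N t \<omega>)\<^sup>2) \<partial>P)" for n
  proof -
    have m: "(\<lambda>\<omega>. ennreal ((N s \<omega>)\<^sup>2)) \<in> borel_measurable P" if "0 \<le> s" for s using Nm[OF that] by measurable
    have "(\<integral>\<^sup>+\<omega>. ennreal ((N (r n (J n \<omega>)) \<omega>)\<^sup>2) \<partial>P)
        = (\<Sum>i\<le>n. \<integral>\<^sup>+\<omega>. ennreal ((N (r n i) \<omega>)\<^sup>2) * indicator (A n i) \<omega> \<partial>P)"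
      by (rule decomp) (rule m[OF r0])
    also have "\<dots> \<le> (\<Sum>i\<le>n. \<integral>\<^sup>+\<omega>. ennreal ((N t \<omega>)\<^sup>2) * indicator (A n i) \<omega> \<partial>P)"
      using t by (intro sum_mono martingale_square_mono[OF N] r0 rt A i) auto
    also have "\<dots> = (\<integral>\<^sup>+\<omega>. ennreal ((N t \<omega>)\<^sup>2) \<partial>P)"
      by (rule decomp[symmetric]) (use t m in auto)
    finally show ?thesis .
  qed
  have lim: "AE \<omega> in P. (\<lambda>n. ennreal ((N (r n (J n \<omega>)) \<omega>)\<^sup>2)) \<longlonglongrightarrow> ennreal ((N (min t (\<tau> \<omega>)) \<omega>)\<^sup>2)"
    using cont[unfolded continuous_paths_def] AE_space
  proof eventually_elim
    case (elim \<omega>)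
    have \<tau>0: "0 \<le> \<tau> \<omega>" using \<tau>(2) elim by blast
    \<comment> \<open>Rounding up errs by at most one grid step; beyond \<open>t\<close> the index is cut off at \<open>n\<close>.\<close>
    have close: "min t (\<tau> \<omega>) \<le> r n (J n \<omega>) \<and> r n (J n \<omega>) \<le> min t (\<tau> \<omega>) + t / real n" if n: "0 < n" for n
    proof (cases "real n * \<tau> \<omega> / t \<le> real n")
      case True
      define x where "x = real n * \<tau> \<omega> / t"
      have x: "0 \<le> x" "x \<le> real n" "\<tau> \<omega> = t * x / real n" using True \<tau>0 t n by (auto simp: x_def field_simps)
      have J: "real (J n \<omega>) = real_of_int \<lceil>x\<rceil>"
      proof -
        have c: "0 \<le> \<lceil>x\<rceil>" "\<lceil>x\<rceil> \<le> int n" using x(1,2) by (simp_all add: ceiling_le_iff)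
        then have "min n (nat \<lceil>x\<rceil>) = nat \<lceil>x\<rceil>" by (simp add: nat_le_iff min_absorb2)
        then show ?thesis using c unfolding J_def x_def[symmetric] by simp
      qed
      have "x \<le> real (J n \<omega>)" "real (J n \<omega>) \<le> x + 1" unfolding J by linarith+
      then have "t * x / real n \<le> t * real (J n \<omega>) / real n" "t * real (J n \<omega>) / real n \<le> t * (x + 1) / real n"
        using t n by (auto intro!: divide_right_mono mult_left_mono)
      moreover have "\<tau> \<omega> \<le> t" using True t n by (simp add: field_simps)
      ultimately show ?thesis using x(3) by (simp add: r_def min_def distrib_left add_divide_distrib)
    next
      case False
      then have tt: "t < \<tau> \<omega>" using t n by (simp add: field_simps)
      have "int n \<le> \<lceil>real n * \<tau> \<omega> / t\<rceil>" using False by linarith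
      then have "J n \<omega> = n" by (simp add: J_def min_def le_nat_iff)
      then show ?thesis using tt n t by (simp add: r_def min_def)
    qed
    have "(\<lambda>n. r n (J n \<omega>)) \<longlonglongrightarrow> min t (\<tau> \<omega>)"
    proof (rule tendsto_sandwich)
      show "\<forall>\<^sub>F n in sequentially. min t (\<tau> \<omega>) \<le> r n (J n \<omega>)"
        "\<forall>\<^sub>F n in sequentially. r n (J n \<omega>) \<le> min t (\<tau> \<omega>) + t / real n"
        using close by (auto intro!: eventually_sequentiallyI[of 1])
      have "(\<lambda>n. t / real n) \<longlonglongrightarrow> 0" by (rule lim_const_over_n)
      from tendsto_add[OF tendsto_const this] show "(\<lambda>n. min t (\<tau> \<omega>) + t / real n) \<longlonglongrightarrow> min t (\<tau> \<omega>)"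
        by simp
    qed simp
    then have "(\<lambda>n. N (r n (J n \<omega>)) \<omega>) \<longlonglongrightarrow> N (min t (\<tau> \<omega>)) \<omega>"
      using r0 \<tau>0 t by (intro continuous_on_tendsto_compose[OF elim(1)]) auto
    then show ?case by (intro tendsto_intros)
  qed
  have meas: "(\<lambda>\<omega>. ennreal ((N (r n (J n \<omega>)) \<omega>)\<^sup>2)) \<in> borel_measurable P" for n
  proof -
    have "J n \<in> measurable P (count_space UNIV)"
    proof (rule measurable_count_space_eq2_countable[THEN iffD2, OF _ ], intro conjI)
      show "J n \<in> space P \<rightarrow> UNIV" by simp
      show "\<forall>a\<in>UNIV. J n -` {a} \<inter> space P \<in> sets P"
        using AP by (auto simp: A_def vimage_def Int_def conj_commute)
    qed
    from measurable_compose_countable'[OF _ this, of "\<lambda>i. N (r n i)"] have "(\<lambda>\<omega>. N (r n (J n \<omega>)) \<omega>) \<in> borel_measurable P"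
      using Nm[OF r0] by simp
    then show ?thesis by measurable
  qed
  have "(\<integral>\<^sup>+\<omega>. ennreal ((N (min t (\<tau> \<omega>)) \<omega>)\<^sup>2) \<partial>P)
      = (\<integral>\<^sup>+\<omega>. liminf (\<lambda>n. ennreal ((N (r n (J n \<omega>)) \<omega>)\<^sup>2)) \<partial>P)"
    using lim by (intro nn_integral_cong_AE, eventually_elim)
      (rule lim_imp_Liminf[OF sequentially_bot, symmetric])
  also have "\<dots> \<le> liminf (\<lambda>n. \<integral>\<^sup>+\<omega>. ennreal ((N (r n (J n \<omega>)) \<omega>)\<^sup>2) \<partial>P)"
    using meas by (rule nn_integral_liminf)
  also have "\<dots> \<le> (\<integral>\<^sup>+\<omega>. ennreal ((N t \<omega>)\<^sup>2) \<partial>P)"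
    using disc by (intro Liminf_le) (auto intro: always_eventually)
  finally show ?thesis .
qed

text \<open>
  Along a localizing sequence \<open>\<tau>\<^sub>n\<close> the second moment of the stopped martingale is the mean of the
  stopped bracket. Fatou's lemma gives the first inequality, since the stopped bracket is below \<open>V t\<close>.
  Fatou's lemma on the other side gives the second, since the stopped second moment is below that of
  \<open>N t\<close> by optional stopping; this step requires square integrability, which the first inequality
  supplies.
\<close>

lemma bracket_second_moment_ineqs:
  fixes N :: "real \<Rightarrow> 'w \<Rightarrow> real"
  assumes N: "martingale P F N" "continuous_paths P N" "AE \<omega> in P. N 0 \<omega> = 0"
    and V: "has_bracket P F N N V" "AE \<omega> in P. \<forall>s t. 0 \<le> s \<longrightarrow> s \<le> t \<longrightarrow> V s \<omega> \<le> V t \<omega>"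
    and fin: "\<And>t. 0 \<le> t \<Longrightarrow> (\<integral>\<^sup>+\<omega>. ennreal (V t \<omega>) \<partial>P) < \<infinity>" and t: "0 \<le> t"
  shows "(\<integral>\<^sup>+\<omega>. ennreal ((N t \<omega>)\<^sup>2) \<partial>P) \<le> (\<integral>\<^sup>+\<omega>. ennreal (V t \<omega>) \<partial>P)"
    and "(\<And>s. 0 \<le> s \<Longrightarrow> integrable P (\<lambda>\<omega>. (N s \<omega>)\<^sup>2)) \<Longrightarrow>
      (\<integral>\<^sup>+\<omega>. ennreal (V t \<omega>) \<partial>P) \<le> (\<integral>\<^sup>+\<omega>. ennreal ((N t \<omega>)\<^sup>2) \<partial>P)"
proof -
  have Vad: "adapted F V" and V0: "AE \<omega> in P. V 0 \<omega> = 0" and Vc: "continuous_paths P V"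
    and loc: "local_martingale P F (\<lambda>t \<omega>. N t \<omega> * N t \<omega> - V t \<omega>)"
    using V(1) unfolding has_bracket_def by blast+
  have Nm: "N s \<in> borel_measurable P" and Vm: "V s \<in> borel_measurable P" if "0 \<le> s" for s
    using martingaleD(2)[OF N(1) that] Vad that by (auto simp: adapted_def intro: filtration_measurable_P)
  from loc obtain \<tau> :: "nat \<Rightarrow> 'w \<Rightarrow> real" where \<tau>s: "\<forall>n. stopping_time F (\<tau> n)"
    "\<forall>n. \<forall>\<omega>\<in>space P. 0 \<le> \<tau> n \<omega>"
    "AE \<omega> in P. incseq (\<lambda>n. \<tau> n \<omega>) \<and> filterlim (\<lambda>n. \<tau> n \<omega>) at_top sequentially"
    "\<forall>n. martingale P F (\<lambda>t \<omega>. (N (min t (\<tau> n \<omega>)) \<omega> * N (min t (\<tau> n \<omega>)) \<omega> - V (min t (\<tau> n \<omega>)) \<omega>)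
        - (N 0 \<omega> * N 0 \<omega> - V 0 \<omega>))"
    unfolding local_martingale_def by (elim conjE exE)
  have "AE \<omega> in P. filterlim (\<lambda>n. \<tau> n \<omega>) at_top sequentially" using \<tau>s(3) by eventually_elim (rule conjunct2)
  note \<tau> = \<tau>s(1)[rule_format] \<tau>s(2)[rule_format] this \<tau>s(4)[rule_format]
  obtain N' where "\<And>\<omega>. continuous_on UNIV (\<lambda>t. N' t \<omega>)" and N': "(\<lambda>(t, \<omega>). N' t \<omega>) \<in> borel_measurable (borel \<Otimes>\<^sub>M P)" "AE \<omega> in P. \<forall>t\<ge>0. N' t \<omega> = N t \<omega>"
    by (rule continuous_modification[OF Nm N(2)]) (assumption | rule that)+
  obtain V' where "\<And>\<omega>. continuous_on UNIV (\<lambda>t. V' t \<omega>)" and V': "(\<lambda>(t, \<omega>). V' t \<omega>) \<in> borel_measurable (borel \<Otimes>\<^sub>M P)" "AE \<omega> in P. \<forall>t\<ge>0. V' t \<omega> = V t \<omega>"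
    by (rule continuous_modification[OF Vm Vc]) (assumption | rule that)+
  have \<tau>m[measurable]: "\<tau> n \<in> borel_measurable P" for n
  proof -
    have "{\<omega> \<in> space P. \<tau> n \<omega> \<le> c} \<in> sets P" for c
      using stopping_timeD[OF \<tau>(1), of n c] subalgebra_filtration[of c]
      by (auto simp: pred_def subalgebra_def space_filtration)
    then show ?thesis by (subst borel_measurable_iff_le) auto
  qed
  define S where "S n \<omega> = N' (min t (\<tau> n \<omega>)) \<omega>" for n \<omega>
  define W where "W n \<omega> = V' (min t (\<tau> n \<omega>)) \<omega>" for n \<omega>
  have pm: "(\<lambda>\<omega>. (min t (\<tau> n \<omega>), \<omega>)) \<in> measurable P (borel \<Otimes>\<^sub>M P)" for n by measurable
  have Sm[measurable]: "S n \<in> borel_measurable P" and Wm[measurable]: "W n \<in> borel_measurable P" for n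
    using measurable_compose[OF pm N'(1), of n] measurable_compose[OF pm V'(1), of n]
    by (simp_all add: S_def[abs_def] W_def[abs_def])
  have SW: "AE \<omega> in P. S n \<omega> = N (min t (\<tau> n \<omega>)) \<omega> \<and> W n \<omega> = V (min t (\<tau> n \<omega>)) \<omega>" for n
    using N'(2) V'(2) AE_space by eventually_elim (use t \<tau>(2) in \<open>auto simp: S_def W_def\<close>)
  have Wb: "AE \<omega> in P. 0 \<le> W n \<omega> \<and> W n \<omega> \<le> V t \<omega>" for n
    using SW[of n] V(2) V0 AE_space
  proof eventually_elim
    case (elim \<omega>)
    have "0 \<le> min t (\<tau> n \<omega>)" "min t (\<tau> n \<omega>) \<le> t" using t \<tau>(2) elim by auto
    then have "V 0 \<omega> \<le> V (min t (\<tau> n \<omega>)) \<omega>" "V (min t (\<tau> n \<omega>)) \<omega> \<le> V t \<omega>" using elim(2) by auto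
    then show ?case using elim by simp
  qed
  have Vpos: "AE \<omega> in P. 0 \<le> V t \<omega>" using Wb[of 0] by eventually_elim auto
  have Vi: "integrable P (V t)"
    using fin[OF t] Vpos by (intro integrableI_nonneg Vm t) auto
  have Wi: "integrable P (W n)" for n
    using Wb[of n] by (intro Bochner_Integration.integrable_bound[OF Vi]) auto
  have eq: "(\<integral>\<^sup>+\<omega>. ennreal ((S n \<omega>)\<^sup>2) \<partial>P) = (\<integral>\<^sup>+\<omega>. ennreal (W n \<omega>) \<partial>P)" for n
  proof -
    define Y where "Y r \<omega> = (N (min r (\<tau> n \<omega>)) \<omega> * N (min r (\<tau> n \<omega>)) \<omega> - V (min r (\<tau> n \<omega>)) \<omega>)
        - (N 0 \<omega> * N 0 \<omega> - V 0 \<omega>)" for r \<omega>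
    have Ym: "martingale P F Y" using \<tau>(4)[of n] by (simp add: Y_def[abs_def])
    note D = martingaleD[OF Ym]
    have "space P \<in> sets (F 0)" using sets.top[of "F 0"] by (simp add: space_filtration)
    from D(3)[OF _ t this] have "expectation (Y t) = expectation (Y 0)"
      using D(2)[OF t] D(2)[of 0] by (simp add: set_integral_space)
    also have "\<dots> = expectation (\<lambda>\<omega>. 0)"
      using \<tau>(2) by (intro Bochner_Integration.integral_cong) (auto simp: Y_def min_def)
    finally have EY: "expectation (Y t) = 0" by simp
    have YSW: "AE \<omega> in P. Y t \<omega> = (S n \<omega>)\<^sup>2 - W n \<omega>"
      using SW[of n] N(3) V0 by eventually_elim (simp add: Y_def power2_eq_square)
    have Yi: "integrable P (Y t)" by (rule D(2)[OF t])
    have "integrable P (\<lambda>\<omega>. Y t \<omega> + W n \<omega>)" using Yi Wi by simp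
    moreover have ae: "AE \<omega> in P. Y t \<omega> + W n \<omega> = (S n \<omega>)\<^sup>2" using YSW by eventually_elim simp
    ultimately have Si: "integrable P (\<lambda>\<omega>. (S n \<omega>)\<^sup>2)"
      by (subst integrable_cong_AE[symmetric, OF _ _ ae]) auto
    have "expectation (\<lambda>\<omega>. (S n \<omega>)\<^sup>2) = expectation (\<lambda>\<omega>. Y t \<omega> + W n \<omega>)"
      using Yi Wi ae by (intro integral_cong_AE) auto
    also have "\<dots> = expectation (W n)" using Yi Wi EY by simp
    finally have "expectation (\<lambda>\<omega>. (S n \<omega>)\<^sup>2) = expectation (W n)" .
    moreover have "(\<integral>\<^sup>+\<omega>. ennreal (W n \<omega>) \<partial>P) = ennreal (expectation (W n))"
      using Wb[of n] by (intro nn_integral_eq_integral Wi) auto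
    moreover have "(\<integral>\<^sup>+\<omega>. ennreal ((S n \<omega>)\<^sup>2) \<partial>P) = ennreal (expectation (\<lambda>\<omega>. (S n \<omega>)\<^sup>2))"
      by (intro nn_integral_eq_integral Si) auto
    ultimately show ?thesis by simp
  qed
  have ev: "AE \<omega> in P. \<forall>\<^sub>F n in sequentially. S n \<omega> = N t \<omega> \<and> W n \<omega> = V t \<omega>"
    using N'(2) V'(2) \<tau>(3)
  proof eventually_elim
    case (elim \<omega>)
    have "\<forall>\<^sub>F n in sequentially. t \<le> \<tau> n \<omega>" using elim(3) by (simp add: filterlim_at_top)
    then show ?case by eventually_elim (use elim t in \<open>auto simp: S_def W_def min_def\<close>)
  qed
  have liminf_const: "liminf f = x" if "\<forall>\<^sub>F n in sequentially. f n = x" for f and x :: ennreal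
    using tendsto_eventually[OF that] by (intro lim_imp_Liminf) auto
  have fatou: "(\<integral>\<^sup>+\<omega>. g \<omega> \<partial>P) \<le> liminf (\<lambda>n. \<integral>\<^sup>+\<omega>. f n \<omega> \<partial>P)"
    if "\<And>n. f n \<in> borel_measurable P" "AE \<omega> in P. \<forall>\<^sub>F n in sequentially. f n \<omega> = g \<omega>" for f and g :: "'w \<Rightarrow> ennreal"
  proof -
    have "(\<integral>\<^sup>+\<omega>. g \<omega> \<partial>P) = (\<integral>\<^sup>+\<omega>. liminf (\<lambda>n. f n \<omega>) \<partial>P)"
      using that(2) by (intro nn_integral_cong_AE, eventually_elim) (simp add: liminf_const)
    also have "\<dots> \<le> liminf (\<lambda>n. \<integral>\<^sup>+\<omega>. f n \<omega> \<partial>P)" by (rule nn_integral_liminf) (rule that(1))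
    finally show ?thesis .
  qed
  show "(\<integral>\<^sup>+\<omega>. ennreal ((N t \<omega>)\<^sup>2) \<partial>P) \<le> (\<integral>\<^sup>+\<omega>. ennreal (V t \<omega>) \<partial>P)"
  proof -
    have "(\<integral>\<^sup>+\<omega>. ennreal ((N t \<omega>)\<^sup>2) \<partial>P) \<le> liminf (\<lambda>n. \<integral>\<^sup>+\<omega>. ennreal ((S n \<omega>)\<^sup>2) \<partial>P)"
      using ev by (intro fatou) (auto elim!: eventually_mono)
    also have "\<dots> \<le> (\<integral>\<^sup>+\<omega>. ennreal (V t \<omega>) \<partial>P)"
    proof (intro Liminf_le always_eventually allI)
      fix n show "(\<integral>\<^sup>+\<omega>. ennreal ((S n \<omega>)\<^sup>2) \<partial>P) \<le> (\<integral>\<^sup>+\<omega>. ennreal (V t \<omega>) \<partial>P)"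
        unfolding eq using Wb[of n] by (intro nn_integral_mono_AE, eventually_elim) (auto intro: ennreal_leI)
    qed simp
    finally show ?thesis .
  qed
  show "(\<integral>\<^sup>+\<omega>. ennreal (V t \<omega>) \<partial>P) \<le> (\<integral>\<^sup>+\<omega>. ennreal ((N t \<omega>)\<^sup>2) \<partial>P)"
    if Ni: "\<And>s. 0 \<le> s \<Longrightarrow> integrable P (\<lambda>\<omega>. (N s \<omega>)\<^sup>2)"
  proof (cases "t = 0")
    case True
    have "(\<integral>\<^sup>+\<omega>. ennreal (V t \<omega>) \<partial>P) = (\<integral>\<^sup>+\<omega>. 0 \<partial>P)"
      using V0 unfolding True by (intro nn_integral_cong_AE, eventually_elim) simp
    then show ?thesis by simp
  next
    case False
    have "(\<integral>\<^sup>+\<omega>. ennreal (V t \<omega>) \<partial>P) \<le> liminf (\<lambda>n. \<integral>\<^sup>+\<omega>. ennreal (W n \<omega>) \<partial>P)"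
      using ev by (intro fatou) (auto elim!: eventually_mono)
    also have "\<dots> \<le> (\<integral>\<^sup>+\<omega>. ennreal ((N t \<omega>)\<^sup>2) \<partial>P)"
    proof (intro Liminf_le always_eventually allI)
      fix n
      have "(\<integral>\<^sup>+\<omega>. ennreal ((S n \<omega>)\<^sup>2) \<partial>P) = (\<integral>\<^sup>+\<omega>. ennreal ((N (min t (\<tau> n \<omega>)) \<omega>)\<^sup>2) \<partial>P)"
        using SW[of n] by (intro nn_integral_cong_AE, eventually_elim) simp
      also have "\<dots> \<le> (\<integral>\<^sup>+\<omega>. ennreal ((N t \<omega>)\<^sup>2) \<partial>P)"
        by (rule martingale_stopped_square_le[OF N(1) \<tau>(1) \<tau>(2) Ni _ N(2)]) (use False t in auto)
      finally show "(\<integral>\<^sup>+\<omega>. ennreal (W n \<omega>) \<partial>P) \<le> (\<integral>\<^sup>+\<omega>. ennreal ((N t \<omega>)\<^sup>2) \<partial>P)" unfolding eq .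
    qed simp
    finally show ?thesis .
  qed
qed

lemma bracket_second_moment:
  fixes N :: "real \<Rightarrow> 'w \<Rightarrow> real"
  assumes N: "martingale P F N" "continuous_paths P N" "AE \<omega> in P. N 0 \<omega> = 0"
    and V: "has_bracket P F N N V" "AE \<omega> in P. \<forall>s t. 0 \<le> s \<longrightarrow> s \<le> t \<longrightarrow> V s \<omega> \<le> V t \<omega>"
    and fin: "\<And>t. 0 \<le> t \<Longrightarrow> (\<integral>\<^sup>+\<omega>. ennreal (V t \<omega>) \<partial>P) < \<infinity>" and t: "0 \<le> t"
  shows "(\<integral>\<^sup>+\<omega>. ennreal ((N t \<omega>)\<^sup>2) \<partial>P) = (\<integral>\<^sup>+\<omega>. ennreal (V t \<omega>) \<partial>P)"
proof (rule antisym)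
  note ineqs = bracket_second_moment_ineqs[OF N V fin]
  show "(\<integral>\<^sup>+\<omega>. ennreal ((N t \<omega>)\<^sup>2) \<partial>P) \<le> (\<integral>\<^sup>+\<omega>. ennreal (V t \<omega>) \<partial>P)" by (rule ineqs(1)[OF _ t])
  have "integrable P (\<lambda>\<omega>. (N s \<omega>)\<^sup>2)" if s: "0 \<le> s" for s
  proof (rule integrableI_nonneg)
    have "N s \<in> borel_measurable P" using martingaleD(2)[OF N(1) s] by simp
    then show "(\<lambda>\<omega>. (N s \<omega>)\<^sup>2) \<in> borel_measurable P" by measurable
    show "(\<integral>\<^sup>+\<omega>. ennreal ((N s \<omega>)\<^sup>2) \<partial>P) < \<infinity>" by (rule le_less_trans[OF ineqs(1)[OF _ s] fin[OF s]])
  qed simp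
  then show "(\<integral>\<^sup>+\<omega>. ennreal (V t \<omega>) \<partial>P) \<le> (\<integral>\<^sup>+\<omega>. ennreal ((N t \<omega>)\<^sup>2) \<partial>P)" by (intro ineqs(2)[OF _ t])
qed

text \<open>
  Parseval's identity in the basis that defines the trace, the scalar identity in each coordinate, and
  Tonelli's theorem.
\<close>

lemma covariation_second_moment:
  fixes M :: "real \<Rightarrow> 'w \<Rightarrow> 'b::{real_inner, banach, second_countable_topology}"
  assumes M: "martingale P F M" "continuous_paths P M" "AE \<omega> in P. M 0 \<omega> = 0"
      "\<And>t \<omega>. 0 \<le> t \<Longrightarrow> \<omega> \<in> space P \<Longrightarrow> M t \<omega> \<in> H"
    and Q: "covariation_operator P F H M Q" and H: "subspace H" "closed H"
    and fin: "\<And>t. 0 \<le> t \<Longrightarrow> (\<integral>\<^sup>+\<omega>. (\<integral>\<^sup>+s\<in>{0..t}. trace_on H (Q s \<omega>) \<partial>lborel) \<partial>P) < \<infinity>"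
  shows trace_measurable: "(\<lambda>(s, \<omega>). trace_on H (Q (max 0 s) \<omega>)) \<in> borel_measurable (borel \<Otimes>\<^sub>M P)"
    and "0 \<le> t \<Longrightarrow> (\<integral>\<^sup>+\<omega>. ennreal ((norm (M t \<omega>))\<^sup>2) \<partial>P)
      = (\<integral>\<^sup>+s\<in>{0..t}. (\<integral>\<^sup>+\<omega>. trace_on H (Q s \<omega>) \<partial>P) \<partial>lborel)"
proof -
  interpret PS: pair_sigma_finite lborel P ..
  define E where "E = (SOME E. orthonormal_basis_on H E)"
  have "orthonormal_basis_on H E" unfolding E_def using orthonormal_basis_on_exists[OF H] by (rule someI_ex)
  then obtain e where e: "orthonormal_seq H e"
    and esum: "\<And>g :: 'b \<Rightarrow> ennreal. g 0 = 0 \<Longrightarrow> (\<Sum>\<^sub>\<infinity>x\<in>E. g x) = (\<Sum>n. g (e n))"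
    by (rule orthonormal_basis_on_enumerate) (rule that)
  have eH: "e n \<in> H" for n
    using e closure_subset[of "span (range e)"] span_base[of "e n" "range e"] by (auto simp: orthonormal_seq_def)
  have tr: "trace_on H T = (\<Sum>n. ennreal (T (e n) \<bullet> e n))" for T
    unfolding trace_on_def E_def[symmetric] by (rule esum) simp
  have Qpos: "0 \<le> Q s \<omega> x \<bullet> x" if "0 \<le> s" "\<omega> \<in> space P" "x \<in> H" for s \<omega> x
  proof -
    have "nonneg_bounded_op_on H (Q s \<omega>)" using Q that unfolding covariation_operator_def by blast
    then show ?thesis using that(3) unfolding nonneg_bounded_op_on_def by blast
  qed
  have Qm: "(\<lambda>(t, \<omega>). Q t \<omega> (e n) \<bullet> e n) \<in> borel_measurable (restrict_space borel {0..} \<Otimes>\<^sub>M P)"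
    and Qi: "AE \<omega> in P. \<forall>t\<ge>0. set_integrable lborel {0..t} (\<lambda>s. Q s \<omega> (e n) \<bullet> e n)"
    and Qb: "has_bracket P F (\<lambda>t \<omega>. M t \<omega> \<bullet> e n) (\<lambda>t \<omega>. M t \<omega> \<bullet> e n)
          (\<lambda>t \<omega>. LINT s:{0..t}|lborel. Q s \<omega> (e n) \<bullet> e n)" for n
    using Q eH[of n] unfolding covariation_operator_def by blast+
  define q where "q n = (\<lambda>(s, \<omega>). ennreal (Q (max 0 s) \<omega> (e n) \<bullet> e n))" for n
  have qm[measurable]: "q n \<in> borel_measurable (borel \<Otimes>\<^sub>M P)" for n
  proof -
    have "(\<lambda>x. (max 0 (fst x), snd x)) \<in> measurable ((borel :: real measure) \<Otimes>\<^sub>M P) (restrict_space borel {0..} \<Otimes>\<^sub>M P)"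
      by (intro measurable_Pair measurable_restrict_space2) auto
    from measurable_compose[OF this Qm[of n]] have "(\<lambda>x. Q (max 0 (fst x)) (snd x) (e n) \<bullet> e n) \<in> borel_measurable (borel \<Otimes>\<^sub>M P)"
      by simp
    then show ?thesis unfolding q_def split_beta by measurable
  qed
  have trq: "trace_on H (Q (max 0 s) \<omega>) = (\<Sum>n. q n (s, \<omega>))" for s \<omega> by (simp add: tr q_def)
  show "(\<lambda>(s, \<omega>). trace_on H (Q (max 0 s) \<omega>)) \<in> borel_measurable (borel \<Otimes>\<^sub>M P)"
    unfolding trq split_beta by simp
  define V where "V n t \<omega> = (LINT s:{0..t}|lborel. Q s \<omega> (e n) \<bullet> e n)" for n t \<omega>
  have VV: "AE \<omega> in P. \<forall>t\<ge>0. 0 \<le> V n t \<omega> \<and> ennreal (V n t \<omega>) = (\<integral>\<^sup>+s\<in>{0..t}. q n (s, \<omega>) \<partial>lborel)" for n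
    using Qi[of n] AE_space
  proof eventually_elim
    case (elim \<omega>)
    show ?case
    proof (intro allI impI)
      fix t :: real assume t: "0 \<le> t"
      have i: "integrable lborel (\<lambda>s. indicator {0..t} s *\<^sub>R (Q s \<omega> (e n) \<bullet> e n))"
        using elim(1) t unfolding set_integrable_def by blast
      have pos: "0 \<le> indicator {0..t} s *\<^sub>R (Q s \<omega> (e n) \<bullet> e n)" for s
        using Qpos[OF _ elim(2) eH] by (auto simp: indicator_def)
      have "(\<integral>\<^sup>+s\<in>{0..t}. q n (s, \<omega>) \<partial>lborel) = (\<integral>\<^sup>+s. ennreal (indicator {0..t} s *\<^sub>R (Q s \<omega> (e n) \<bullet> e n)) \<partial>lborel)"
        by (intro nn_integral_cong) (auto simp: q_def indicator_def)
      also have "\<dots> = ennreal (V n t \<omega>)"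
        unfolding V_def set_lebesgue_integral_def using i pos by (intro nn_integral_eq_integral) auto
      finally have "ennreal (V n t \<omega>) = (\<integral>\<^sup>+s\<in>{0..t}. q n (s, \<omega>) \<partial>lborel)" by simp
      moreover have "0 \<le> V n t \<omega>"
        unfolding V_def set_lebesgue_integral_def by (rule integral_nonneg_AE) (intro AE_I2 pos)
      ultimately show "0 \<le> V n t \<omega> \<and> ennreal (V n t \<omega>) = (\<integral>\<^sup>+s\<in>{0..t}. q n (s, \<omega>) \<partial>lborel)" by simp
    qed
  qed
  have EV: "(\<integral>\<^sup>+\<omega>. ennreal (V n t \<omega>) \<partial>P) = (\<integral>\<^sup>+\<omega>. (\<integral>\<^sup>+s\<in>{0..t}. q n (s, \<omega>) \<partial>lborel) \<partial>P)" if "0 \<le> t" for n t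
    using VV[of n] that by (intro nn_integral_cong_AE) (auto elim!: eventually_mono)
  have qtr: "(\<integral>\<^sup>+s\<in>{0..t}. q n (s, \<omega>) \<partial>lborel) \<le> (\<integral>\<^sup>+s\<in>{0..t}. trace_on H (Q s \<omega>) \<partial>lborel)" for n t \<omega>
  proof (intro nn_integral_mono)
    fix s
    have "q n (s, \<omega>) \<le> trace_on H (Q (max 0 s) \<omega>)"
      unfolding trq using sum_le_suminf[of "\<lambda>n. q n (s, \<omega>)" "{n}"] by simp
    then show "q n (s, \<omega>) * indicator {0..t} s \<le> trace_on H (Q s \<omega>) * indicator {0..t} s"
      by (auto simp: indicator_def max_def)
  qed
  have comp: "(\<integral>\<^sup>+\<omega>. ennreal ((M t \<omega> \<bullet> e n)\<^sup>2) \<partial>P) = (\<integral>\<^sup>+\<omega>. ennreal (V n t \<omega>) \<partial>P)" if t: "0 \<le> t" for n t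
  proof (rule bracket_second_moment[OF _ _ _ _ _ _ t])
    show "martingale P F (\<lambda>t \<omega>. M t \<omega> \<bullet> e n)"
      by (rule martingale_bounded_linear[OF M(1) bounded_linear_inner_left])
    show "continuous_paths P (\<lambda>t \<omega>. M t \<omega> \<bullet> e n)"
      using M(2) unfolding continuous_paths_def by eventually_elim (intro continuous_intros)
    show "AE \<omega> in P. M 0 \<omega> \<bullet> e n = 0" using M(3) by eventually_elim simp
    show "has_bracket P F (\<lambda>t \<omega>. M t \<omega> \<bullet> e n) (\<lambda>t \<omega>. M t \<omega> \<bullet> e n) (V n)"
      using Qb[of n] by (simp add: V_def[abs_def])
    show "AE \<omega> in P. \<forall>s t. 0 \<le> s \<longrightarrow> s \<le> t \<longrightarrow> V n s \<omega> \<le> V n t \<omega>"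
      using VV[of n]
    proof eventually_elim
      case (elim \<omega>)
      show ?case
      proof (intro allI impI)
        fix s t :: real assume st: "0 \<le> s" "s \<le> t"
        have s: "0 \<le> V n s \<omega> \<and> ennreal (V n s \<omega>) = (\<integral>\<^sup>+r\<in>{0..s}. q n (r, \<omega>) \<partial>lborel)"
          by (rule elim[rule_format, OF st(1)])
        have t: "0 \<le> V n t \<omega> \<and> ennreal (V n t \<omega>) = (\<integral>\<^sup>+r\<in>{0..t}. q n (r, \<omega>) \<partial>lborel)"
          by (rule elim[rule_format, OF order_trans[OF st]])
        have "(\<integral>\<^sup>+r\<in>{0..s}. q n (r, \<omega>) \<partial>lborel) \<le> (\<integral>\<^sup>+r\<in>{0..t}. q n (r, \<omega>) \<partial>lborel)"
          using st(2) by (intro nn_integral_mono mult_left_mono) (auto simp: indicator_def)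
        then have "ennreal (V n s \<omega>) \<le> ennreal (V n t \<omega>)"
          by (simp only: conjunct2[OF s] conjunct2[OF t])
        then show "V n s \<omega> \<le> V n t \<omega>" by (simp only: ennreal_le_iff[OF conjunct1[OF t]])
      qed
    qed
    fix t :: real assume t: "0 \<le> t"
    have "(\<integral>\<^sup>+\<omega>. ennreal (V n t \<omega>) \<partial>P) \<le> (\<integral>\<^sup>+\<omega>. (\<integral>\<^sup>+s\<in>{0..t}. trace_on H (Q s \<omega>) \<partial>lborel) \<partial>P)"
      unfolding EV[OF t] by (intro nn_integral_mono qtr)
    then show "(\<integral>\<^sup>+\<omega>. ennreal (V n t \<omega>) \<partial>P) < \<infinity>" using fin[OF t] by (rule le_less_trans)
  qed
  assume t: "0 \<le> t"
  have Mm[measurable]: "M t \<in> borel_measurable P" using martingaleD(2)[OF M(1) t] by simp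
  have "(\<integral>\<^sup>+\<omega>. ennreal ((norm (M t \<omega>))\<^sup>2) \<partial>P) = (\<integral>\<^sup>+\<omega>. (\<Sum>n. ennreal ((M t \<omega> \<bullet> e n)\<^sup>2)) \<partial>P)"
    by (intro nn_integral_cong orthonormal_parseval(2)[OF e M(4)[OF t], symmetric])
  also have "\<dots> = (\<Sum>n. \<integral>\<^sup>+\<omega>. ennreal ((M t \<omega> \<bullet> e n)\<^sup>2) \<partial>P)" by (rule nn_integral_suminf) measurable
  also have "\<dots> = (\<Sum>n. \<integral>\<^sup>+\<omega>. (\<integral>\<^sup>+s\<in>{0..t}. q n (s, \<omega>) \<partial>lborel) \<partial>P)" by (simp add: comp t EV)
  also have "\<dots> = (\<Sum>n. \<integral>\<^sup>+s. (\<integral>\<^sup>+\<omega>. q n (s, \<omega>) * indicator {0..t} s \<partial>P) \<partial>lborel)"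
    by (intro suminf_cong PS.Fubini'[where f="\<lambda>s \<omega>. q _ (s, \<omega>) * indicator {0..t} s"]) measurable
  also have "\<dots> = (\<integral>\<^sup>+s. (\<Sum>n. \<integral>\<^sup>+\<omega>. q n (s, \<omega>) * indicator {0..t} s \<partial>P) \<partial>lborel)"
    by (rule nn_integral_suminf[symmetric]) measurable
  also have "\<dots> = (\<integral>\<^sup>+s. (\<integral>\<^sup>+\<omega>. (\<Sum>n. q n (s, \<omega>) * indicator {0..t} s) \<partial>P) \<partial>lborel)"
    by (intro nn_integral_cong nn_integral_suminf[symmetric]) measurable
  also have "\<dots> = (\<integral>\<^sup>+s\<in>{0..t}. (\<integral>\<^sup>+\<omega>. trace_on H (Q s \<omega>) \<partial>P) \<partial>lborel)"
  proof (rule nn_integral_cong)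
    fix s
    show "(\<integral>\<^sup>+\<omega>. (\<Sum>n. q n (s, \<omega>) * indicator {0..t} s) \<partial>P)
        = (\<integral>\<^sup>+\<omega>. trace_on H (Q s \<omega>) \<partial>P) * indicator {0..t} s"
      using trq[of s] by (cases "s \<in> {0..t}") (auto simp: max_def)
  qed
  finally show "(\<integral>\<^sup>+\<omega>. ennreal ((norm (M t \<omega>))\<^sup>2) \<partial>P)
      = (\<integral>\<^sup>+s\<in>{0..t}. (\<integral>\<^sup>+\<omega>. trace_on H (Q s \<omega>) \<partial>P) \<partial>lborel)" .
qed

end

section \<open>A Gronwall inequality with an increasing forcing term\<close>

lemma set_integral_FTC:
  fixes F f :: "real \<Rightarrow> real"
  assumes "a \<le> b" "\<And>x. a \<le> x \<Longrightarrow> x \<le> b \<Longrightarrow> (F has_vector_derivative f x) (at x within {a..b})"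
    "continuous_on {a..b} f"
  shows "set_integrable lborel {a..b} f" "(LINT x:{a..b}|lborel. f x) = F b - F a"
proof -
  show "set_integrable lborel {a..b} f"
    unfolding set_integrable_def using borel_integrable_atLeastAtMost'[OF assms(3)] by (simp add: set_integrable_def)
  show "(LINT x:{a..b}|lborel. f x) = F b - F a"
    unfolding set_lebesgue_integral_def using integral_FTC_Icc[OF assms(1,2,3)] by simp
qed

lemma set_integral_point: "(LINT x:{a..a}|lborel. f x) = 0" for a :: real
  unfolding set_lebesgue_integral_def
  by (rule integral_eq_zero_AE, rule eventually_mono[OF AE_lborel_singleton[of a]]) (simp add: indicator_def)

text \<open>
  Integration by parts for an absolutely continuous \<open>F\<close>, as Fubini's theorem on the triangle \<open>r \<le> s \<le> t\<close>.
\<close>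

lemma exp_weight_by_parts:
  fixes f :: "real \<Rightarrow> real"
  assumes f: "set_integrable lborel {0..t} f" and t: "0 \<le> t" and c: "0 < c"
  defines "F \<equiv> \<lambda>s. LINT r:{0..s}|lborel. f r"
  shows "set_integrable lborel {0..t} (\<lambda>s. c * exp (c * s) * F s)"
    and "set_integrable lborel {0..t} (\<lambda>s. exp (c * s) * f s)"
    and "(LINT s:{0..t}|lborel. c * exp (c * s) * F s) = exp (c * t) * F t - (LINT s:{0..t}|lborel. exp (c * s) * f s)"
proof -
  define g where "g r = indicator {0..t} r * f r" for r
  have gi: "integrable lborel g" using f by (simp add: set_integrable_def g_def[abs_def])
  have gm[measurable]: "g \<in> borel_measurable borel" using gi by auto
  define k where "k s r = (if 0 \<le> r \<and> r \<le> s \<and> s \<le> t then c * exp (c * s) * g r else 0)" for s r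
  have km: "case_prod k \<in> borel_measurable (lborel \<Otimes>\<^sub>M lborel)"
    unfolding k_def split_beta by measurable
  have kb: "\<bar>k s r\<bar> \<le> indicator {0..t} s * (c * exp (c * t)) * \<bar>g r\<bar>" for s r
    using c by (auto simp: k_def abs_mult indicator_def intro!: mult_right_mono)
  have ki: "integrable (lborel \<Otimes>\<^sub>M lborel) (case_prod k)"
  proof (rule lborel_pair.Fubini_integrable)
    show "case_prod k \<in> borel_measurable (lborel \<Otimes>\<^sub>M lborel)" by (rule km)
    have ks: "integrable lborel (\<lambda>r. k s r)" for s
    proof (rule Bochner_Integration.integrable_bound)
      show "integrable lborel (\<lambda>r. indicator {0..t} s * (c * exp (c * t)) * \<bar>g r\<bar>)" using gi by simp
      show "k s \<in> borel_measurable lborel" unfolding k_def[abs_def] by measurable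
      show "AE r in lborel. norm (k s r) \<le> norm (indicator {0..t} s * (c * exp (c * t)) * \<bar>g r\<bar>)"
        using kb c by (intro AE_I2) (smt (verit) real_norm_def)
    qed
    then show "AE s in lborel. integrable lborel (\<lambda>r. case_prod k (s, r))" by simp
    show "integrable lborel (\<lambda>s. \<integral>r. norm (case_prod k (s, r)) \<partial>lborel)"
    proof (rule Bochner_Integration.integrable_bound)
      show "integrable lborel (\<lambda>s. indicator {0..t} s * (c * exp (c * t) * (\<integral>r. \<bar>g r\<bar> \<partial>lborel)))"
        by (intro integrable_mult_left integrable_real_indicator) (simp_all add: emeasure_lborel_Icc_eq)
      show "(\<lambda>s. \<integral>r. norm (case_prod k (s, r)) \<partial>lborel) \<in> borel_measurable lborel"
        using km by measurable
      have "(\<integral>r. \<bar>k s r\<bar> \<partial>lborel) \<le> (\<integral>r. indicator {0..t} s * (c * exp (c * t)) * \<bar>g r\<bar> \<partial>lborel)" for s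
        using ks gi kb by (intro integral_mono) auto
      then show "AE s in lborel. norm (\<integral>r. norm (case_prod k (s, r)) \<partial>lborel)
          \<le> norm (indicator {0..t} s * (c * exp (c * t) * (\<integral>r. \<bar>g r\<bar> \<partial>lborel)))"
        using c by (intro AE_I2) (simp add: abs_mult mult.assoc)
    qed
  qed
  have inner_r: "(\<integral>r. k s r \<partial>lborel) = indicator {0..t} s *\<^sub>R (c * exp (c * s) * F s)" for s
  proof -
    have "(\<integral>r. k s r \<partial>lborel) = (\<integral>r. (indicator {0..t} s * (c * exp (c * s))) * (indicator {0..s} r *\<^sub>R f r) \<partial>lborel)"
      by (intro Bochner_Integration.integral_cong) (auto simp: k_def g_def indicator_def)
    then show ?thesis by (simp add: F_def set_lebesgue_integral_def)
  qed
  have inner_s: "(\<integral>s. k s r \<partial>lborel) = exp (c * t) * g r - indicator {0..t} r *\<^sub>R (exp (c * r) * f r)" for r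
  proof (cases "r \<in> {0..t}")
    case True
    have "(LINT s:{r..t}|lborel. c * exp (c * s)) = exp (c * t) - exp (c * r)"
    proof (rule set_integral_FTC(2))
      show "((\<lambda>s. exp (c * s)) has_vector_derivative c * exp (c * x)) (at x within {r..t})" for x
        by (auto simp flip: has_real_derivative_iff_has_vector_derivative intro!: derivative_eq_intros)
    qed (use True in \<open>auto intro!: continuous_intros\<close>)
    moreover have "(\<integral>s. k s r \<partial>lborel) = (\<integral>s. g r * (indicator {r..t} s *\<^sub>R (c * exp (c * s))) \<partial>lborel)"
      using True by (intro Bochner_Integration.integral_cong) (auto simp: k_def indicator_def)
    ultimately have "(\<integral>s. k s r \<partial>lborel) = g r * (exp (c * t) - exp (c * r))"
      by (simp only: set_lebesgue_integral_def integral_mult_right_zero)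
    then show ?thesis using True by (simp add: g_def algebra_simps)
  next
    case False
    then have "k s r = 0" for s by (auto simp: k_def)
    then show ?thesis using False by (simp add: g_def)
  qed
  have "integrable lborel (\<lambda>r. \<integral>s. k s r \<partial>lborel)" using lborel_pair.integrable_snd[OF ki] by simp
  then have i1: "integrable lborel (\<lambda>r. exp (c * t) * g r - indicator {0..t} r *\<^sub>R (exp (c * r) * f r))"
    by (simp only: inner_s)
  have i2: "integrable lborel (\<lambda>r. exp (c * t) * g r)" using gi by simp
  have i3: "integrable lborel (\<lambda>r. indicator {0..t} r *\<^sub>R (exp (c * r) * f r))"
    using Bochner_Integration.integrable_diff[OF i2 i1] by simp
  then show "set_integrable lborel {0..t} (\<lambda>s. exp (c * s) * f s)" by (simp add: set_integrable_def)
  have "integrable lborel (\<lambda>s. \<integral>r. k s r \<partial>lborel)" using lborel_pair.integrable_fst[OF ki] by simp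
  then show "set_integrable lborel {0..t} (\<lambda>s. c * exp (c * s) * F s)"
    unfolding set_integrable_def by (simp only: inner_r)
  have "(LINT s:{0..t}|lborel. c * exp (c * s) * F s) = (\<integral>s. (\<integral>r. k s r \<partial>lborel) \<partial>lborel)"
    by (simp only: inner_r set_lebesgue_integral_def)
  also have "\<dots> = (\<integral>r. (\<integral>s. k s r \<partial>lborel) \<partial>lborel)" by (rule lborel_pair.Fubini_integral[OF ki, symmetric])
  also have "\<dots> = (\<integral>r. exp (c * t) * g r \<partial>lborel) - (LINT r:{0..t}|lborel. exp (c * r) * f r)"
    unfolding inner_s set_lebesgue_integral_def by (rule Bochner_Integration.integral_diff[OF i2 i3])
  also have "(\<integral>r. exp (c * t) * g r \<partial>lborel) = exp (c * t) * F t"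
    by (simp add: F_def set_lebesgue_integral_def g_def)
  finally show "(LINT s:{0..t}|lborel. c * exp (c * s) * F s) = exp (c * t) * F t - (LINT s:{0..t}|lborel. exp (c * s) * f s)" .
qed

text \<open>
  In the application \<open>\<phi>\<close> is the mean energy, \<open>\<psi>\<close> its absolutely continuous drift and \<open>n\<close> the second moment
  of the noise, which is nondecreasing with increments bounded by integrals of \<open>q\<close>, but is not given as an
  integral. Multiplying by \<open>exp (c s)\<close> and integrating by parts, one uses that
  \<open>n - \<integral> q\<close> is at any earlier time at least its value at time \<open>t\<close>.
\<close>

lemma gronwall_with_increasing_part:
  fixes \<phi> \<psi> n h q :: "real \<Rightarrow> real"
  assumes c: "0 < c" and t: "0 \<le> t"
    and \<psi>: "set_integrable lborel {0..t} \<psi>" and q: "set_integrable lborel {0..t} q"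
    and h: "set_integrable lborel {0..t} h" and n: "set_integrable lborel {0..t} n"
    and \<phi>: "\<And>s. 0 \<le> s \<Longrightarrow> s \<le> t \<Longrightarrow> \<phi> s = A + (LINT r:{0..s}|lborel. \<psi> r) + n s"
    and n0: "n 0 = 0"
    and n_le: "\<And>s. 0 \<le> s \<Longrightarrow> s \<le> t \<Longrightarrow> n t - n s \<le> (LINT r:{0..t}|lborel. q r) - (LINT r:{0..s}|lborel. q r)"
    and drift: "AE s in lborel. s \<in> {0..t} \<longrightarrow> \<psi> s \<le> - c * \<phi> s + h s"
  shows "\<phi> t \<le> exp (- c * t) * A + (LINT s:{0..t}|lborel. exp (- c * (t - s)) * (h s + q s))"
proof -
  define \<Psi> where "\<Psi> s = (LINT r:{0..s}|lborel. \<psi> r)" for s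
  define Q where "Q s = (LINT r:{0..s}|lborel. q r)" for s
  let ?I = "\<lambda>f. LINT s:{0..t}|lborel. f s"
  let ?w = "\<lambda>s. c * exp (c * s)"
  note P\<psi> = exp_weight_by_parts[OF \<psi> t c, folded \<Psi>_def] and Pq = exp_weight_by_parts[OF q t c, folded Q_def]
  have w: "set_integrable lborel {0..t} ?w" "?I ?w = exp (c * t) - 1"
  proof -
    have d: "((\<lambda>s. exp (c * s)) has_vector_derivative ?w x) (at x within {0..t})" for x
      by (auto simp flip: has_real_derivative_iff_has_vector_derivative intro!: derivative_eq_intros)
    have "continuous_on {0..t} ?w" by (intro continuous_intros)
    from set_integral_FTC[OF t d this] show "set_integrable lborel {0..t} ?w" "?I ?w = exp (c * t) - 1" by auto
  qed
  have bound: "set_integrable lborel {0..t} (\<lambda>s. exp (c * s) * f s)" if "set_integrable lborel {0..t} f" for f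
    by (rule exp_weight_by_parts(2)[OF that t c])
  have wn: "set_integrable lborel {0..t} (\<lambda>s. ?w s * n s)"
    using set_integrable_mult_right[OF bound[OF n], of c] by (simp add: mult.assoc)
  have \<phi>eq: "?w s * \<phi> s = A * ?w s + ?w s * \<Psi> s + ?w s * n s" if "s \<in> {0..t}" for s
    using that \<phi>[of s] by (simp add: \<Psi>_def algebra_simps)
  have i\<phi>: "set_integrable lborel {0..t} (\<lambda>s. A * ?w s + ?w s * \<Psi> s + ?w s * n s)"
    using set_integrable_mult_right[OF w(1), of A] P\<psi>(1) wn by (intro set_integral_add) auto
  have w\<phi>: "set_integrable lborel {0..t} (\<lambda>s. ?w s * \<phi> s)"
    using i\<phi> by (rule set_integrable_cong[THEN iffD1, rotated 3]) (use \<phi>eq in auto)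
  have "?I (\<lambda>s. ?w s * \<phi> s) = ?I (\<lambda>s. A * ?w s + ?w s * \<Psi> s + ?w s * n s)"
    by (intro set_lebesgue_integral_cong) (use \<phi>eq in auto)
  also have "\<dots> = A * ?I ?w + ?I (\<lambda>s. ?w s * \<Psi> s) + ?I (\<lambda>s. ?w s * n s)"
    using set_integrable_mult_right[OF w(1), of A] P\<psi>(1) wn by (simp add: set_integral_add set_integral_mult_right)
  finally have E1: "?I (\<lambda>s. ?w s * \<phi> s) = A * (exp (c * t) - 1) + (exp (c * t) * \<Psi> t - ?I (\<lambda>s. exp (c * s) * \<psi> s))
      + ?I (\<lambda>s. ?w s * n s)" using P\<psi>(3) w(2) by simp
  \<comment> \<open>The comparison of \<open>n - Q\<close> at times \<open>s\<close> and \<open>t\<close>, integrated against the weight.\<close>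
  have "?I (\<lambda>s. (n t - Q t) * ?w s + ?w s * Q s) \<le> ?I (\<lambda>s. ?w s * n s)"
  proof (rule set_integral_mono[OF _ wn])
    show "set_integrable lborel {0..t} (\<lambda>s. (n t - Q t) * ?w s + ?w s * Q s)"
      using set_integrable_mult_right[OF w(1), of "n t - Q t"] Pq(1) by (intro set_integral_add) auto
    fix s assume "s \<in> {0..t}"
    then have "n t - Q t + Q s \<le> n s" using n_le[of s] by (auto simp: Q_def)
    then have "?w s * (n t - Q t + Q s) \<le> ?w s * n s" using c by (intro mult_left_mono) auto
    then show "(n t - Q t) * ?w s + ?w s * Q s \<le> ?w s * n s" by (simp add: algebra_simps)
  qed
  moreover have "?I (\<lambda>s. (n t - Q t) * ?w s + ?w s * Q s)
      = (n t - Q t) * (exp (c * t) - 1) + (exp (c * t) * Q t - ?I (\<lambda>s. exp (c * s) * q s))"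
    using set_integrable_mult_right[OF w(1), of "n t - Q t"] Pq(1,3) w(2)
    by (simp add: set_integral_add set_integral_mult_right)
  ultimately have E2: "(n t - Q t) * (exp (c * t) - 1) + (exp (c * t) * Q t - ?I (\<lambda>s. exp (c * s) * q s))
      \<le> ?I (\<lambda>s. ?w s * n s)" by simp
  have "n t - n 0 \<le> Q t - Q 0" unfolding Q_def by (rule n_le) (use t in auto)
  moreover have "Q 0 = 0" unfolding Q_def by (rule set_integral_point)
  ultimately have Q0: "n t - Q t \<le> 0" using n0 by simp
  have E3: "?I (\<lambda>s. exp (c * s) * \<psi> s) + ?I (\<lambda>s. ?w s * \<phi> s) \<le> ?I (\<lambda>s. exp (c * s) * h s)"
  proof -
    have "?I (\<lambda>s. exp (c * s) * \<psi> s) + ?I (\<lambda>s. ?w s * \<phi> s) = ?I (\<lambda>s. exp (c * s) * \<psi> s + ?w s * \<phi> s)"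
      by (rule set_integral_add(2)[OF bound[OF \<psi>] w\<phi>, symmetric])
    also have "\<dots> \<le> ?I (\<lambda>s. exp (c * s) * h s)"
    proof (rule set_integral_mono_AE[OF set_integral_add(1)[OF bound[OF \<psi>] w\<phi>] bound[OF h]])
      show "AE s\<in>{0..t} in lborel. exp (c * s) * \<psi> s + ?w s * \<phi> s \<le> exp (c * s) * h s"
        using drift
      proof eventually_elim
        case (elim s)
        have "exp (c * s) * (\<psi> s + c * \<phi> s) \<le> exp (c * s) * h s" if "s \<in> {0..t}"
          using elim that by (intro mult_left_mono) auto
        then show ?case by (simp add: algebra_simps)
      qed
    qed
    finally show ?thesis .
  qed
  have "exp (c * t) * \<phi> t = exp (c * t) * A + exp (c * t) * \<Psi> t + exp (c * t) * n t"
    using \<phi>[of t] t by (simp add: \<Psi>_def algebra_simps)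
  with E1 E2 E3 Q0 have main: "exp (c * t) * \<phi> t \<le> A + (?I (\<lambda>s. exp (c * s) * h s) + ?I (\<lambda>s. exp (c * s) * q s))"
    by (simp add: algebra_simps)
  have "?I (\<lambda>s. exp (- c * (t - s)) * (h s + q s)) = ?I (\<lambda>s. exp (- c * t) * (exp (c * s) * h s + exp (c * s) * q s))"
    by (intro set_lebesgue_integral_cong) (auto simp: algebra_simps simp flip: exp_add)
  also have "\<dots> = exp (- c * t) * (?I (\<lambda>s. exp (c * s) * h s) + ?I (\<lambda>s. exp (c * s) * q s))"
    using bound[OF h] bound[OF q] by (simp add: set_integral_mult_right set_integral_add)
  finally have "exp (- c * t) * A + ?I (\<lambda>s. exp (- c * (t - s)) * (h s + q s))
      = exp (- c * t) * (A + (?I (\<lambda>s. exp (c * s) * h s) + ?I (\<lambda>s. exp (c * s) * q s)))"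
    by (simp add: distrib_left)
  moreover have "\<phi> t = exp (- c * t) * (exp (c * t) * \<phi> t)" by (simp flip: mult.assoc exp_add)
  moreover have "exp (- c * t) * (exp (c * t) * \<phi> t)
      \<le> exp (- c * t) * (A + (?I (\<lambda>s. exp (c * s) * h s) + ?I (\<lambda>s. exp (c * s) * q s)))"
    by (rule mult_left_mono[OF main]) simp
  ultimately show ?thesis by linarith
qed

section \<open>Energy inequalities for the regularized equation\<close>

lemma two_mult_le: "2 * (x * y) \<le> x\<^sup>2 + y\<^sup>2" for x y :: real
  using sum_squares_bound[of x y] by (simp add: mult.assoc)

text \<open>
  In the application, \<open>R = (I + \<epsilon> B\<^sup>2)\<^sup>-\<^sup>1\<close>, \<open>S = B R\<close> and \<open>K = B\<^sup>2 R = (I - R) / \<epsilon>\<close>. The inner product identity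
  expresses \<open>(B R x, B R y) = (B\<^sup>2 R x, R y)\<close>, and \<open>\<eta>\<close> is the spectral gap.
\<close>

locale regularized_wave =
  fixes R S K :: "'h::{real_inner, banach, second_countable_topology} \<Rightarrow> 'h" and \<alpha> lam \<eta> :: real
  assumes bounded_linear_R: "bounded_linear R" and bounded_linear_S: "bounded_linear S"
    and bounded_linear_K: "bounded_linear K"
    and norm_R_le: "norm (R x) \<le> norm x"
    and S_inner: "S x \<bullet> S y = K x \<bullet> R y"
    and gap: "\<eta> * (norm (R x))\<^sup>2 \<le> (norm (S x))\<^sup>2"
    and alpha_pos: "0 < \<alpha>" and lam_pos: "0 < lam" and lam_le: "lam \<le> \<alpha> / 2" "4 * \<alpha> * lam \<le> \<eta>"
begin

lemma lam_R_le_S: "4 * \<alpha> * lam * (norm (R x))\<^sup>2 \<le> (norm (S x))\<^sup>2"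
  using mult_right_mono[OF lam_le(2), of "(norm (R x))\<^sup>2"] gap[of x] by simp

text \<open>
  The skewness of the wave equation: \<open>(R v, K u)\<close> equals \<open>(S u, S v)\<close> and cancels.
\<close>

lemma drift_identity:
  defines "\<beta> \<equiv> 2 * \<alpha> - lam"
  shows "2 * (S u \<bullet> S v) + 2 * ((R v + lam *\<^sub>R R u) \<bullet> (- K u + (R f - \<beta> *\<^sub>R R v)))
    = - 2 * lam * (norm (S u))\<^sup>2 - 2 * \<beta> * (norm (R v + lam *\<^sub>R R u))\<^sup>2
      + 2 * \<beta> * lam * ((R v + lam *\<^sub>R R u) \<bullet> R u) + 2 * ((R v + lam *\<^sub>R R u) \<bullet> R f)"
proof -
  define w where "w = R v + lam *\<^sub>R R u"
  have e1: "w \<bullet> K u = S u \<bullet> S v + lam * (norm (S u))\<^sup>2"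
    by (subst inner_commute) (simp add: w_def inner_add_right S_inner[symmetric] power2_norm_eq_inner)
  have e2: "w \<bullet> R v = (norm w)\<^sup>2 - lam * (w \<bullet> R u)"
  proof -
    have "R v = w - lam *\<^sub>R R u" by (simp add: w_def)
    then have "w \<bullet> R v = w \<bullet> (w - lam *\<^sub>R R u)" by simp
    then show ?thesis by (simp add: inner_diff_right power2_norm_eq_inner)
  qed
  show ?thesis
    unfolding w_def[symmetric] inner_add_right inner_diff_right inner_minus_right inner_scaleR_right e1 e2
    by (simp add: algebra_simps)
qed

text \<open>
  The spectral gap enters through
  \<open>4 \<alpha> lam \<parallel>w\<parallel> \<parallel>R u\<parallel> \<le> \<alpha> (\<parallel>w\<parallel>\<^sup>2 + 4 lam\<^sup>2 \<parallel>R u\<parallel>\<^sup>2) \<le> \<alpha> \<parallel>w\<parallel>\<^sup>2 + lam \<parallel>S u\<parallel>\<^sup>2\<close>. After the force is absorbed with weight \<open>c\<close>,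
  the coefficient of \<open>\<parallel>w\<parallel>\<^sup>2\<close> is \<open>\<alpha> + c - 2 (2 \<alpha> - lam)\<close>, at most \<open>- c\<close> because \<open>2 c = lam \<le> \<alpha> / 2\<close>.
\<close>

lemma drift_le:
  defines "\<beta> \<equiv> 2 * \<alpha> - lam" and "c \<equiv> lam / 2"
  shows "2 * (S u \<bullet> S v) + 2 * ((R v + lam *\<^sub>R R u) \<bullet> (- K u + (R f - \<beta> *\<^sub>R R v)))
    \<le> - c * ((norm (S u))\<^sup>2 + (norm (R v + lam *\<^sub>R R u))\<^sup>2) + 2 / c * (norm f)\<^sup>2"
proof -
  define w where "w = R v + lam *\<^sub>R R u"
  have \<beta>: "0 \<le> \<beta>" "\<beta> \<le> 2 * \<alpha>" and c: "0 < c" "2 * c = lam" using alpha_pos lam_pos lam_le by (auto simp: \<beta>_def c_def)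
  have cross: "2 * \<beta> * lam * (w \<bullet> R u) \<le> \<alpha> * (norm w)\<^sup>2 + lam * (norm (S u))\<^sup>2"
  proof -
    have "2 * \<beta> * lam * (w \<bullet> R u) \<le> 2 * \<beta> * lam * (norm w * norm (R u))"
      using \<beta> lam_pos by (intro mult_left_mono norm_cauchy_schwarz) auto
    also have "\<dots> \<le> 2 * (2 * \<alpha>) * lam * (norm w * norm (R u))"
      using \<beta> lam_pos by (intro mult_right_mono mult_left_mono) auto
    also have "\<dots> = \<alpha> * (2 * (norm w * (2 * lam * norm (R u))))" by simp
    also have "\<dots> \<le> \<alpha> * ((norm w)\<^sup>2 + (2 * lam * norm (R u))\<^sup>2)"
      using alpha_pos by (intro mult_left_mono two_mult_le) auto
    also have "\<dots> = \<alpha> * (norm w)\<^sup>2 + lam * (4 * \<alpha> * lam * (norm (R u))\<^sup>2)"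
      by (simp add: power2_eq_square algebra_simps)
    also have "\<dots> \<le> \<alpha> * (norm w)\<^sup>2 + lam * (norm (S u))\<^sup>2"
      using lam_pos lam_R_le_S by (intro add_left_mono mult_left_mono) auto
    finally show ?thesis .
  qed
  have force: "2 * (w \<bullet> R f) \<le> c * (norm w)\<^sup>2 + 2 / c * (norm f)\<^sup>2"
  proof -
    have "2 * (w \<bullet> R f) \<le> 2 * (norm w * norm f)"
      using norm_cauchy_schwarz[of w "R f"] mult_left_mono[OF norm_R_le[of f] norm_ge_zero, of w] by linarith
    moreover have "c * (2 * (norm w * norm f)) \<le> (c * norm w)\<^sup>2 + (norm f)\<^sup>2"
      using two_mult_le[of "c * norm w" "norm f"] by simp
    then have "2 * (norm w * norm f) \<le> c * (norm w)\<^sup>2 + 1 / c * (norm f)\<^sup>2"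
      using c by (simp add: field_simps power2_eq_square)
    moreover have "1 / c * (norm f)\<^sup>2 \<le> 2 / c * (norm f)\<^sup>2"
      using c by (intro mult_right_mono divide_right_mono) auto
    ultimately show ?thesis by linarith
  qed
  have "\<alpha> * (norm w)\<^sup>2 + c * (norm w)\<^sup>2 - 2 * \<beta> * (norm w)\<^sup>2 + c * (norm w)\<^sup>2 = (\<alpha> + 2 * c - 2 * \<beta>) * (norm w)\<^sup>2"
    by (simp add: algebra_simps)
  also have "\<dots> \<le> 0"
    using c lam_le alpha_pos by (intro mult_nonpos_nonneg) (auto simp: \<beta>_def)
  finally have w0: "\<alpha> * (norm w)\<^sup>2 + c * (norm w)\<^sup>2 - 2 * \<beta> * (norm w)\<^sup>2 + c * (norm w)\<^sup>2 \<le> 0" .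
  have u0: "- 2 * lam * (norm (S u))\<^sup>2 + lam * (norm (S u))\<^sup>2 \<le> - c * (norm (S u))\<^sup>2"
  proof -
    have "- lam * (norm (S u))\<^sup>2 \<le> - c * (norm (S u))\<^sup>2" using c by (intro mult_right_mono) auto
    then show ?thesis by simp
  qed
  show ?thesis
    unfolding \<beta>_def drift_identity unfolding \<beta>_def[symmetric] w_def[symmetric]
    using cross force w0 u0 by (simp add: algebra_simps)
qed

text \<open>
  Only the quantities \<open>S u\<close>, \<open>z = R v + lam R u - R m\<close> (where \<open>m\<close> is the value of the noise) and \<open>m\<close> are
  controlled a priori. This lemma and the following ones bound everything that occurs in the energy
  balance by their squares and that of the force \<open>f\<close>.
\<close>

lemma velocity_le:
  "norm (R v) \<le> norm (R v + lam *\<^sub>R R u - R m) + norm (S u) + norm m"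
proof -
  have "(lam * norm (R u))\<^sup>2 \<le> (norm (S u))\<^sup>2"
  proof -
    have "lam * lam * (norm (R u))\<^sup>2 \<le> 4 * \<alpha> * lam * (norm (R u))\<^sup>2"
      using lam_le lam_pos alpha_pos by (intro mult_right_mono) auto
    then show ?thesis using lam_R_le_S[of u] by (simp add: power_mult_distrib) (simp add: power2_eq_square)
  qed
  then have "lam * norm (R u) \<le> norm (S u)" by (rule power2_le_imp_le) simp
  moreover have "norm (R v) \<le> norm (R v + lam *\<^sub>R R u - R m) + norm (R m - lam *\<^sub>R R u)"
    using norm_triangle_ineq[of "R v + lam *\<^sub>R R u - R m" "R m - lam *\<^sub>R R u"] by simp
  moreover have "norm (R m - lam *\<^sub>R R u) \<le> norm (R m) + lam * norm (R u)"
    using norm_triangle_ineq4[of "R m" "lam *\<^sub>R R u"] lam_pos by simp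
  ultimately show ?thesis using norm_R_le[of m] by linarith
qed

lemma forcing_le:
  defines "\<beta> \<equiv> 2 * \<alpha> - lam"
  shows "(norm (R f - \<beta> *\<^sub>R R v))\<^sup>2 \<le> (4 + 4 * \<beta>\<^sup>2) *
    ((norm (S u))\<^sup>2 + (norm (R v + lam *\<^sub>R R u - R m))\<^sup>2 + (norm m)\<^sup>2 + (norm f)\<^sup>2)"
proof -
  define a b where "a = norm (S u)" and "b = norm (R v + lam *\<^sub>R R u - R m)"
  have \<beta>: "0 \<le> \<beta>" using alpha_pos lam_le by (simp add: \<beta>_def)
  have "norm (R f - \<beta> *\<^sub>R R v) \<le> norm (R f) + \<beta> * norm (R v)"
    using norm_triangle_ineq4[of "R f" "\<beta> *\<^sub>R R v"] \<beta> by simp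
  also have "\<dots> \<le> norm f + \<beta> * (b + a + norm m)"
    using norm_R_le velocity_le[of v u m] \<beta> unfolding a_def b_def by (intro add_mono mult_left_mono) auto
  finally have "(norm (R f - \<beta> *\<^sub>R R v))\<^sup>2 \<le> (norm f + \<beta> * (b + a + norm m))\<^sup>2" by (intro power_mono) auto
  also have "\<dots> \<le> 4 * ((norm f)\<^sup>2 + \<beta>\<^sup>2 * (b\<^sup>2 + a\<^sup>2 + (norm m)\<^sup>2))"
  proof -
    have "(x + (y1 + y2 + y3))\<^sup>2 \<le> 4 * (x\<^sup>2 + (y1\<^sup>2 + y2\<^sup>2 + y3\<^sup>2))" for x y1 y2 y3 :: real
      using two_mult_le[of x y1] two_mult_le[of x y2] two_mult_le[of x y3] two_mult_le[of y1 y2]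
        two_mult_le[of y1 y3] two_mult_le[of y2 y3]
      by (simp add: power2_eq_square algebra_simps)
    from this[of "norm f" "\<beta> * b" "\<beta> * a" "\<beta> * norm m"] show ?thesis
      by (simp add: power_mult_distrib distrib_left)
  qed
  also have "\<dots> \<le> (4 + 4 * \<beta>\<^sup>2) * (a\<^sup>2 + b\<^sup>2 + (norm m)\<^sup>2 + (norm f)\<^sup>2)"
    by (simp add: algebra_simps)
  finally show ?thesis unfolding a_def b_def .
qed

text \<open>
  The term \<open>K u\<close> has no bound by the quantities on the right, but \<open>(K u, R m') = (S u, S m')\<close> has.
\<close>

lemma force_noise_bound:
  defines "\<beta> \<equiv> 2 * \<alpha> - lam"
  obtains C where "0 \<le> C" "\<And>u v f m m'. \<bar>(- K u + (R f - \<beta> *\<^sub>R R v)) \<bullet> R m'\<bar> \<le>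
    C * ((norm (S u))\<^sup>2 + (norm (R v + lam *\<^sub>R R u - R m))\<^sup>2 + (norm m)\<^sup>2 + (norm f)\<^sup>2 + (norm m')\<^sup>2)"
proof -
  obtain L where L: "0 < L" "\<And>x. norm (S x) \<le> norm x * L"
    using bounded_linear.pos_bounded[OF bounded_linear_S] by blast
  define B where "B = 4 + 4 * \<beta>\<^sup>2"
  have B: "4 \<le> B" by (simp add: B_def)
  have "\<bar>(- K u + (R f - \<beta> *\<^sub>R R v)) \<bullet> R m'\<bar> \<le>
    (1 + L\<^sup>2 + B) * ((norm (S u))\<^sup>2 + (norm (R v + lam *\<^sub>R R u - R m))\<^sup>2 + (norm m)\<^sup>2 + (norm f)\<^sup>2 + (norm m')\<^sup>2)"
    (is "?l \<le> _ * ?E") for u v f m m'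
  proof -
    let ?y = "R f - \<beta> *\<^sub>R R v"
    have "(- K u + ?y) \<bullet> R m' = - (S u \<bullet> S m') + ?y \<bullet> R m'" by (simp only: inner_add_left inner_minus_left S_inner)
    then have "?l \<le> \<bar>S u \<bullet> S m'\<bar> + \<bar>?y \<bullet> R m'\<bar>" by linarith
    moreover have "\<bar>S u \<bullet> S m'\<bar> \<le> norm (S u) * (norm m' * L)"
      using Cauchy_Schwarz_ineq2[of "S u" "S m'"] mult_left_mono[OF L(2)[of m'], of "norm (S u)"] by simp
    moreover have "\<bar>?y \<bullet> R m'\<bar> \<le> norm ?y * norm m'"
      using Cauchy_Schwarz_ineq2[of ?y "R m'"] mult_left_mono[OF norm_R_le[of m'], of "norm ?y"] by simp
    moreover have "2 * (norm (S u) * (norm m' * L)) \<le> (norm (S u))\<^sup>2 + (norm m')\<^sup>2 * L\<^sup>2"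
      using two_mult_le[of "norm (S u)" "norm m' * L"] by (simp add: power_mult_distrib)
    moreover have "2 * (norm ?y * norm m') \<le> (norm ?y)\<^sup>2 + (norm m')\<^sup>2" by (rule two_mult_le)
    moreover have "(norm ?y)\<^sup>2 \<le> B * ?E"
    proof -
      have "(norm ?y)\<^sup>2 \<le> B * ((norm (S u))\<^sup>2 + (norm (R v + lam *\<^sub>R R u - R m))\<^sup>2 + (norm m)\<^sup>2 + (norm f)\<^sup>2)"
        unfolding B_def \<beta>_def by (rule forcing_le)
      also have "\<dots> \<le> B * ?E" using B by (intro mult_left_mono) auto
      finally show ?thesis .
    qed
    moreover have "(norm (S u))\<^sup>2 + (norm m')\<^sup>2 \<le> ?E" by simp
    moreover have "(norm m')\<^sup>2 * L\<^sup>2 \<le> L\<^sup>2 * ?E" by (subst mult.commute) (intro mult_left_mono, auto)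
    ultimately have "?l \<le> B * ?E + L\<^sup>2 * ?E + ?E" by (smt (verit) abs_ge_zero zero_le_power2)
    then show ?thesis by (simp add: algebra_simps)
  qed
  then show thesis using L B by (intro that[of "1 + L\<^sup>2 + B"]) auto
qed

text \<open>
  The terms \<open>(S u, S v)\<close>, for which there is no a priori bound, cancel up to \<open>(S m, S u)\<close>, and \<open>S\<close> is bounded.
  The constant depends on \<open>\<epsilon>\<close> through \<open>\<parallel>S\<parallel>\<close>.
\<close>

lemma energy_rate_bound:
  defines "\<beta> \<equiv> 2 * \<alpha> - lam"
  obtains C where "0 \<le> C" "\<And>u v f m.
    \<bar>2 * (S u \<bullet> S v) + 2 * ((R v + lam *\<^sub>R R u - R m) \<bullet> (- K u + (R f - \<beta> *\<^sub>R R v)))\<bar>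
      \<le> C * ((norm (S u))\<^sup>2 + (norm (R v + lam *\<^sub>R R u - R m))\<^sup>2 + (norm m)\<^sup>2 + (norm f)\<^sup>2)"
proof -
  obtain L where L: "0 < L" "\<And>x. norm (S x) \<le> norm x * L"
    using bounded_linear.pos_bounded[OF bounded_linear_S] by blast
  define B where "B = 4 + 4 * \<beta>\<^sup>2"
  have B: "4 \<le> B" by (simp add: B_def)
  have "\<bar>2 * (S u \<bullet> S v) + 2 * ((R v + lam *\<^sub>R R u - R m) \<bullet> (- K u + (R f - \<beta> *\<^sub>R R v)))\<bar>
      \<le> (2 * lam + 1 + L\<^sup>2 + B) * ((norm (S u))\<^sup>2 + (norm (R v + lam *\<^sub>R R u - R m))\<^sup>2 + (norm m)\<^sup>2 + (norm f)\<^sup>2)"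
    (is "?l \<le> _ * ?E") for u v f m
  proof -
    define z where "z = R v + lam *\<^sub>R R u - R m"
    define y where "y = R f - \<beta> *\<^sub>R R v"
    have "z \<bullet> K u = S u \<bullet> S v + lam * (norm (S u))\<^sup>2 - S m \<bullet> S u"
      by (subst inner_commute)
        (simp add: z_def inner_add_right inner_diff_right S_inner[symmetric] power2_norm_eq_inner inner_commute[of "S m"])
    then have "2 * (S u \<bullet> S v) + 2 * (z \<bullet> (- K u + y)) = - 2 * lam * (norm (S u))\<^sup>2 + 2 * (S m \<bullet> S u) + 2 * (z \<bullet> y)"
      by (simp only: inner_add_right inner_minus_right) (simp add: algebra_simps)
    then have "?l = \<bar>- 2 * lam * (norm (S u))\<^sup>2 + 2 * (S m \<bullet> S u) + 2 * (z \<bullet> y)\<bar>"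
      by (simp only: z_def y_def)
    moreover have "0 \<le> lam * (norm (S u))\<^sup>2" using lam_pos by simp
    ultimately have "?l \<le> 2 * lam * (norm (S u))\<^sup>2 + 2 * \<bar>S m \<bullet> S u\<bar> + 2 * \<bar>z \<bullet> y\<bar>"
      by linarith
    moreover have "2 * \<bar>S m \<bullet> S u\<bar> \<le> (norm m)\<^sup>2 * L\<^sup>2 + (norm (S u))\<^sup>2"
    proof -
      have "\<bar>S m \<bullet> S u\<bar> \<le> (norm m * L) * norm (S u)"
        using Cauchy_Schwarz_ineq2[of "S m" "S u"] mult_right_mono[OF L(2)[of m], of "norm (S u)"] by simp
      then show ?thesis using two_mult_le[of "norm m * L" "norm (S u)"] by (simp add: power_mult_distrib)
    qed
    moreover have "2 * \<bar>z \<bullet> y\<bar> \<le> (norm z)\<^sup>2 + (norm y)\<^sup>2"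
      using Cauchy_Schwarz_ineq2[of z y] two_mult_le[of "norm z" "norm y"] by linarith
    moreover have "(norm y)\<^sup>2 \<le> B * ?E" unfolding y_def B_def \<beta>_def by (rule forcing_le)
    moreover have "(norm (S u))\<^sup>2 + (norm z)\<^sup>2 \<le> ?E" by (simp add: z_def)
    moreover have "(norm m)\<^sup>2 * L\<^sup>2 \<le> L\<^sup>2 * ?E" by (subst mult.commute) (intro mult_left_mono, auto)
    moreover have "2 * lam * (norm (S u))\<^sup>2 \<le> 2 * lam * ?E" using lam_pos by (intro mult_left_mono) auto
    ultimately have "?l \<le> 2 * lam * ?E + L\<^sup>2 * ?E + ?E + B * ?E" by linarith
    then show ?thesis by (simp add: algebra_simps)
  qed
  then show thesis using L B lam_pos by (intro that[of "2 * lam + 1 + L\<^sup>2 + B"]) auto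
qed

end

section \<open>Finiteness of the regularized mean energy\<close>

lemma (in prob_space) slice_measurable:
  assumes "(\<lambda>x. g (fst x) (snd x)) \<in> borel_measurable ((borel :: real measure) \<Otimes>\<^sub>M M)"
  shows "g t \<in> borel_measurable M"
proof -
  have "Pair t \<in> measurable M (borel \<Otimes>\<^sub>M M)" by (rule measurable_Pair1') simp
  from measurable_compose[OF this assms] show ?thesis by simp
qed

lemma (in prob_space) time_integral_measurable:
  assumes g: "(\<lambda>x. g (fst x) (snd x)) \<in> borel_measurable ((borel :: real measure) \<Otimes>\<^sub>M M)"
  shows "(\<lambda>\<omega>. \<integral>\<^sup>+s\<in>{0..t}. g s \<omega> \<partial>lborel) \<in> borel_measurable M"
proof -
  have [measurable]: "(\<lambda>x. g (snd x) (fst x)) \<in> borel_measurable (M \<Otimes>\<^sub>M (borel :: real measure))"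
    using measurable_compose[OF measurable_pair_swap' g] by (simp add: split_beta)
  have [measurable]: "(\<lambda>x. indicator {0..t} (snd x) :: ennreal) \<in> borel_measurable (M \<Otimes>\<^sub>M (borel :: real measure))"
    by (rule measurable_compose[OF measurable_snd]) measurable
  show ?thesis
    by (rule sigma_finite_measure.borel_measurable_nn_integral[OF sigma_finite_lborel]) (unfold split_beta, measurable)
qed

lemma (in prob_space) time_swap:
  assumes [measurable]: "(\<lambda>x. g (fst x) (snd x)) \<in> borel_measurable ((borel :: real measure) \<Otimes>\<^sub>M M)"
  shows "(\<integral>\<^sup>+\<omega>. (\<integral>\<^sup>+s\<in>{0..t}. g s \<omega> \<partial>lborel) \<partial>M) = (\<integral>\<^sup>+s\<in>{0..t}. (\<integral>\<^sup>+\<omega>. g s \<omega> \<partial>M) \<partial>lborel)"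
proof -
  interpret PS: pair_sigma_finite lborel M ..
  have "(\<integral>\<^sup>+\<omega>. (\<integral>\<^sup>+s\<in>{0..t}. g s \<omega> \<partial>lborel) \<partial>M) = (\<integral>\<^sup>+s. (\<integral>\<^sup>+\<omega>. g s \<omega> * indicator {0..t} s \<partial>M) \<partial>lborel)"
    by (rule PS.Fubini') (unfold split_beta, measurable)
  also have "\<dots> = (\<integral>\<^sup>+s\<in>{0..t}. (\<integral>\<^sup>+\<omega>. g s \<omega> \<partial>M) \<partial>lborel)"
    by (intro nn_integral_cong) (auto simp: indicator_def)
  finally show ?thesis .
qed

lemma (in prob_space) fubini_time_integral:
  fixes g :: "real \<Rightarrow> 'a \<Rightarrow> real"
  assumes g[measurable]: "(\<lambda>x. g (fst x) (snd x)) \<in> borel_measurable (borel \<Otimes>\<^sub>M M)"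
    and fin: "(\<integral>\<^sup>+s\<in>{0..t}. (\<integral>\<^sup>+\<omega>. ennreal \<bar>g s \<omega>\<bar> \<partial>M) \<partial>lborel) < \<infinity>"
  shows "expectation (\<lambda>\<omega>. LINT s:{0..t}|lborel. g s \<omega>) = (LINT s:{0..t}|lborel. expectation (g s))"
    and "set_integrable lborel {0..t} (\<lambda>s. expectation (g s))"
    and "integrable M (\<lambda>\<omega>. LINT s:{0..t}|lborel. g s \<omega>)"
proof -
  interpret PS: pair_sigma_finite lborel M ..
  let ?k = "\<lambda>s \<omega>. indicator {0..t} s *\<^sub>R g s \<omega>"
  have k: "integrable (lborel \<Otimes>\<^sub>M M) (case_prod ?k)"
  proof (rule integrableI_bounded)
    show "case_prod ?k \<in> borel_measurable (lborel \<Otimes>\<^sub>M M)" unfolding split_beta by measurable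
    have "(\<integral>\<^sup>+x. ennreal (norm (case_prod ?k x)) \<partial>(lborel \<Otimes>\<^sub>M M)) = (\<integral>\<^sup>+s. (\<integral>\<^sup>+\<omega>. ennreal (norm (?k s \<omega>)) \<partial>M) \<partial>lborel)"
      by (subst nn_integral_fst[symmetric]) (auto simp: split_beta)
    also have "\<dots> = (\<integral>\<^sup>+s\<in>{0..t}. (\<integral>\<^sup>+\<omega>. ennreal \<bar>g s \<omega>\<bar> \<partial>M) \<partial>lborel)"
      by (intro nn_integral_cong) (auto simp: indicator_def)
    finally show "(\<integral>\<^sup>+x. ennreal (norm (case_prod ?k x)) \<partial>(lborel \<Otimes>\<^sub>M M)) < \<infinity>" using fin by simp
  qed
  show "expectation (\<lambda>\<omega>. LINT s:{0..t}|lborel. g s \<omega>) = (LINT s:{0..t}|lborel. expectation (g s))"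
    using PS.Fubini_integral[OF k] by (simp add: set_lebesgue_integral_def)
  show "set_integrable lborel {0..t} (\<lambda>s. expectation (g s))"
    using PS.integrable_fst[OF k] by (simp add: set_integrable_def)
  show "integrable M (\<lambda>\<omega>. LINT s:{0..t}|lborel. g s \<omega>)"
    using PS.integrable_snd[OF k] by (simp add: set_lebesgue_integral_def)
qed

lemma has_vector_derivative_norm_square:
  fixes X :: "real \<Rightarrow> 'b::real_inner"
  assumes "(X has_vector_derivative X') (at t within A)"
  shows "((\<lambda>t. (norm (X t))\<^sup>2) has_vector_derivative 2 * (X t \<bullet> X')) (at t within A)"
proof -
  have "((\<lambda>t. X t \<bullet> X t) has_derivative (\<lambda>h. X t \<bullet> (h *\<^sub>R X') + (h *\<^sub>R X') \<bullet> X t)) (at t within A)"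
    using assms unfolding has_vector_derivative_def by (intro has_derivative_inner)
  then show ?thesis
    unfolding has_vector_derivative_def power2_norm_eq_inner by (simp add: inner_commute algebra_simps)
qed

text \<open>
  The processes \<open>u\<close>, \<open>v\<close>, \<open>f\<close>, \<open>M\<close> stand for modifications with continuous paths; this is why they are
  adapted only up to null sets, and why the original martingale \<open>M'\<close> is kept. In the application, \<open>q\<close> is the
  mean of the trace of the covariation operator.
\<close>

locale regularized_stochastic_wave = regularized_wave R S K \<alpha> lam \<eta> + filtered P F
  for R S K :: "'h::{real_inner, banach, second_countable_topology} \<Rightarrow> 'h" and \<alpha> lam \<eta> :: real
    and P :: "'w measure" and F :: "real \<Rightarrow> 'w measure" +
  fixes u v f M M' :: "real \<Rightarrow> 'w \<Rightarrow> 'h" and u0 v0 :: 'h and q :: "real \<Rightarrow> ennreal"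
  assumes paths: "continuous_on UNIV (\<lambda>t. u t \<omega>)" "continuous_on UNIV (\<lambda>t. v t \<omega>)"
      "continuous_on UNIV (\<lambda>t. f t \<omega>)" "continuous_on UNIV (\<lambda>t. M t \<omega>)"
    and joint: "(\<lambda>(t, \<omega>). u t \<omega>) \<in> borel_measurable (borel \<Otimes>\<^sub>M P)"
      "(\<lambda>(t, \<omega>). v t \<omega>) \<in> borel_measurable (borel \<Otimes>\<^sub>M P)"
      "(\<lambda>(t, \<omega>). f t \<omega>) \<in> borel_measurable (borel \<Otimes>\<^sub>M P)"
      "(\<lambda>(t, \<omega>). M t \<omega>) \<in> borel_measurable (borel \<Otimes>\<^sub>M P)"
    and adapted_ae: "0 \<le> t \<Longrightarrow> \<exists>Y\<in>borel_measurable (F t). AE \<omega> in P. u t \<omega> = Y \<omega>"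
      "0 \<le> t \<Longrightarrow> \<exists>Y\<in>borel_measurable (F t). AE \<omega> in P. v t \<omega> = Y \<omega>"
      "0 \<le> t \<Longrightarrow> \<exists>Y\<in>borel_measurable (F t). AE \<omega> in P. f t \<omega> = Y \<omega>"
    and mart: "martingale P F M'" "AE \<omega> in P. \<forall>t\<ge>0. M t \<omega> = M' t \<omega>" "AE \<omega> in P. M 0 \<omega> = 0"
    and init: "AE \<omega> in P. u 0 \<omega> = u0" "AE \<omega> in P. v 0 \<omega> = v0"
    and deriv_u: "AE \<omega> in P. \<forall>t\<ge>0. ((\<lambda>s. u s \<omega>) has_vector_derivative v t \<omega>) (at t within {0..})"
    and deriv_v: "AE \<omega> in P. \<forall>t\<ge>0. ((\<lambda>s. R (v s \<omega>) - R (M s \<omega>)) has_vector_derivative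
      - K (u t \<omega>) - (2 * \<alpha>) *\<^sub>R R (v t \<omega>) + R (f t \<omega>)) (at t within {0..})"
    and q: "q \<in> borel_measurable borel"
      "0 \<le> t \<Longrightarrow> (\<integral>\<^sup>+\<omega>. ennreal ((norm (M t \<omega>))\<^sup>2) \<partial>P) = (\<integral>\<^sup>+s\<in>{0..t}. q s \<partial>lborel)"
      "0 \<le> t \<Longrightarrow> (\<integral>\<^sup>+s\<in>{0..t}. q s \<partial>lborel) < \<infinity>"
    and f_square: "0 \<le> t \<Longrightarrow> (\<integral>\<^sup>+\<omega>. (\<integral>\<^sup>+s\<in>{0..t}. ennreal ((norm (f s \<omega>))\<^sup>2) \<partial>lborel) \<partial>P) < \<infinity>"
begin

lemma joint_measurable [measurable]:
  "(\<lambda>x. u (fst x) (snd x)) \<in> borel_measurable (borel \<Otimes>\<^sub>M P)"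
  "(\<lambda>x. v (fst x) (snd x)) \<in> borel_measurable (borel \<Otimes>\<^sub>M P)"
  "(\<lambda>x. f (fst x) (snd x)) \<in> borel_measurable (borel \<Otimes>\<^sub>M P)"
  "(\<lambda>x. M (fst x) (snd x)) \<in> borel_measurable (borel \<Otimes>\<^sub>M P)"
  using joint by (simp_all add: split_beta)

lemmas slices [measurable] = joint_measurable[THEN slice_measurable]

lemmas RSK_measurable [measurable] =
  bounded_linear_R[THEN bounded_linear_borel_measurable] bounded_linear_S[THEN bounded_linear_borel_measurable]
  bounded_linear_K[THEN bounded_linear_borel_measurable]

definition noise :: "real \<Rightarrow> 'w \<Rightarrow> 'h" where "noise t \<omega> = R (M t \<omega>)"
definition shifted_velocity :: "real \<Rightarrow> 'w \<Rightarrow> 'h" where "shifted_velocity t \<omega> = R (v t \<omega>) + lam *\<^sub>R R (u t \<omega>)"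
definition smooth_velocity :: "real \<Rightarrow> 'w \<Rightarrow> 'h" where "smooth_velocity t \<omega> = shifted_velocity t \<omega> - noise t \<omega>"
definition lower_force :: "real \<Rightarrow> 'w \<Rightarrow> 'h" where
  "lower_force t \<omega> = R (f t \<omega>) - (2 * \<alpha> - lam) *\<^sub>R R (v t \<omega>)"
definition force :: "real \<Rightarrow> 'w \<Rightarrow> 'h" where "force t \<omega> = - K (u t \<omega>) + lower_force t \<omega>"
definition smooth_energy :: "real \<Rightarrow> 'w \<Rightarrow> real" where
  "smooth_energy t \<omega> = (norm (S (u t \<omega>)))\<^sup>2 + (norm (smooth_velocity t \<omega>))\<^sup>2"
definition energy_rate :: "real \<Rightarrow> 'w \<Rightarrow> real" where
  "energy_rate t \<omega> = 2 * (S (u t \<omega>) \<bullet> S (v t \<omega>)) + 2 * (smooth_velocity t \<omega> \<bullet> force t \<omega>)"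
text \<open>
  This is the pseudo energy of \<open>(R u; R v)\<close>; the smooth energy above is its variant without the noise,
  which is differentiable along each path.
\<close>

definition energy :: "real \<Rightarrow> 'w \<Rightarrow> real" where
  "energy t \<omega> = (norm (S (u t \<omega>)))\<^sup>2 + (norm (shifted_velocity t \<omega>))\<^sup>2"
text \<open>
  It dominates, up to constants, all integrands in the energy balance.
\<close>

definition majorant :: "real \<Rightarrow> 'w \<Rightarrow> real" where
  "majorant t \<omega> = smooth_energy t \<omega> + ((norm (M t \<omega>))\<^sup>2 + (norm (f t \<omega>))\<^sup>2)"

lemmas process_defs = noise_def shifted_velocity_def smooth_velocity_def lower_force_def force_def
  smooth_energy_def energy_rate_def energy_def majorant_def

lemma process_measurable [measurable]:
  "(\<lambda>x. noise (fst x) (snd x)) \<in> borel_measurable (borel \<Otimes>\<^sub>M P)"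
  "(\<lambda>x. shifted_velocity (fst x) (snd x)) \<in> borel_measurable (borel \<Otimes>\<^sub>M P)"
  "(\<lambda>x. smooth_velocity (fst x) (snd x)) \<in> borel_measurable (borel \<Otimes>\<^sub>M P)"
  "(\<lambda>x. lower_force (fst x) (snd x)) \<in> borel_measurable (borel \<Otimes>\<^sub>M P)"
  "(\<lambda>x. force (fst x) (snd x)) \<in> borel_measurable (borel \<Otimes>\<^sub>M P)"
  "(\<lambda>x. smooth_energy (fst x) (snd x)) \<in> borel_measurable (borel \<Otimes>\<^sub>M P)"
  "(\<lambda>x. energy_rate (fst x) (snd x)) \<in> borel_measurable (borel \<Otimes>\<^sub>M P)"
  "(\<lambda>x. energy (fst x) (snd x)) \<in> borel_measurable (borel \<Otimes>\<^sub>M P)"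
  "(\<lambda>x. majorant (fst x) (snd x)) \<in> borel_measurable (borel \<Otimes>\<^sub>M P)"
  unfolding process_defs by measurable

lemmas process_slices [measurable] = process_measurable[THEN slice_measurable]

lemma continuous_bounded_linear:
  assumes "bounded_linear (T :: 'h \<Rightarrow> 'h)"
  shows "continuous_on UNIV (\<lambda>t. T (u t \<omega>))" "continuous_on UNIV (\<lambda>t. T (v t \<omega>))"
    "continuous_on UNIV (\<lambda>t. T (f t \<omega>))" "continuous_on UNIV (\<lambda>t. T (M t \<omega>))"
  using paths by (auto intro: bounded_linear.continuous_on[OF assms])

lemma process_continuous:
  "continuous_on UNIV (\<lambda>t. force t \<omega>)"
  "continuous_on UNIV (\<lambda>t. energy_rate t \<omega>)" "continuous_on UNIV (\<lambda>t. smooth_energy t \<omega>)"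
  unfolding process_defs
  by (intro continuous_intros continuous_bounded_linear bounded_linear_R bounded_linear_S bounded_linear_K)+

lemma smooth_energy_nonneg: "0 \<le> smooth_energy t \<omega>"
  and majorant_ge: "smooth_energy t \<omega> \<le> majorant t \<omega>" "(norm (M t \<omega>))\<^sup>2 \<le> majorant t \<omega>"
    "(norm (f t \<omega>))\<^sup>2 \<le> majorant t \<omega>" "0 \<le> majorant t \<omega>"
  unfolding majorant_def smooth_energy_def by auto

lemma energy_rate_le:
  obtains C where "0 \<le> C" "\<And>t \<omega>. \<bar>energy_rate t \<omega>\<bar> \<le> C * majorant t \<omega>"
  using energy_rate_bound unfolding process_defs by (metis (no_types, lifting) add.assoc)

lemma force_noise_le:
  obtains C where "0 \<le> C" "\<And>s t \<omega>. \<bar>force s \<omega> \<bullet> noise t \<omega>\<bar> \<le> C * (majorant s \<omega> + (norm (M t \<omega>))\<^sup>2)"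
proof -
  obtain C where "0 \<le> C" and C: "\<And>u v f m m'. \<bar>(- K u + (R f - (2 * \<alpha> - lam) *\<^sub>R R v)) \<bullet> R m'\<bar> \<le>
    C * ((norm (S u))\<^sup>2 + (norm (R v + lam *\<^sub>R R u - R m))\<^sup>2 + (norm m)\<^sup>2 + (norm f)\<^sup>2 + (norm m')\<^sup>2)"
    by (rule force_noise_bound) blast
  have "\<bar>force s \<omega> \<bullet> noise t \<omega>\<bar> \<le> C * (majorant s \<omega> + (norm (M t \<omega>))\<^sup>2)" for s t \<omega>
    using C[of "u s \<omega>" "f s \<omega>" "v s \<omega>" "M t \<omega>" "M s \<omega>"] unfolding process_defs by (simp add: add.assoc)
  then show thesis using \<open>0 \<le> C\<close> that by blast
qed

lemma smooth_velocity_derivative: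
  "AE \<omega> in P. \<forall>t\<ge>0. ((\<lambda>s. smooth_velocity s \<omega>) has_vector_derivative force t \<omega>) (at t within {0..})"
  using deriv_u deriv_v
proof eventually_elim
  case (elim \<omega>)
  show ?case
  proof (intro allI impI)
    fix t :: real assume t: "0 \<le> t"
    have "((\<lambda>s. (R (v s \<omega>) - R (M s \<omega>)) + lam *\<^sub>R R (u s \<omega>)) has_vector_derivative
        (- K (u t \<omega>) - (2 * \<alpha>) *\<^sub>R R (v t \<omega>) + R (f t \<omega>)) + lam *\<^sub>R R (v t \<omega>)) (at t within {0..})"
      using elim t by (intro has_vector_derivative_add
          bounded_linear.has_vector_derivative[OF bounded_linear_scaleR_right]
          bounded_linear.has_vector_derivative[OF bounded_linear_R]) auto
    moreover have "(- K (u t \<omega>) - (2 * \<alpha>) *\<^sub>R R (v t \<omega>) + R (f t \<omega>)) + lam *\<^sub>R R (v t \<omega>) = force t \<omega>"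
      by (simp add: process_defs scaleR_left_diff_distrib)
    moreover have "(\<lambda>s. (R (v s \<omega>) - R (M s \<omega>)) + lam *\<^sub>R R (u s \<omega>)) = (\<lambda>s. smooth_velocity s \<omega>)"
      by (simp add: process_defs algebra_simps)
    ultimately show "((\<lambda>s. smooth_velocity s \<omega>) has_vector_derivative force t \<omega>) (at t within {0..})" by simp
  qed
qed

lemma smooth_energy_derivative:
  "AE \<omega> in P. \<forall>t\<ge>0. ((\<lambda>s. smooth_energy s \<omega>) has_vector_derivative energy_rate t \<omega>) (at t within {0..})"
  using deriv_u smooth_velocity_derivative
proof eventually_elim
  case (elim \<omega>)
  then show ?case
    unfolding smooth_energy_def energy_rate_def
    by (intro allI impI has_vector_derivative_add has_vector_derivative_norm_square
        bounded_linear.has_vector_derivative[OF bounded_linear_S]) auto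
qed

lemma smooth_energy_eq:
  "AE \<omega> in P. \<forall>t\<ge>0. smooth_energy t \<omega> = smooth_energy 0 \<omega> + (LINT s:{0..t}|lborel. energy_rate s \<omega>)"
  using smooth_energy_derivative
proof eventually_elim
  case (elim \<omega>)
  show ?case
  proof (intro allI impI)
    fix t :: real assume t: "0 \<le> t"
    have "(LINT s:{0..t}|lborel. energy_rate s \<omega>) = smooth_energy t \<omega> - smooth_energy 0 \<omega>"
    proof (rule set_integral_FTC(2)[OF t])
      show "((\<lambda>s. smooth_energy s \<omega>) has_vector_derivative energy_rate x \<omega>) (at x within {0..t})" if "0 \<le> x" for x
        using elim that by (auto intro: has_vector_derivative_within_subset)
    qed (rule continuous_on_subset[OF process_continuous(2)], simp)
    then show "smooth_energy t \<omega> = smooth_energy 0 \<omega> + (LINT s:{0..t}|lborel. energy_rate s \<omega>)" by simp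
  qed
qed

lemma velocity_noise_eq:
  "AE \<omega> in P. \<forall>t\<ge>0. smooth_velocity t \<omega> \<bullet> noise t \<omega>
     = smooth_velocity 0 \<omega> \<bullet> noise t \<omega> + (LINT s:{0..t}|lborel. force s \<omega> \<bullet> noise t \<omega>)"
  using smooth_velocity_derivative
proof eventually_elim
  case (elim \<omega>)
  show ?case
  proof (intro allI impI)
    fix t :: real assume t: "0 \<le> t"
    have "(LINT s:{0..t}|lborel. force s \<omega> \<bullet> noise t \<omega>)
        = smooth_velocity t \<omega> \<bullet> noise t \<omega> - smooth_velocity 0 \<omega> \<bullet> noise t \<omega>"
    proof (rule set_integral_FTC(2)[OF t])
      show "((\<lambda>s. smooth_velocity s \<omega> \<bullet> noise t \<omega>) has_vector_derivative force x \<omega> \<bullet> noise t \<omega>) (at x within {0..t})"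
        if "0 \<le> x" for x
        using elim that
        by (intro bounded_linear.has_vector_derivative[OF bounded_linear_inner_left])
          (auto intro: has_vector_derivative_within_subset)
      show "continuous_on {0..t} (\<lambda>s. force s \<omega> \<bullet> noise t \<omega>)"
        by (intro continuous_intros continuous_on_subset[OF process_continuous(1)]) simp
    qed
    then show "smooth_velocity t \<omega> \<bullet> noise t \<omega>
        = smooth_velocity 0 \<omega> \<bullet> noise t \<omega> + (LINT s:{0..t}|lborel. force s \<omega> \<bullet> noise t \<omega>)" by simp
  qed
qed

text \<open>
  The derivative of \<open>exp (- C t)\<close> times the smooth energy is at most \<open>C\<close> times the squared norms of the noise
  and the force. The estimate is stated in \<^typ>\<open>ennreal\<close>, so that it can be integrated over the
  probability space before any integrability is known.
\<close>

lemma smooth_energy_growth: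
  obtains C where "0 \<le> C" "AE \<omega> in P. \<forall>t\<ge>0. ennreal (smooth_energy t \<omega>)
    \<le> ennreal (exp (C * t)) * (ennreal (smooth_energy 0 \<omega>)
      + ennreal C * (\<integral>\<^sup>+s\<in>{0..t}. ennreal ((norm (M s \<omega>))\<^sup>2 + (norm (f s \<omega>))\<^sup>2) \<partial>lborel))"
proof -
  obtain C where C: "0 \<le> C" "\<And>t \<omega>. \<bar>energy_rate t \<omega>\<bar> \<le> C * majorant t \<omega>"
    by (rule energy_rate_le) (rule that)
  have "AE \<omega> in P. \<forall>t\<ge>0. ennreal (smooth_energy t \<omega>)
    \<le> ennreal (exp (C * t)) * (ennreal (smooth_energy 0 \<omega>)
      + ennreal C * (\<integral>\<^sup>+s\<in>{0..t}. ennreal ((norm (M s \<omega>))\<^sup>2 + (norm (f s \<omega>))\<^sup>2) \<partial>lborel))"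
    using smooth_energy_derivative
  proof eventually_elim
    case (elim \<omega>)
    show ?case
    proof (intro allI impI)
      fix t :: real assume t: "0 \<le> t"
      define k where "k s = (norm (M s \<omega>))\<^sup>2 + (norm (f s \<omega>))\<^sup>2" for s
      have kc: "continuous_on {0..t} k"
        unfolding k_def[abs_def] by (intro continuous_intros continuous_on_subset[OF paths(3)] continuous_on_subset[OF paths(4)]) auto
      have ki: "set_integrable lborel {0..t} k" by (rule borel_integrable_atLeastAtMost'[OF kc])
      define h where "h s = exp (- C * s) * (energy_rate s \<omega> - C * smooth_energy s \<omega>)" for s
      have hd: "((\<lambda>s. exp (- C * s) * smooth_energy s \<omega>) has_vector_derivative h s) (at s within {0..t})" if s: "0 \<le> s" for s
      proof -
        have "((\<lambda>s. smooth_energy s \<omega>) has_real_derivative energy_rate s \<omega>) (at s within {0..t})"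
          unfolding has_real_derivative_iff_has_vector_derivative
          using elim s by (auto intro: has_vector_derivative_within_subset)
        then have "((\<lambda>s. exp (- C * s) * smooth_energy s \<omega>) has_real_derivative h s) (at s within {0..t})"
          unfolding h_def by (auto intro!: derivative_eq_intros simp: algebra_simps)
        then show ?thesis unfolding has_real_derivative_iff_has_vector_derivative .
      qed
      have hc: "continuous_on {0..t} h"
        unfolding h_def[abs_def]
        by (intro continuous_intros continuous_on_subset[OF process_continuous(2)] continuous_on_subset[OF process_continuous(3)]) auto
      note FTC = set_integral_FTC[OF t hd hc]
      have "exp (- C * t) * smooth_energy t \<omega> - smooth_energy 0 \<omega> = (LINT s:{0..t}|lborel. h s)"
        using FTC(2) by simp
      also have "\<dots> \<le> (LINT s:{0..t}|lborel. C * k s)"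
      proof (rule set_integral_mono[OF FTC(1)])
        show "set_integrable lborel {0..t} (\<lambda>s. C * k s)" using ki by simp
        fix s assume s: "s \<in> {0..t}"
        have "energy_rate s \<omega> - C * smooth_energy s \<omega> \<le> C * k s"
          using C(2)[of s \<omega>] by (simp add: majorant_def k_def algebra_simps)
        then have "h s \<le> exp (- C * s) * (C * k s)" unfolding h_def by (rule mult_left_mono) simp
        also have "\<dots> \<le> 1 * (C * k s)" using s C(1) by (intro mult_right_mono) (auto simp: k_def)
        finally show "h s \<le> C * k s" by simp
      qed
      also have "\<dots> = C * (LINT s:{0..t}|lborel. k s)" by (rule set_integral_mult_right)
      finally have "exp (- C * t) * smooth_energy t \<omega> \<le> smooth_energy 0 \<omega> + C * (LINT s:{0..t}|lborel. k s)" by simp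
      then have "exp (C * t) * (exp (- C * t) * smooth_energy t \<omega>) \<le> exp (C * t) * (smooth_energy 0 \<omega> + C * (LINT s:{0..t}|lborel. k s))"
        by (rule mult_left_mono) simp
      then have main: "smooth_energy t \<omega> \<le> exp (C * t) * (smooth_energy 0 \<omega> + C * (LINT s:{0..t}|lborel. k s))"
        by (simp flip: mult.assoc exp_add)
      have kn: "(\<integral>\<^sup>+s\<in>{0..t}. ennreal (k s) \<partial>lborel) = ennreal (LINT s:{0..t}|lborel. k s)"
      proof -
        have "(\<integral>\<^sup>+s\<in>{0..t}. ennreal (k s) \<partial>lborel) = (\<integral>\<^sup>+s. ennreal (indicator {0..t} s *\<^sub>R k s) \<partial>lborel)"
          by (intro nn_integral_cong) (auto simp: indicator_def)
        also have "\<dots> = ennreal (LINT s:{0..t}|lborel. k s)"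
          using ki unfolding set_lebesgue_integral_def set_integrable_def
          by (intro nn_integral_eq_integral) (auto simp: k_def)
        finally show ?thesis .
      qed
      have k0: "0 \<le> (LINT s:{0..t}|lborel. k s)"
        unfolding set_lebesgue_integral_def by (rule integral_nonneg_AE) (auto simp: k_def)
      show "ennreal (smooth_energy t \<omega>) \<le> ennreal (exp (C * t)) * (ennreal (smooth_energy 0 \<omega>)
          + ennreal C * (\<integral>\<^sup>+s\<in>{0..t}. ennreal ((norm (M s \<omega>))\<^sup>2 + (norm (f s \<omega>))\<^sup>2) \<partial>lborel))"
        using ennreal_leI[OF main] k0 C(1) smooth_energy_nonneg[of 0 \<omega>]
        by (simp add: kn[unfolded k_def] k_def[symmetric] kn ennreal_mult ennreal_plus)
    qed
  qed
  with C(1) show thesis by (rule that)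
qed

lemma M_square_finite: "0 \<le> t \<Longrightarrow> (\<integral>\<^sup>+\<omega>. ennreal ((norm (M t \<omega>))\<^sup>2) \<partial>P) < \<infinity>"
  using q(2,3)[of t] by simp

lemma M_square_integrable: "0 \<le> t \<Longrightarrow> integrable P (\<lambda>\<omega>. (norm (M t \<omega>))\<^sup>2)"
  using M_square_finite by (intro integrableI_nonneg) auto

definition input_size :: "real \<Rightarrow> ennreal" where
  "input_size t = (\<integral>\<^sup>+\<omega>. (\<integral>\<^sup>+s\<in>{0..t}. ennreal ((norm (M s \<omega>))\<^sup>2 + (norm (f s \<omega>))\<^sup>2) \<partial>lborel) \<partial>P)"

lemma input_size_mono: "s \<le> t \<Longrightarrow> input_size s \<le> input_size t"
  unfolding input_size_def by (intro nn_integral_mono mult_left_mono) (auto simp: indicator_def)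

lemma input_size_finite:
  assumes t: "0 \<le> t"
  shows "input_size t < \<infinity>"
proof -
  have "input_size t = (\<integral>\<^sup>+\<omega>. (\<integral>\<^sup>+s\<in>{0..t}. ennreal ((norm (M s \<omega>))\<^sup>2) \<partial>lborel)
      + (\<integral>\<^sup>+s\<in>{0..t}. ennreal ((norm (f s \<omega>))\<^sup>2) \<partial>lborel) \<partial>P)"
    unfolding input_size_def
  proof (rule nn_integral_cong)
    fix \<omega> assume "\<omega> \<in> space P"
    have [measurable]: "(\<lambda>s. M s \<omega>) \<in> borel_measurable borel" "(\<lambda>s. f s \<omega>) \<in> borel_measurable borel"
      by (rule borel_measurable_continuous_onI, rule paths)+
    show "(\<integral>\<^sup>+s\<in>{0..t}. ennreal ((norm (M s \<omega>))\<^sup>2 + (norm (f s \<omega>))\<^sup>2) \<partial>lborel)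
      = (\<integral>\<^sup>+s\<in>{0..t}. ennreal ((norm (M s \<omega>))\<^sup>2) \<partial>lborel) + (\<integral>\<^sup>+s\<in>{0..t}. ennreal ((norm (f s \<omega>))\<^sup>2) \<partial>lborel)"
      by (simp add: ennreal_plus distrib_right nn_integral_add)
  qed
  also have "\<dots> = (\<integral>\<^sup>+\<omega>. (\<integral>\<^sup>+s\<in>{0..t}. ennreal ((norm (M s \<omega>))\<^sup>2) \<partial>lborel) \<partial>P)
      + (\<integral>\<^sup>+\<omega>. (\<integral>\<^sup>+s\<in>{0..t}. ennreal ((norm (f s \<omega>))\<^sup>2) \<partial>lborel) \<partial>P)"
    by (intro nn_integral_add time_integral_measurable) measurable
  also have "(\<integral>\<^sup>+\<omega>. (\<integral>\<^sup>+s\<in>{0..t}. ennreal ((norm (M s \<omega>))\<^sup>2) \<partial>lborel) \<partial>P)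
      = (\<integral>\<^sup>+s\<in>{0..t}. (\<integral>\<^sup>+\<omega>. ennreal ((norm (M s \<omega>))\<^sup>2) \<partial>P) \<partial>lborel)"
    by (rule time_swap) measurable
  also have "\<dots> \<le> (\<integral>\<^sup>+s. (\<integral>\<^sup>+r\<in>{0..t}. q r \<partial>lborel) * indicator {0..t} s \<partial>lborel)"
  proof (rule nn_integral_mono)
    fix s
    have "(\<integral>\<^sup>+r\<in>{0..s}. q r \<partial>lborel) \<le> (\<integral>\<^sup>+r\<in>{0..t}. q r \<partial>lborel)" if "s \<le> t"
      using that by (intro nn_integral_mono mult_left_mono) (auto simp: indicator_def)
    then show "(\<integral>\<^sup>+\<omega>. ennreal ((norm (M s \<omega>))\<^sup>2) \<partial>P) * indicator {0..t} s
        \<le> (\<integral>\<^sup>+r\<in>{0..t}. q r \<partial>lborel) * indicator {0..t} s"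
      using q(2)[of s] by (auto simp: indicator_def)
  qed
  also have "\<dots> = (\<integral>\<^sup>+r\<in>{0..t}. q r \<partial>lborel) * ennreal t"
    using t by (simp add: nn_integral_cmult_indicator)
  finally have "input_size t \<le> (\<integral>\<^sup>+r\<in>{0..t}. q r \<partial>lborel) * ennreal t
      + (\<integral>\<^sup>+\<omega>. (\<integral>\<^sup>+s\<in>{0..t}. ennreal ((norm (f s \<omega>))\<^sup>2) \<partial>lborel) \<partial>P)"
    by (simp add: add_right_mono)
  also have "\<dots> < \<infinity>" using q(3)[OF t] f_square[OF t] by (simp add: ennreal_mult_less_top)
  finally show ?thesis .
qed

definition initial_energy :: real where
  "initial_energy = (norm (S u0))\<^sup>2 + (norm (R v0 + lam *\<^sub>R R u0))\<^sup>2"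

lemma AE_initial:
  "AE \<omega> in P. smooth_energy 0 \<omega> = initial_energy \<and> smooth_velocity 0 \<omega> = R v0 + lam *\<^sub>R R u0 \<and> noise 0 \<omega> = 0"
  using init mart(3)
  by eventually_elim (simp add: process_defs initial_energy_def linear_0[OF bounded_linear.linear[OF bounded_linear_R]])

lemma smooth_energy_bound:
  assumes t: "0 \<le> t"
  obtains B where "B < \<infinity>" "\<And>s. 0 \<le> s \<Longrightarrow> s \<le> t \<Longrightarrow> (\<integral>\<^sup>+\<omega>. ennreal (smooth_energy s \<omega>) \<partial>P) \<le> B"
proof -
  obtain C where C: "0 \<le> C" "AE \<omega> in P. \<forall>t\<ge>0. ennreal (smooth_energy t \<omega>)
    \<le> ennreal (exp (C * t)) * (ennreal (smooth_energy 0 \<omega>)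
      + ennreal C * (\<integral>\<^sup>+s\<in>{0..t}. ennreal ((norm (M s \<omega>))\<^sup>2 + (norm (f s \<omega>))\<^sup>2) \<partial>lborel))"
    by (rule smooth_energy_growth) (rule that)
  have "(\<integral>\<^sup>+\<omega>. ennreal (smooth_energy s \<omega>) \<partial>P) \<le> ennreal (exp (C * t)) * (ennreal initial_energy + ennreal C * input_size t)"
    if s: "0 \<le> s" "s \<le> t" for s
  proof -
    let ?I = "\<lambda>\<omega>. \<integral>\<^sup>+r\<in>{0..s}. ennreal ((norm (M r \<omega>))\<^sup>2 + (norm (f r \<omega>))\<^sup>2) \<partial>lborel"
    have Im[measurable]: "?I \<in> borel_measurable P" by (rule time_integral_measurable) measurable
    have "AE \<omega> in P. ennreal (smooth_energy s \<omega>) \<le> ennreal (exp (C * s)) * (ennreal initial_energy + ennreal C * ?I \<omega>)"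
      using C(2) AE_initial
    proof eventually_elim
      case (elim \<omega>)
      have "ennreal (smooth_energy s \<omega>) \<le> ennreal (exp (C * s)) * (ennreal (smooth_energy 0 \<omega>) + ennreal C * ?I \<omega>)"
        using elim(1) s(1) by blast
      then show ?case by (simp only: conjunct1[OF elim(2)])
    qed
    then have "(\<integral>\<^sup>+\<omega>. ennreal (smooth_energy s \<omega>) \<partial>P)
        \<le> (\<integral>\<^sup>+\<omega>. ennreal (exp (C * s)) * (ennreal initial_energy + ennreal C * ?I \<omega>) \<partial>P)"
      by (rule nn_integral_mono_AE)
    also have "\<dots> = ennreal (exp (C * s)) * (ennreal initial_energy + ennreal C * input_size s)"
    proof -
      have "(\<integral>\<^sup>+\<omega>. a * (b + c * X \<omega>) \<partial>P) = a * (b + c * (\<integral>\<^sup>+\<omega>. X \<omega> \<partial>P))"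
        if "X \<in> borel_measurable P" for X and a b c :: ennreal
        using that by (simp add: nn_integral_cmult nn_integral_add emeasure_space_1)
      from this[OF Im] show ?thesis unfolding input_size_def .
    qed
    also have "\<dots> \<le> ennreal (exp (C * t)) * (ennreal initial_energy + ennreal C * input_size t)"
      using s C(1) by (intro mult_mono add_mono ennreal_leI input_size_mono) (auto intro: mult_left_mono)
    finally show ?thesis .
  qed
  moreover have "ennreal (exp (C * t)) * (ennreal initial_energy + ennreal C * input_size t) < \<infinity>"
    using input_size_finite[OF t] by (simp add: ennreal_mult_less_top)
  ultimately show thesis by (intro that) auto
qed

lemma majorant_finite:
  assumes t: "0 \<le> t"
  shows "(\<integral>\<^sup>+s\<in>{0..t}. (\<integral>\<^sup>+\<omega>. ennreal (majorant s \<omega>) \<partial>P) \<partial>lborel) < \<infinity>"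
proof -
  obtain B where B: "B < \<infinity>" "\<And>s. 0 \<le> s \<Longrightarrow> s \<le> t \<Longrightarrow> (\<integral>\<^sup>+\<omega>. ennreal (smooth_energy s \<omega>) \<partial>P) \<le> B"
    by (rule smooth_energy_bound[OF t]) (rule that)
  define k where "k s \<omega> = ennreal ((norm (M s \<omega>))\<^sup>2 + (norm (f s \<omega>))\<^sup>2)" for s \<omega>
  have km[measurable]: "(\<lambda>x. k (fst x) (snd x)) \<in> borel_measurable (borel \<Otimes>\<^sub>M P)"
    unfolding k_def by measurable
  have kms[measurable]: "k s \<in> borel_measurable P" for s unfolding k_def by measurable
  have "(\<integral>\<^sup>+s\<in>{0..t}. (\<integral>\<^sup>+\<omega>. ennreal (majorant s \<omega>) \<partial>P) \<partial>lborel)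
      \<le> (\<integral>\<^sup>+s. B * indicator {0..t} s + (\<integral>\<^sup>+\<omega>. k s \<omega> \<partial>P) * indicator {0..t} s \<partial>lborel)"
  proof (rule nn_integral_mono)
    fix s
    have "(\<integral>\<^sup>+\<omega>. ennreal (majorant s \<omega>) \<partial>P) = (\<integral>\<^sup>+\<omega>. ennreal (smooth_energy s \<omega>) + k s \<omega> \<partial>P)"
      using smooth_energy_nonneg by (intro nn_integral_cong) (simp add: majorant_def k_def ennreal_plus)
    also have "\<dots> = (\<integral>\<^sup>+\<omega>. ennreal (smooth_energy s \<omega>) \<partial>P) + (\<integral>\<^sup>+\<omega>. k s \<omega> \<partial>P)"
      by (rule nn_integral_add) measurable
    finally show "(\<integral>\<^sup>+\<omega>. ennreal (majorant s \<omega>) \<partial>P) * indicator {0..t} s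
        \<le> B * indicator {0..t} s + (\<integral>\<^sup>+\<omega>. k s \<omega> \<partial>P) * indicator {0..t} s"
      using B(2)[of s] by (auto simp: indicator_def add_right_mono)
  qed
  also have "\<dots> = (\<integral>\<^sup>+s. B * indicator {0..t} s \<partial>lborel) + (\<integral>\<^sup>+s\<in>{0..t}. (\<integral>\<^sup>+\<omega>. k s \<omega> \<partial>P) \<partial>lborel)"
    by (rule nn_integral_add) measurable
  also have "(\<integral>\<^sup>+s\<in>{0..t}. (\<integral>\<^sup>+\<omega>. k s \<omega> \<partial>P) \<partial>lborel) = input_size t"
    unfolding input_size_def k_def[symmetric] by (rule time_swap[symmetric]) measurable
  also have "(\<integral>\<^sup>+s. B * indicator {0..t} s \<partial>lborel) = B * ennreal t"
    using t by (simp add: nn_integral_cmult_indicator)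
  finally show ?thesis
    using B(1) input_size_finite[OF t] by (auto simp: ennreal_mult_less_top intro: le_less_trans)
qed

lemma smooth_energy_integrable: "0 \<le> t \<Longrightarrow> integrable P (smooth_energy t)"
proof -
  assume t: "0 \<le> t"
  obtain B where B: "B < \<infinity>" "\<And>s. 0 \<le> s \<Longrightarrow> s \<le> t \<Longrightarrow> (\<integral>\<^sup>+\<omega>. ennreal (smooth_energy s \<omega>) \<partial>P) \<le> B"
    by (rule smooth_energy_bound[OF t]) (rule that)
  show ?thesis
    using B(1) B(2)[OF t order_refl] smooth_energy_nonneg by (intro integrableI_nonneg) (auto intro: le_less_trans)
qed

lemma AE_majorant_integrable:
  assumes t: "0 \<le> t"
  shows "AE s in lborel. s \<in> {0..t} \<longrightarrow> integrable P (majorant s)"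
proof -
  have "AE s in lborel. (\<integral>\<^sup>+\<omega>. ennreal (majorant s \<omega>) \<partial>P) * indicator {0..t} s \<noteq> \<infinity>"
    using majorant_finite[OF t] by (intro nn_integral_PInf_AE) auto
  then show ?thesis
  proof eventually_elim
    case (elim s)
    then show ?case
      using majorant_ge(4) by (auto intro!: integrableI_nonneg simp: less_top)
  qed
qed

lemma fubini_majorized:
  assumes t: "0 \<le> t" and g[measurable]: "(\<lambda>x. g (fst x) (snd x)) \<in> borel_measurable (borel \<Otimes>\<^sub>M P)"
    and C: "0 \<le> C" "\<And>s \<omega>. \<bar>g s \<omega>\<bar> \<le> C * (majorant s \<omega> + (norm (M t \<omega>))\<^sup>2)"
  shows "expectation (\<lambda>\<omega>. LINT s:{0..t}|lborel. g s \<omega>) = (LINT s:{0..t}|lborel. expectation (g s))"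
    and "set_integrable lborel {0..t} (\<lambda>s. expectation (g s))"
    and "integrable P (\<lambda>\<omega>. LINT s:{0..t}|lborel. g s \<omega>)"
proof -
  let ?B = "\<integral>\<^sup>+\<omega>. ennreal ((norm (M t \<omega>))\<^sup>2) \<partial>P"
  have "(\<integral>\<^sup>+s\<in>{0..t}. (\<integral>\<^sup>+\<omega>. ennreal \<bar>g s \<omega>\<bar> \<partial>P) \<partial>lborel)
      \<le> (\<integral>\<^sup>+s. ennreal C * ((\<integral>\<^sup>+\<omega>. ennreal (majorant s \<omega>) \<partial>P) * indicator {0..t} s + ?B * indicator {0..t} s) \<partial>lborel)"
  proof (rule nn_integral_mono)
    fix s
    have "(\<integral>\<^sup>+\<omega>. ennreal \<bar>g s \<omega>\<bar> \<partial>P) \<le> (\<integral>\<^sup>+\<omega>. ennreal C * (ennreal (majorant s \<omega>) + ennreal ((norm (M t \<omega>))\<^sup>2)) \<partial>P)"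
      using C majorant_ge(4)
      by (intro nn_integral_mono) (simp add: ennreal_leI flip: ennreal_plus ennreal_mult)
    also have "\<dots> = ennreal C * ((\<integral>\<^sup>+\<omega>. ennreal (majorant s \<omega>) \<partial>P) + ?B)"
      by (simp add: nn_integral_cmult nn_integral_add)
    finally show "(\<integral>\<^sup>+\<omega>. ennreal \<bar>g s \<omega>\<bar> \<partial>P) * indicator {0..t} s
        \<le> ennreal C * ((\<integral>\<^sup>+\<omega>. ennreal (majorant s \<omega>) \<partial>P) * indicator {0..t} s + ?B * indicator {0..t} s)"
      by (auto simp: indicator_def)
  qed
  also have "\<dots> = ennreal C * ((\<integral>\<^sup>+s\<in>{0..t}. (\<integral>\<^sup>+\<omega>. ennreal (majorant s \<omega>) \<partial>P) \<partial>lborel) + ?B * ennreal t)"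
    using t by (simp add: nn_integral_cmult nn_integral_add nn_integral_cmult_indicator)
  also have "\<dots> < \<infinity>"
    using majorant_finite[OF t] M_square_finite[OF t] by (simp add: ennreal_mult_less_top)
  finally have fin: "(\<integral>\<^sup>+s\<in>{0..t}. (\<integral>\<^sup>+\<omega>. ennreal \<bar>g s \<omega>\<bar> \<partial>P) \<partial>lborel) < \<infinity>" .
  show "expectation (\<lambda>\<omega>. LINT s:{0..t}|lborel. g s \<omega>) = (LINT s:{0..t}|lborel. expectation (g s))"
    "set_integrable lborel {0..t} (\<lambda>s. expectation (g s))"
    "integrable P (\<lambda>\<omega>. LINT s:{0..t}|lborel. g s \<omega>)"
    by (rule fubini_time_integral[OF g fin])+
qed

text \<open>
  Transfers \<open>martingale_inner_expectation\<close> to the modified processes.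
\<close>

lemma martingale_orthogonality:
  assumes T: "bounded_linear (T :: 'h \<Rightarrow> 'h)" and st: "0 \<le> s" "s \<le> t"
    and \<xi>[measurable]: "\<xi> \<in> borel_measurable P" and \<xi>2: "integrable P (\<lambda>\<omega>. (norm (\<xi> \<omega>))\<^sup>2)"
    and Y: "\<exists>Y\<in>borel_measurable (F s). AE \<omega> in P. \<xi> \<omega> = Y \<omega>"
  shows "expectation (\<lambda>\<omega>. \<xi> \<omega> \<bullet> T (M t \<omega>)) = expectation (\<lambda>\<omega>. \<xi> \<omega> \<bullet> T (M s \<omega>))"
    and "integrable P (\<lambda>\<omega>. \<xi> \<omega> \<bullet> T (M t \<omega>))"
proof -
  have t: "0 \<le> t" using st by simp
  have [measurable]: "T \<in> borel_measurable borel" by (rule bounded_linear_borel_measurable[OF T])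
  obtain L where L: "0 < L" "\<And>x. norm (T x) \<le> norm x * L" using bounded_linear.pos_bounded[OF T] by blast
  have TM: "integrable P (\<lambda>\<omega>. (norm (T (M r \<omega>)))\<^sup>2)" if "0 \<le> r" for r
  proof (rule Bochner_Integration.integrable_bound)
    show "integrable P (\<lambda>\<omega>. (norm (M r \<omega>))\<^sup>2 * L\<^sup>2)" using M_square_integrable[OF that] by simp
    have "(norm (T x))\<^sup>2 \<le> (norm x)\<^sup>2 * L\<^sup>2" for x
      using power_mono[OF L(2)[of x], of 2] by (simp add: power_mult_distrib)
    then show "AE \<omega> in P. norm ((norm (T (M r \<omega>)))\<^sup>2) \<le> norm ((norm (M r \<omega>))\<^sup>2 * L\<^sup>2)" by simp
  qed measurable
  obtain Y where Ym: "Y \<in> borel_measurable (F s)" and Y: "AE \<omega> in P. \<xi> \<omega> = Y \<omega>" using Y by blast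
  have [measurable]: "Y \<in> borel_measurable P" by (rule filtration_measurable_P[OF Ym])
  have M'm: "M' r \<in> borel_measurable P" if "0 \<le> r" for r using martingaleD(2)[OF mart(1) that] by simp
  note [measurable] = M'm[OF t] M'm[OF st(1)]
  have MM': "AE \<omega> in P. M r \<omega> = M' r \<omega>" if "0 \<le> r" for r using mart(2) by eventually_elim (use that in blast)
  have Y2: "integrable P (\<lambda>\<omega>. (norm (Y \<omega>))\<^sup>2)"
    by (rule integrable_cong_AE_imp[OF \<xi>2]) (measurable, use Y in \<open>auto elim!: eventually_mono\<close>)
  have TM': "integrable P (\<lambda>\<omega>. (norm (T (M' r \<omega>)))\<^sup>2)" if "0 \<le> r" for r
  proof (rule integrable_cong_AE_imp[OF TM[OF that]])
    have [measurable]: "M' r \<in> borel_measurable P" by (rule M'm[OF that])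
    show "(\<lambda>\<omega>. (norm (T (M' r \<omega>)))\<^sup>2) \<in> borel_measurable P" by measurable
    show "AE \<omega> in P. (norm (T (M r \<omega>)))\<^sup>2 = (norm (T (M' r \<omega>)))\<^sup>2"
      using MM'[OF that] by eventually_elim simp
  qed
  have eq: "expectation (\<lambda>\<omega>. \<xi> \<omega> \<bullet> T (M r \<omega>)) = expectation (\<lambda>\<omega>. Y \<omega> \<bullet> T (M' r \<omega>))" if "0 \<le> r" for r
  proof (rule integral_cong_AE)
    have [measurable]: "M' r \<in> borel_measurable P" by (rule M'm[OF that])
    show "(\<lambda>\<omega>. Y \<omega> \<bullet> T (M' r \<omega>)) \<in> borel_measurable P" by measurable
    show "AE \<omega> in P. \<xi> \<omega> \<bullet> T (M r \<omega>) = Y \<omega> \<bullet> T (M' r \<omega>)"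
      using Y MM'[OF that] by eventually_elim simp
  qed measurable
  have "expectation (\<lambda>\<omega>. Y \<omega> \<bullet> T (M' t \<omega>)) = expectation (\<lambda>\<omega>. Y \<omega> \<bullet> T (M' s \<omega>))"
    by (rule martingale_inner_expectation[OF martingale_bounded_linear[OF mart(1) T] st Ym Y2 TM'[OF t] TM'[OF st(1)]])
  then show "expectation (\<lambda>\<omega>. \<xi> \<omega> \<bullet> T (M t \<omega>)) = expectation (\<lambda>\<omega>. \<xi> \<omega> \<bullet> T (M s \<omega>))"
    using eq[OF t] eq[OF st(1)] by simp
  show "integrable P (\<lambda>\<omega>. \<xi> \<omega> \<bullet> T (M t \<omega>))"
  proof (rule Bochner_Integration.integrable_bound[where f="\<lambda>\<omega>. norm (\<xi> \<omega>) * norm (T (M t \<omega>))"])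
    show "integrable P (\<lambda>\<omega>. norm (\<xi> \<omega>) * norm (T (M t \<omega>)))"
      by (rule integrable_mult_of_squares[OF _ _ \<xi>2 TM[OF t]]) measurable
    show "AE \<omega> in P. norm (\<xi> \<omega> \<bullet> T (M t \<omega>)) \<le> norm (norm (\<xi> \<omega>) * norm (T (M t \<omega>)))"
      using Cauchy_Schwarz_ineq2 by auto
  qed measurable
qed

lemma adapted_ae_process:
  assumes s: "0 \<le> s"
  shows "\<exists>Y\<in>borel_measurable (F s). AE \<omega> in P. S (u s \<omega>) = Y \<omega>"
    and "\<exists>Y\<in>borel_measurable (F s). AE \<omega> in P. lower_force s \<omega> = Y \<omega>"
    and "\<exists>Y\<in>borel_measurable (F s). AE \<omega> in P. noise s \<omega> = Y \<omega>"
proof -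
  obtain Yu where Yu[measurable]: "Yu \<in> borel_measurable (F s)" and u: "AE \<omega> in P. u s \<omega> = Yu \<omega>"
    using adapted_ae(1)[OF s] by blast
  obtain Yv where Yv[measurable]: "Yv \<in> borel_measurable (F s)" and v: "AE \<omega> in P. v s \<omega> = Yv \<omega>"
    using adapted_ae(2)[OF s] by blast
  obtain Yf where Yf[measurable]: "Yf \<in> borel_measurable (F s)" and f: "AE \<omega> in P. f s \<omega> = Yf \<omega>"
    using adapted_ae(3)[OF s] by blast
  have [measurable]: "M' s \<in> borel_measurable (F s)" by (rule martingaleD(1)[OF mart(1) s])
  show "\<exists>Y\<in>borel_measurable (F s). AE \<omega> in P. S (u s \<omega>) = Y \<omega>"
    by (rule bexI[of _ "\<lambda>\<omega>. S (Yu \<omega>)"]) (use u in \<open>auto elim!: eventually_mono\<close>)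
  show "\<exists>Y\<in>borel_measurable (F s). AE \<omega> in P. lower_force s \<omega> = Y \<omega>"
  proof (rule bexI[of _ "\<lambda>\<omega>. R (Yf \<omega>) - (2 * \<alpha> - lam) *\<^sub>R R (Yv \<omega>)"])
    show "AE \<omega> in P. lower_force s \<omega> = R (Yf \<omega>) - (2 * \<alpha> - lam) *\<^sub>R R (Yv \<omega>)"
      using v f by eventually_elim (simp add: lower_force_def)
  qed measurable
  show "\<exists>Y\<in>borel_measurable (F s). AE \<omega> in P. noise s \<omega> = Y \<omega>"
  proof (rule bexI[of _ "\<lambda>\<omega>. R (M' s \<omega>)"])
    show "AE \<omega> in P. noise s \<omega> = R (M' s \<omega>)" using mart(2) by eventually_elim (use s in \<open>simp add: noise_def\<close>)
  qed measurable
qed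

end

section \<open>Decay of the regularized mean energy\<close>

lemma ennreal_integral_le_nn_integral:
  fixes g :: "'a \<Rightarrow> real"
  assumes "\<And>x. 0 \<le> g x"
  shows "ennreal (integral\<^sup>L M g) \<le> (\<integral>\<^sup>+x. ennreal (g x) \<partial>M)"
proof (cases "integrable M g")
  case True
  then show ?thesis using assms by (simp add: nn_integral_eq_integral)
qed (simp add: not_integrable_integral_eq)

lemma set_integral_enn2real:
  fixes q :: "real \<Rightarrow> ennreal"
  assumes q: "q \<in> borel_measurable borel" and fin: "(\<integral>\<^sup>+s\<in>{0..t}. q s \<partial>lborel) < \<infinity>"
  shows "set_integrable lborel {0..t} (\<lambda>s. enn2real (q s))"
    and "ennreal (LINT s:{0..t}|lborel. enn2real (q s)) = (\<integral>\<^sup>+s\<in>{0..t}. q s \<partial>lborel)"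
proof -
  note [measurable] = q
  have "AE s in lborel. q s * indicator {0..t} s \<noteq> \<infinity>"
    by (rule nn_integral_PInf_AE) (measurable, use fin in simp)
  then have eq: "(\<integral>\<^sup>+s. ennreal (indicator {0..t} s *\<^sub>R enn2real (q s)) \<partial>lborel) = (\<integral>\<^sup>+s\<in>{0..t}. q s \<partial>lborel)"
    by (intro nn_integral_cong_AE, eventually_elim) (auto simp: indicator_def less_top)
  have m: "(\<lambda>s. indicator {0..t} s *\<^sub>R enn2real (q s)) \<in> borel_measurable lborel" using q by measurable
  show i: "set_integrable lborel {0..t} (\<lambda>s. enn2real (q s))"
    unfolding set_integrable_def
  proof (rule integrableI_nonneg[OF m])
    show "(\<integral>\<^sup>+s. ennreal (indicator {0..t} s *\<^sub>R enn2real (q s)) \<partial>lborel) < \<infinity>" using fin by (simp only: eq)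
  qed simp
  show "ennreal (LINT s:{0..t}|lborel. enn2real (q s)) = (\<integral>\<^sup>+s\<in>{0..t}. q s \<partial>lborel)"
    unfolding eq[symmetric] set_lebesgue_integral_def using i
    by (intro nn_integral_eq_integral[symmetric]) (auto simp: set_integrable_def)
qed

context regularized_stochastic_wave
begin

text \<open>
  The second moment of \<open>f\<close> is merely integrable in time, hence finite for almost every time; the identities for expectations that follow hold for these times.
\<close>

lemma AE_square_integrable:
  assumes t: "0 \<le> t"
  shows "AE s in lborel. s \<in> {0..t} \<longrightarrow> integrable P (\<lambda>\<omega>. (norm (S (u s \<omega>)))\<^sup>2)
    \<and> integrable P (\<lambda>\<omega>. (norm (lower_force s \<omega>))\<^sup>2)"
  using AE_majorant_integrable[OF t]
proof eventually_elim
  case (elim s)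
  show ?case
  proof (intro impI conjI)
    assume "s \<in> {0..t}"
    then have i: "integrable P (majorant s)" using elim by simp
    show "integrable P (\<lambda>\<omega>. (norm (S (u s \<omega>)))\<^sup>2)"
    proof (rule Bochner_Integration.integrable_bound[OF i])
      have "(norm (S (u s \<omega>)))\<^sup>2 \<le> majorant s \<omega>" for \<omega>
        unfolding majorant_def smooth_energy_def by simp
      then show "AE \<omega> in P. norm ((norm (S (u s \<omega>)))\<^sup>2) \<le> norm (majorant s \<omega>)"
        by (intro AE_I2) (simp add: order_trans[OF _ abs_ge_self])
    qed measurable
    let ?B = "4 + 4 * (2 * \<alpha> - lam)\<^sup>2"
    have "(norm (lower_force s \<omega>))\<^sup>2 \<le> ?B * majorant s \<omega>" for \<omega>
      using forcing_le[of "f s \<omega>" "v s \<omega>" "u s \<omega>" "M s \<omega>"] by (simp add: process_defs add.assoc)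
    then have "AE \<omega> in P. norm ((norm (lower_force s \<omega>))\<^sup>2) \<le> norm (?B * majorant s \<omega>)"
      by (intro AE_I2) (simp only: real_norm_def abs_power2 order_trans[OF _ abs_ge_self])
    then show "integrable P (\<lambda>\<omega>. (norm (lower_force s \<omega>))\<^sup>2)"
      by (rule Bochner_Integration.integrable_bound[OF integrable_mult_right[OF i], rotated]) measurable
  qed
qed

text \<open>
  The second moment of the force is not under control, but its pairing with the noise is that of \<open>S u\<close> with
  \<open>S M\<close> and of the lower order force with \<open>R M\<close>, and \<open>S M\<close>, \<open>R M\<close> are martingales.
\<close>

lemma AE_expectation_force_noise:
  assumes t: "0 \<le> t"
  shows "AE s in lborel. s \<in> {0..t} \<longrightarrow>
    expectation (\<lambda>\<omega>. force s \<omega> \<bullet> noise t \<omega>) = expectation (\<lambda>\<omega>. force s \<omega> \<bullet> noise s \<omega>)"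
  using AE_square_integrable[OF t]
proof eventually_elim
  case (elim s)
  show ?case
  proof
    assume "s \<in> {0..t}"
    then have st: "0 \<le> s" "s \<le> t" by auto
    have i: "integrable P (\<lambda>\<omega>. (norm (S (u s \<omega>)))\<^sup>2)" "integrable P (\<lambda>\<omega>. (norm (lower_force s \<omega>))\<^sup>2)"
      using elim st by auto
    have Su: "(\<lambda>\<omega>. S (u s \<omega>)) \<in> borel_measurable P" by measurable
    have split: "force s \<omega> \<bullet> noise r \<omega> = lower_force s \<omega> \<bullet> R (M r \<omega>) - S (u s \<omega>) \<bullet> S (M r \<omega>)" for r \<omega>
      by (simp add: force_def noise_def inner_add_left S_inner inner_diff_left)
    note oS = martingale_orthogonality[OF bounded_linear_S st(1) _ Su i(1) adapted_ae_process(1)[OF st(1)]]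
    note oR = martingale_orthogonality[OF bounded_linear_R st(1) _ process_slices(4) i(2) adapted_ae_process(2)[OF st(1)]]
    show "expectation (\<lambda>\<omega>. force s \<omega> \<bullet> noise t \<omega>) = expectation (\<lambda>\<omega>. force s \<omega> \<bullet> noise s \<omega>)"
      unfolding split using oS(1)[OF st(2)] oR(1)[OF st(2)]
        oS(2)[OF st(2)] oR(2)[OF st(2)] oS(2)[OF order_refl] oR(2)[OF order_refl] by simp
  qed
qed

lemma noise_square_integrable: "0 \<le> t \<Longrightarrow> integrable P (\<lambda>\<omega>. (norm (noise t \<omega>))\<^sup>2)"
  by (rule Bochner_Integration.integrable_bound[OF M_square_integrable])
    (auto simp: noise_def norm_R_le power_mono)

lemma martingale_increment:
  assumes st: "0 \<le> s" "s \<le> t" and X: "bounded_linear (T :: 'h \<Rightarrow> 'h)" "\<exists>Y\<in>borel_measurable (F s). AE \<omega> in P. T (M s \<omega>) = Y \<omega>"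
    and i: "\<And>r. 0 \<le> r \<Longrightarrow> integrable P (\<lambda>\<omega>. (norm (T (M r \<omega>)))\<^sup>2)"
  shows "expectation (\<lambda>\<omega>. (norm (T (M t \<omega>) - T (M s \<omega>)))\<^sup>2)
      = expectation (\<lambda>\<omega>. (norm (T (M t \<omega>)))\<^sup>2) - expectation (\<lambda>\<omega>. (norm (T (M s \<omega>)))\<^sup>2)"
    and "integrable P (\<lambda>\<omega>. (norm (T (M t \<omega>) - T (M s \<omega>)))\<^sup>2)"
proof -
  have [measurable]: "T \<in> borel_measurable borel" by (rule bounded_linear_borel_measurable[OF X(1)])
  have m: "(\<lambda>\<omega>. T (M s \<omega>)) \<in> borel_measurable P" by measurable
  note o = martingale_orthogonality[OF X(1) st m i[OF st(1)] X(2)]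
  have t: "0 \<le> t" using st by simp
  have eq: "(\<lambda>\<omega>. (norm (T (M t \<omega>) - T (M s \<omega>)))\<^sup>2)
      = (\<lambda>\<omega>. (norm (T (M t \<omega>)))\<^sup>2 - 2 * (T (M s \<omega>) \<bullet> T (M t \<omega>)) + (norm (T (M s \<omega>)))\<^sup>2)"
    by (simp add: fun_eq_iff power2_norm_eq_inner inner_diff inner_commute)
  show "integrable P (\<lambda>\<omega>. (norm (T (M t \<omega>) - T (M s \<omega>)))\<^sup>2)"
    unfolding eq using o(2) i[OF t] i[OF st(1)] by simp
  show "expectation (\<lambda>\<omega>. (norm (T (M t \<omega>) - T (M s \<omega>)))\<^sup>2)
      = expectation (\<lambda>\<omega>. (norm (T (M t \<omega>)))\<^sup>2) - expectation (\<lambda>\<omega>. (norm (T (M s \<omega>)))\<^sup>2)"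
    unfolding eq using o i[OF t] i[OF st(1)] by (simp add: power2_norm_eq_inner)
qed

text \<open>
  The increments of a square integrable martingale are orthogonal to the past, so that differences of
  second moments are second moments of differences, and these decrease under the contraction \<open>R\<close>.
\<close>

lemma noise_increment_le:
  assumes st: "0 \<le> s" "s \<le> t"
  shows "expectation (\<lambda>\<omega>. (norm (noise t \<omega>))\<^sup>2) - expectation (\<lambda>\<omega>. (norm (noise s \<omega>))\<^sup>2)
    \<le> (LINT r:{0..t}|lborel. enn2real (q r)) - (LINT r:{0..s}|lborel. enn2real (q r))"
proof -
  have t: "0 \<le> t" using st by simp
  have Mq: "expectation (\<lambda>\<omega>. (norm (M r \<omega>))\<^sup>2) = (LINT x:{0..r}|lborel. enn2real (q x))" if r: "0 \<le> r" for r
  proof -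
    have "ennreal (expectation (\<lambda>\<omega>. (norm (M r \<omega>))\<^sup>2)) = ennreal (LINT x:{0..r}|lborel. enn2real (q x))"
      using set_integral_enn2real(2)[OF q(1) q(3)[OF r]] q(2)[OF r]
        nn_integral_eq_integral[OF M_square_integrable[OF r]] by simp
    moreover have "0 \<le> (LINT x:{0..r}|lborel. enn2real (q x))"
      unfolding set_lebesgue_integral_def by (rule integral_nonneg_AE) simp
    ultimately show ?thesis by (simp add: integral_nonneg_AE)
  qed
  have aM: "\<exists>Y\<in>borel_measurable (F s). AE \<omega> in P. M s \<omega> = Y \<omega>"
    using martingaleD(1)[OF mart(1) st(1)] mart(2) st(1) by (intro bexI[of _ "M' s"]) (auto elim: eventually_mono)
  have aN: "\<exists>Y\<in>borel_measurable (F s). AE \<omega> in P. R (M s \<omega>) = Y \<omega>"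
    using adapted_ae_process(3)[OF st(1)] by (simp add: noise_def)
  note iN = noise_square_integrable[unfolded noise_def]
  note N = martingale_increment[OF st bounded_linear_R aN iN]
  note M = martingale_increment[OF st bounded_linear_ident aM M_square_integrable]
  have "expectation (\<lambda>\<omega>. (norm (noise t \<omega>))\<^sup>2) - expectation (\<lambda>\<omega>. (norm (noise s \<omega>))\<^sup>2)
      = expectation (\<lambda>\<omega>. (norm (R (M t \<omega>) - R (M s \<omega>)))\<^sup>2)" by (simp add: noise_def N(1))
  also have "\<dots> \<le> expectation (\<lambda>\<omega>. (norm (M t \<omega> - M s \<omega>))\<^sup>2)"
  proof (rule integral_mono[OF N(2) M(2)])
    fix \<omega>
    have "R (M t \<omega>) - R (M s \<omega>) = R (M t \<omega> - M s \<omega>)"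
      by (simp add: linear_diff[OF bounded_linear.linear[OF bounded_linear_R]])
    then show "(norm (R (M t \<omega>) - R (M s \<omega>)))\<^sup>2 \<le> (norm (M t \<omega> - M s \<omega>))\<^sup>2"
      by (simp add: norm_R_le power_mono)
  qed
  also have "\<dots> = (LINT r:{0..t}|lborel. enn2real (q r)) - (LINT r:{0..s}|lborel. enn2real (q r))"
    by (simp add: M(1) Mq st t)
  finally show ?thesis .
qed

definition mean_drift :: "real \<Rightarrow> real" where
  "mean_drift s = expectation (energy_rate s) + 2 * expectation (\<lambda>\<omega>. force s \<omega> \<bullet> noise s \<omega>)"

text \<open>
  The substitute for Ito's formula: expand \<open>\<parallel>z + R M\<parallel>\<^sup>2\<close>, where \<open>z\<close> is the smooth velocity. The mixed term
  is \<open>(z t, R M t) = (z 0, R M t) + \<integral> (z' s, R M t) ds\<close>; the mean of its first part vanishes, since \<open>z 0\<close> is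
  constant, and in the second part \<open>R M t\<close> may be replaced by \<open>R M s\<close> under the expectation.
\<close>

lemma mean_energy_identity:
  assumes t: "0 \<le> t"
  shows "integrable P (energy t)"
    and "expectation (energy t) = initial_energy + (LINT s:{0..t}|lborel. mean_drift s)
      + expectation (\<lambda>\<omega>. (norm (noise t \<omega>))\<^sup>2)"
    and "set_integrable lborel {0..t} mean_drift"
proof -
  obtain C where C: "0 \<le> C" "\<And>t \<omega>. \<bar>energy_rate t \<omega>\<bar> \<le> C * majorant t \<omega>"
    by (rule energy_rate_le) (rule that)
  obtain C' where C': "0 \<le> C'" "\<And>s t \<omega>. \<bar>force s \<omega> \<bullet> noise t \<omega>\<bar> \<le> C' * (majorant s \<omega> + (norm (M t \<omega>))\<^sup>2)"
    by (rule force_noise_le) (rule that)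
  have b1: "\<bar>energy_rate s \<omega>\<bar> \<le> C * (majorant s \<omega> + (norm (M t \<omega>))\<^sup>2)" for s \<omega>
    using C(2)[of s \<omega>] mult_nonneg_nonneg[OF C(1) zero_le_power2[of "norm (M t \<omega>)"]]
    by (simp add: distrib_left)
  have b3: "\<bar>force s \<omega> \<bullet> noise s \<omega>\<bar> \<le> (2 * C') * (majorant s \<omega> + (norm (M t \<omega>))\<^sup>2)" for s \<omega>
  proof -
    have "majorant s \<omega> + (norm (M s \<omega>))\<^sup>2 \<le> 2 * (majorant s \<omega> + (norm (M t \<omega>))\<^sup>2)"
      using add_left_mono[OF majorant_ge(2)[of s \<omega>], of "majorant s \<omega>"] by (rule order_trans) simp
    from mult_left_mono[OF this C'(1)] C'(2)[of s \<omega> s] show ?thesis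
      by (simp add: algebra_simps)
  qed
  have m2: "(\<lambda>x. force (fst x) (snd x) \<bullet> noise t (snd x)) \<in> borel_measurable (borel \<Otimes>\<^sub>M P)"
  proof -
    have [measurable]: "(\<lambda>x. noise t (snd x)) \<in> borel_measurable ((borel :: real measure) \<Otimes>\<^sub>M P)"
      by (rule measurable_compose[OF measurable_snd process_slices(1)])
    show ?thesis by measurable
  qed
  have m3: "(\<lambda>x. force (fst x) (snd x) \<bullet> noise (fst x) (snd x)) \<in> borel_measurable (borel \<Otimes>\<^sub>M P)" by measurable
  note F1 = fubini_majorized[OF t process_measurable(7) C(1) b1]
  note F2 = fubini_majorized[OF t m2 C'(1) C'(2)]
  have C'2: "0 \<le> 2 * C'" using C'(1) by simp
  note F3 = fubini_majorized[OF t m3 C'2 b3]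
  have E1: "integrable P (smooth_energy t)"
    "expectation (smooth_energy t) = initial_energy + (LINT s:{0..t}|lborel. expectation (energy_rate s))"
  proof -
    show "integrable P (smooth_energy t)" by (rule smooth_energy_integrable[OF t])
    have "expectation (smooth_energy t) = expectation (\<lambda>\<omega>. initial_energy + (LINT s:{0..t}|lborel. energy_rate s \<omega>))"
    proof (rule integral_cong_AE)
      show "AE \<omega> in P. smooth_energy t \<omega> = initial_energy + (LINT s:{0..t}|lborel. energy_rate s \<omega>)"
        using smooth_energy_eq AE_initial by eventually_elim (use t in auto)
      show "(\<lambda>\<omega>. initial_energy + (LINT s:{0..t}|lborel. energy_rate s \<omega>)) \<in> borel_measurable P"
        using borel_measurable_integrable[OF F1(3)] by measurable
    qed measurable
    then show "expectation (smooth_energy t) = initial_energy + (LINT s:{0..t}|lborel. expectation (energy_rate s))"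
      using F1 by (simp add: prob_space)
  qed
  let ?z0 = "R v0 + lam *\<^sub>R R u0"
  \<comment> \<open>A constant is measurable at time \<open>0\<close>, so its pairing with the noise has constant mean.\<close>
  have c: "\<exists>Y\<in>borel_measurable (F 0). AE \<omega> in P. ?z0 = Y \<omega>" by (rule bexI[of _ "\<lambda>_. ?z0"]) auto
  have o: "expectation (\<lambda>\<omega>. ?z0 \<bullet> noise t \<omega>) = expectation (\<lambda>\<omega>. ?z0 \<bullet> noise 0 \<omega>)" "integrable P (\<lambda>\<omega>. ?z0 \<bullet> noise t \<omega>)"
    unfolding noise_def by (rule martingale_orthogonality[OF bounded_linear_R order_refl t _ _ c]; simp)+
  have "expectation (\<lambda>\<omega>. ?z0 \<bullet> noise 0 \<omega>) = 0"
    using AE_initial by (intro integral_eq_zero_AE) (auto elim: eventually_mono)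
  with o have o0: "expectation (\<lambda>\<omega>. ?z0 \<bullet> noise t \<omega>) = 0" by simp
  have ae: "AE \<omega> in P. ?z0 \<bullet> noise t \<omega> + (LINT s:{0..t}|lborel. force s \<omega> \<bullet> noise t \<omega>) = smooth_velocity t \<omega> \<bullet> noise t \<omega>"
    using velocity_noise_eq AE_initial by eventually_elim (use t in auto)
  have i2: "integrable P (\<lambda>\<omega>. ?z0 \<bullet> noise t \<omega> + (LINT s:{0..t}|lborel. force s \<omega> \<bullet> noise t \<omega>))"
    using o(2) F2(3) by simp
  have E2: "integrable P (\<lambda>\<omega>. smooth_velocity t \<omega> \<bullet> noise t \<omega>)"
    by (rule integrable_cong_AE_imp[OF i2 _ ae]) measurable
  have "expectation (\<lambda>\<omega>. smooth_velocity t \<omega> \<bullet> noise t \<omega>)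
      = expectation (\<lambda>\<omega>. ?z0 \<bullet> noise t \<omega> + (LINT s:{0..t}|lborel. force s \<omega> \<bullet> noise t \<omega>))"
    using ae borel_measurable_integrable[OF i2] by (intro integral_cong_AE) (auto elim: eventually_mono)
  also have "\<dots> = (LINT s:{0..t}|lborel. expectation (\<lambda>\<omega>. force s \<omega> \<bullet> noise t \<omega>))"
    using o(2) o0 F2 by simp
  also have "\<dots> = (LINT s:{0..t}|lborel. expectation (\<lambda>\<omega>. force s \<omega> \<bullet> noise s \<omega>))"
    unfolding set_lebesgue_integral_def
  proof (rule integral_cong_AE)
    show "(\<lambda>s. indicator {0..t} s *\<^sub>R expectation (\<lambda>\<omega>. force s \<omega> \<bullet> noise t \<omega>)) \<in> borel_measurable lborel"
      "(\<lambda>s. indicator {0..t} s *\<^sub>R expectation (\<lambda>\<omega>. force s \<omega> \<bullet> noise s \<omega>)) \<in> borel_measurable lborel"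
      using F2(2) F3(2) by (auto simp: set_integrable_def)
    show "AE s in lborel. indicator {0..t} s *\<^sub>R expectation (\<lambda>\<omega>. force s \<omega> \<bullet> noise t \<omega>)
        = indicator {0..t} s *\<^sub>R expectation (\<lambda>\<omega>. force s \<omega> \<bullet> noise s \<omega>)"
      using AE_expectation_force_noise[OF t] by eventually_elim (auto simp: indicator_def)
  qed
  finally have E2': "expectation (\<lambda>\<omega>. smooth_velocity t \<omega> \<bullet> noise t \<omega>)
      = (LINT s:{0..t}|lborel. expectation (\<lambda>\<omega>. force s \<omega> \<bullet> noise s \<omega>))" .
  have eq: "energy t = (\<lambda>\<omega>. smooth_energy t \<omega> + 2 * (smooth_velocity t \<omega> \<bullet> noise t \<omega>) + (norm (noise t \<omega>))\<^sup>2)"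
    by (simp add: fun_eq_iff energy_def smooth_energy_def smooth_velocity_def power2_norm_eq_inner
        inner_diff inner_commute algebra_simps)
  show "integrable P (energy t)" unfolding eq using E1(1) E2 noise_square_integrable[OF t] by simp
  show md: "set_integrable lborel {0..t} mean_drift"
    unfolding mean_drift_def[abs_def] using F1(2) F3(2) by (intro set_integral_add set_integrable_mult_right) auto
  have "(LINT s:{0..t}|lborel. mean_drift s) = (LINT s:{0..t}|lborel. expectation (energy_rate s))
      + 2 * (LINT s:{0..t}|lborel. expectation (\<lambda>\<omega>. force s \<omega> \<bullet> noise s \<omega>))"
    unfolding mean_drift_def using F1(2) F3(2) by (simp add: set_integral_add set_integral_mult_right)
  then show "expectation (energy t) = initial_energy + (LINT s:{0..t}|lborel. mean_drift s)
      + expectation (\<lambda>\<omega>. (norm (noise t \<omega>))\<^sup>2)"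
    unfolding eq using E1 E2 E2' noise_square_integrable[OF t] by simp
qed

text \<open>
  The noise subtracted in the smooth velocity is restored by the martingale term:
  \<open>2 (z, z') + 2 (z', R M) = 2 (R w, z')\<close>, to which the pointwise drift estimate applies.
\<close>

lemma mean_drift_le:
  assumes t: "0 \<le> t"
  defines "c \<equiv> lam / 2"
  shows "AE s in lborel. s \<in> {0..t} \<longrightarrow>
    mean_drift s \<le> - c * expectation (energy s) + 2 / c * expectation (\<lambda>\<omega>. (norm (f s \<omega>))\<^sup>2)"
  using AE_majorant_integrable[OF t]
proof eventually_elim
  case (elim s)
  show ?case
  proof
    assume "s \<in> {0..t}"
    then have s: "0 \<le> s" and i: "integrable P (majorant s)" using elim by auto
    obtain C where C: "0 \<le> C" "\<And>t \<omega>. \<bar>energy_rate t \<omega>\<bar> \<le> C * majorant t \<omega>"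
      by (rule energy_rate_le) (rule that)
    obtain C' where C': "0 \<le> C'" "\<And>s t \<omega>. \<bar>force s \<omega> \<bullet> noise t \<omega>\<bar> \<le> C' * (majorant s \<omega> + (norm (M t \<omega>))\<^sup>2)"
      by (rule force_noise_le) (rule that)
    have dominated: "integrable P g"
      if "g \<in> borel_measurable P" "integrable P k" "\<And>\<omega>. \<bar>g \<omega>\<bar> \<le> k \<omega>" for g k :: "'w \<Rightarrow> real"
      by (rule Bochner_Integration.integrable_bound[OF that(2,1)])
        (intro AE_I2, simp only: real_norm_def order_trans[OF that(3) abs_ge_self])
    have i1: "integrable P (energy_rate s)"
      by (rule dominated[OF _ integrable_mult_right[OF i] C(2)]) measurable
    have i2: "integrable P (\<lambda>\<omega>. force s \<omega> \<bullet> noise s \<omega>)"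
    proof (rule dominated[OF _ _ C'(2)])
      show "integrable P (\<lambda>\<omega>. C' * (majorant s \<omega> + (norm (M s \<omega>))\<^sup>2))"
        using i M_square_integrable[OF s] by simp
    qed measurable
    have i3: "integrable P (\<lambda>\<omega>. (norm (f s \<omega>))\<^sup>2)"
      by (rule dominated[OF _ i]) (measurable, simp add: majorant_ge)
    note i4 = mean_energy_identity(1)[OF s]
    have "mean_drift s = expectation (\<lambda>\<omega>. energy_rate s \<omega> + 2 * (force s \<omega> \<bullet> noise s \<omega>))"
      unfolding mean_drift_def using i1 i2 by simp
    also have "\<dots> \<le> expectation (\<lambda>\<omega>. - c * energy s \<omega> + 2 / c * (norm (f s \<omega>))\<^sup>2)"
    proof (rule integral_mono)
      fix \<omega>
      have "energy_rate s \<omega> + 2 * (force s \<omega> \<bullet> noise s \<omega>) = 2 * (S (u s \<omega>) \<bullet> S (v s \<omega>))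
          + 2 * (shifted_velocity s \<omega> \<bullet> force s \<omega>)"
        unfolding energy_rate_def smooth_velocity_def by (simp add: inner_diff_left inner_commute[of "force s \<omega>"])
      then show "energy_rate s \<omega> + 2 * (force s \<omega> \<bullet> noise s \<omega>) \<le> - c * energy s \<omega> + 2 / c * (norm (f s \<omega>))\<^sup>2"
        using drift_le[of "u s \<omega>" "v s \<omega>" "f s \<omega>"] unfolding c_def
        by (simp add: shifted_velocity_def force_def lower_force_def energy_def)
    qed (use i1 i2 i3 i4 in auto)
    also have "\<dots> = - c * expectation (energy s) + 2 / c * expectation (\<lambda>\<omega>. (norm (f s \<omega>))\<^sup>2)"
      using i3 i4 by simp
    finally show "mean_drift s \<le> - c * expectation (energy s) + 2 / c * expectation (\<lambda>\<omega>. (norm (f s \<omega>))\<^sup>2)" .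
  qed
qed

theorem regularized_energy_estimate:
  assumes t: "0 \<le> t"
  defines "c \<equiv> lam / 2"
  shows "(\<integral>\<^sup>+\<omega>. ennreal ((norm (S (u t \<omega>)))\<^sup>2 + (norm (R (v t \<omega>) + lam *\<^sub>R R (u t \<omega>)))\<^sup>2) \<partial>P)
    \<le> ennreal (((norm (S u0))\<^sup>2 + (norm (R v0 + lam *\<^sub>R R u0))\<^sup>2) * exp (- c * t))
      + (\<integral>\<^sup>+s\<in>{0..t}. ennreal (exp (- c * (t - s)))
          * ((\<integral>\<^sup>+\<omega>. ennreal (2 / c * (norm (f s \<omega>))\<^sup>2) \<partial>P) + q s) \<partial>lborel)"
proof -
  have c: "0 < c" using lam_pos by (simp add: c_def)
  define n where "n s = expectation (\<lambda>\<omega>. (norm (noise s \<omega>))\<^sup>2)" for s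
  define h where "h s = 2 / c * expectation (\<lambda>\<omega>. (norm (f s \<omega>))\<^sup>2)" for s
  have fm: "(\<lambda>x. (norm (f (fst x) (snd x)))\<^sup>2) \<in> borel_measurable (borel \<Otimes>\<^sub>M P)"
    and nm: "(\<lambda>x. (norm (noise (fst x) (snd x)))\<^sup>2) \<in> borel_measurable (borel \<Otimes>\<^sub>M P)" by measurable
  have fb: "\<bar>(norm (f s \<omega>))\<^sup>2\<bar> \<le> 1 * (majorant s \<omega> + (norm (M t \<omega>))\<^sup>2)" for s \<omega>
    using majorant_ge(3)[of s \<omega>] by (simp add: add_increasing2)
  have nb: "\<bar>(norm (noise s \<omega>))\<^sup>2\<bar> \<le> 1 * (majorant s \<omega> + (norm (M t \<omega>))\<^sup>2)" for s \<omega>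
  proof -
    have "(norm (noise s \<omega>))\<^sup>2 \<le> (norm (M s \<omega>))\<^sup>2" by (simp add: noise_def norm_R_le power_mono)
    then have "(norm (noise s \<omega>))\<^sup>2 \<le> majorant s \<omega>" using majorant_ge(2) by (rule order_trans)
    then show ?thesis by (simp add: add_increasing2)
  qed
  have ni: "set_integrable lborel {0..t} n"
    unfolding n_def[abs_def] by (rule fubini_majorized(2)[OF t nm zero_le_one nb])
  have hi: "set_integrable lborel {0..t} h"
    unfolding h_def[abs_def] using fubini_majorized(2)[OF t fm zero_le_one fb] by (intro set_integrable_mult_right) auto
  have n0: "n 0 = 0"
    unfolding n_def using AE_initial by (intro integral_eq_zero_AE) (auto elim: eventually_mono)
  have main: "expectation (energy t) \<le> exp (- c * t) * initial_energy
      + (LINT s:{0..t}|lborel. exp (- c * (t - s)) * (h s + enn2real (q s)))"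
  proof (rule gronwall_with_increasing_part[OF c t mean_energy_identity(3)[OF t] set_integral_enn2real(1)[OF q(1) q(3)[OF t]] hi ni _ n0])
    show "expectation (energy s) = initial_energy + (LINT r:{0..s}|lborel. mean_drift r) + n s" if "0 \<le> s" for s
      using mean_energy_identity(2)[OF that] by (simp add: n_def)
    show "n t - n s \<le> (LINT r:{0..t}|lborel. enn2real (q r)) - (LINT r:{0..s}|lborel. enn2real (q r))"
      if "0 \<le> s" "s \<le> t" for s
      using noise_increment_le[OF that] by (simp add: n_def)
    show "AE s in lborel. s \<in> {0..t} \<longrightarrow> mean_drift s \<le> - c * expectation (energy s) + h s"
      using mean_drift_le[OF t] unfolding h_def c_def .
  qed
  have "ennreal (LINT s:{0..t}|lborel. exp (- c * (t - s)) * (h s + enn2real (q s)))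
      \<le> (\<integral>\<^sup>+s. ennreal (indicator {0..t} s *\<^sub>R (exp (- c * (t - s)) * (h s + enn2real (q s)))) \<partial>lborel)"
    unfolding set_lebesgue_integral_def
    by (rule ennreal_integral_le_nn_integral) (use c in \<open>simp add: h_def integral_nonneg_AE\<close>)
  also have "\<dots> \<le> (\<integral>\<^sup>+s\<in>{0..t}. ennreal (exp (- c * (t - s)))
          * ((\<integral>\<^sup>+\<omega>. ennreal (2 / c * (norm (f s \<omega>))\<^sup>2) \<partial>P) + q s) \<partial>lborel)"
  proof (rule nn_integral_mono)
    fix s
    have h0: "0 \<le> h s" using c by (simp add: h_def integral_nonneg_AE)
    have "ennreal (h s) \<le> (\<integral>\<^sup>+\<omega>. ennreal (2 / c * (norm (f s \<omega>))\<^sup>2) \<partial>P)"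
      using ennreal_integral_le_nn_integral[of "\<lambda>\<omega>. 2 / c * (norm (f s \<omega>))\<^sup>2" P] c by (simp add: h_def)
    moreover have "ennreal (enn2real (q s)) \<le> q s" by (cases "q s") auto
    ultimately have "ennreal (h s + enn2real (q s)) \<le> (\<integral>\<^sup>+\<omega>. ennreal (2 / c * (norm (f s \<omega>))\<^sup>2) \<partial>P) + q s"
      using h0 by (simp add: ennreal_plus add_mono)
    then have "ennreal (exp (- c * (t - s)) * (h s + enn2real (q s)))
        \<le> ennreal (exp (- c * (t - s))) * ((\<integral>\<^sup>+\<omega>. ennreal (2 / c * (norm (f s \<omega>))\<^sup>2) \<partial>P) + q s)"
      using h0 by (simp add: ennreal_mult mult_left_mono)
    then show "ennreal (indicator {0..t} s *\<^sub>R (exp (- c * (t - s)) * (h s + enn2real (q s))))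
        \<le> ennreal (exp (- c * (t - s))) * ((\<integral>\<^sup>+\<omega>. ennreal (2 / c * (norm (f s \<omega>))\<^sup>2) \<partial>P) + q s) * indicator {0..t} s"
      by (auto simp: indicator_def)
  qed
  finally have I: "ennreal (LINT s:{0..t}|lborel. exp (- c * (t - s)) * (h s + enn2real (q s)))
      \<le> (\<integral>\<^sup>+s\<in>{0..t}. ennreal (exp (- c * (t - s)))
          * ((\<integral>\<^sup>+\<omega>. ennreal (2 / c * (norm (f s \<omega>))\<^sup>2) \<partial>P) + q s) \<partial>lborel)" .
  have "(\<integral>\<^sup>+\<omega>. ennreal (energy t \<omega>) \<partial>P) = ennreal (expectation (energy t))"
    by (rule nn_integral_eq_integral[OF mean_energy_identity(1)[OF t]]) (simp add: energy_def)
  also have "\<dots> \<le> ennreal (initial_energy * exp (- c * t)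
      + (LINT s:{0..t}|lborel. exp (- c * (t - s)) * (h s + enn2real (q s))))"
    using main by (intro ennreal_leI) (simp add: mult.commute)
  also have "\<dots> = ennreal (initial_energy * exp (- c * t))
      + ennreal (LINT s:{0..t}|lborel. exp (- c * (t - s)) * (h s + enn2real (q s)))"
  proof (rule ennreal_plus)
    show "0 \<le> initial_energy * exp (- c * t)" by (simp add: initial_energy_def)
    show "0 \<le> (LINT s:{0..t}|lborel. exp (- c * (t - s)) * (h s + enn2real (q s)))"
      unfolding set_lebesgue_integral_def
      by (rule integral_nonneg_AE) (use c in \<open>simp add: h_def integral_nonneg_AE\<close>)
  qed
  also note add_left_mono[OF I]
  finally show ?thesis by (simp only: energy_def initial_energy_def shifted_velocity_def)
qed

end

section \<open>The energy estimate\<close>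

lemma dense_inner_eqI:
  fixes x y :: "'a::real_inner"
  assumes "subspace H" "H \<subseteq> closure V" "x \<in> H" "y \<in> H" "\<And>g. g \<in> V \<Longrightarrow> x \<bullet> g = y \<bullet> g"
  shows "x = y"
proof -
  have "V \<subseteq> {g. (x - y) \<bullet> g = 0}" using assms(5) by (auto simp: inner_diff_left)
  then have "closure V \<subseteq> {g. (x - y) \<bullet> g = 0}" by (rule closure_minimal) (rule closed_hyperplane)
  moreover have "x - y \<in> H" using assms by (intro subspace_diff)
  ultimately have "(x - y) \<bullet> (x - y) = 0" using assms(2) by blast
  then show ?thesis by simp
qed

text \<open>
  The difference of \<open>X t\<close> and the vector-valued integral is orthogonal to \<open>H\<close>, hence to both of them,
  as \<open>X\<close> and \<open>Y\<close> take values in \<open>H\<close>.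
\<close>

lemma weak_integral_imp_strong:
  fixes X Y :: "real \<Rightarrow> 'h::{real_inner, banach}"
  assumes Y: "continuous_on {0..} Y" and H: "H \<subseteq> closure V"
    and in_H: "\<And>t. 0 \<le> t \<Longrightarrow> X t \<in> H" "\<And>t. 0 \<le> t \<Longrightarrow> Y t \<in> H" "x0 \<in> H"
    and eq: "\<And>t g. 0 \<le> t \<Longrightarrow> g \<in> V \<Longrightarrow> X t \<bullet> g = x0 \<bullet> g + (LINT s:{0..t}|lborel. Y s \<bullet> g)"
    and t: "0 \<le> t"
  shows "X t = x0 + integral {0..t} Y"
    and "(X has_vector_derivative Y t) (at t within {0..})"
proof -
  define U where "U t = x0 + integral {0..t} Y" for t
  have cY: "continuous_on {0..t} Y" for t by (rule continuous_on_subset[OF Y]) auto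
  have U: "U t \<bullet> g = x0 \<bullet> g + (LINT s:{0..t}|lborel. Y s \<bullet> g)" for t g
  proof -
    have "integral {0..t} ((\<lambda>y. y \<bullet> g) \<circ> Y) = integral {0..t} Y \<bullet> g"
      by (rule integral_linear[OF integrable_continuous_real[OF cY] bounded_linear_inner_left])
    moreover have "set_integrable lborel {0..t} (\<lambda>s. Y s \<bullet> g)"
      by (intro borel_integrable_atLeastAtMost' continuous_intros cY)
    ultimately show ?thesis
      using set_borel_integral_eq_integral(2)[of "{0..t}" "\<lambda>s. Y s \<bullet> g"]
      by (simp add: U_def inner_add_left comp_def)
  qed
  have XU: "X t = U t" if t: "0 \<le> t" for t
  proof -
    define d where "d = X t - U t"
    have "V \<subseteq> {g. d \<bullet> g = 0}" using eq[OF t] U by (auto simp: d_def inner_diff_left)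
    then have "closure V \<subseteq> {g. d \<bullet> g = 0}" by (rule closure_minimal) (rule closed_hyperplane)
    then have dH: "d \<bullet> g = 0" if "g \<in> H" for g using H that by blast
    have "(LINT s:{0..t}|lborel. Y s \<bullet> d) = (LINT s:{0..t}|lborel. 0)"
      by (rule set_lebesgue_integral_cong) (auto simp: inner_commute[of _ d] dH in_H)
    then have "U t \<bullet> d = 0" using U[of t d] dH[OF in_H(3)] by (simp add: inner_commute)
    moreover have "X t \<bullet> d = 0" using dH[OF in_H(1)[OF t]] by (simp add: inner_commute)
    ultimately have "d \<bullet> d = 0" by (simp add: d_def inner_diff_left)
    then show ?thesis by (simp add: d_def)
  qed
  show "X t = x0 + integral {0..t} Y" using XU[OF t] by (simp add: U_def)
  have "((\<lambda>t. integral {0..t} Y) has_vector_derivative Y t) (at t within {0..t + 1})"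
    by (rule integral_has_vector_derivative[OF cY]) (use t in auto)
  then have "(U has_vector_derivative Y t) (at t within {0..t + 1})"
    unfolding U_def[abs_def] by (auto intro!: derivative_eq_intros)
  moreover have "at t within {0..t + 1} = at t within {0..}"
    by (rule at_within_nhd[of _ "{..<t + 1}"]) auto
  ultimately have "(U has_vector_derivative Y t) (at t within {0..})" by simp
  then show "(X has_vector_derivative Y t) (at t within {0..})"
    by (rule has_vector_derivative_transform[rotated 2]) (use t XU in auto)
qed

text \<open>
  The sections at time \<open>t\<close> of the generators of the predictable \<sigma>-algebra belong to \<open>F t\<close>.
\<close>

lemma (in filtered) predictable_imp_adapted:
  assumes X: "predictable P F X"
  shows "adapted F X"
  unfolding adapted_def
proof (intro allI impI)
  fix t :: real assume t: "0 \<le> t"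
  have in_space: "\<omega> \<in> space P" if "A \<in> sets (F s)" "\<omega> \<in> A" for A s \<omega>
    using sets.sets_into_space[OF that(1)] that(2) by (auto simp: space_filtration)
  have "Pair t \<in> measurable (F t) (predictable_sigma P F)"
    unfolding predictable_sigma_def
  proof (rule measurable_measure_of)
    show "{{0} \<times> A |A. A \<in> sets (F 0)} \<union> {{s<..t} \<times> A |s t A. 0 \<le> s \<and> s \<le> t \<and> A \<in> sets (F s)} \<subseteq> Pow ({0..} \<times> space P)"
      by (auto dest: in_space)
    show "Pair t \<in> space (F t) \<rightarrow> {0..} \<times> space P" using t by (auto simp: space_filtration)
    fix G assume "G \<in> {{0} \<times> A |A. A \<in> sets (F 0)} \<union> {{s<..t} \<times> A |s t A. 0 \<le> s \<and> s \<le> t \<and> A \<in> sets (F s)}"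
    then consider A where "G = {0} \<times> A" "A \<in> sets (F 0)"
      | s r A where "G = {s<..r} \<times> A" "A \<in> sets (F s)" by blast
    then obtain A I s where G: "G = I \<times> A" "A \<in> sets (F s)" "\<And>r. r \<in> I \<Longrightarrow> s \<le> r"
    proof cases
      case (1 A)
      then show ?thesis by (intro that[of "{0}" A 0]) auto
    next
      case (2 s r A)
      then show ?thesis by (intro that[of "{s<..r}" A s]) auto
    qed
    show "Pair t -` G \<inter> space (F t) \<in> sets (F t)"
    proof (cases "t \<in> I")
      case True
      then have "A \<in> sets (F t)" using G(2,3) filtration_mono[of s t] by blast
      moreover have "Pair t -` G \<inter> space (F t) = A" using True G(1) sets.sets_into_space[OF calculation] by auto
      ultimately show ?thesis by simp
    qed (simp add: G(1))
  qed
  from measurable_compose[OF this X[unfolded predictable_def]] show "X t \<in> borel_measurable (F t)" by simp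
qed

text \<open>
  This recovers \<open>u\<close> from \<open>B u\<close>: measurability and path continuity of a solution are given for \<open>B u\<close>.
\<close>

lemma lower_bounded_inverse:
  fixes B :: "'h::real_normed_vector \<Rightarrow> 'h"
  assumes V: "subspace V" and lin: "\<And>x y. x \<in> V \<Longrightarrow> y \<in> V \<Longrightarrow> B (x - y) = B x - B y"
    and \<eta>: "0 < \<eta>" "\<And>x. x \<in> V \<Longrightarrow> \<eta> * (norm x)\<^sup>2 \<le> (norm (B x))\<^sup>2"
  obtains G where "continuous_on (B ` V) G" "\<And>x. x \<in> V \<Longrightarrow> G (B x) = x"
proof -
  have le: "sqrt \<eta> * norm (x - y) \<le> norm (B x - B y)" if "x \<in> V" "y \<in> V" for x y
  proof (rule power2_le_imp_le)
    show "(sqrt \<eta> * norm (x - y))\<^sup>2 \<le> (norm (B x - B y))\<^sup>2"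
      using \<eta>(2)[OF subspace_diff[OF V that]] \<eta>(1) by (simp add: lin that power_mult_distrib)
  qed simp
  have "inj_on B V"
  proof (rule inj_onI)
    fix x y assume "x \<in> V" "y \<in> V" "B x = B y"
    then show "x = y" using le[of x y] \<eta>(1) by (simp add: mult_le_0_iff)
  qed
  then have inv: "inv_into V B (B x) = x" if "x \<in> V" for x using that by simp
  have "continuous_on (B ` V) (inv_into V B)"
    unfolding continuous_on_iff
  proof (intro ballI allI impI)
    fix a e assume a: "a \<in> B ` V" and e: "0 < (e::real)"
    show "\<exists>d>0. \<forall>a'\<in>B ` V. dist a' a < d \<longrightarrow> dist (inv_into V B a') (inv_into V B a) < e"
    proof (intro exI[of _ "sqrt \<eta> * e"] conjI ballI impI)
      show "0 < sqrt \<eta> * e" using \<eta>(1) e by simp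
      fix a' assume a': "a' \<in> B ` V" "dist a' a < sqrt \<eta> * e"
      obtain x x' where x: "x \<in> V" "a = B x" "x' \<in> V" "a' = B x'" using a a' by auto
      have "sqrt \<eta> * norm (x' - x) < sqrt \<eta> * e"
        using le[OF x(3,1)] a'(2) by (simp add: x dist_norm)
      then show "dist (inv_into V B a') (inv_into V B a) < e" using \<eta>(1) by (simp add: x inv dist_norm)
    qed
  qed
  then show thesis using inv by (rule that)
qed

text \<open>
  The energy estimate for the resolvent-regularized solution, with \<open>\<epsilon> = 1 / (n + 1)\<close>, is uniform in \<open>n\<close>;
  Fatou's lemma gives it for the solution itself.
\<close>

theorem lemma3p2:
  fixes D :: "(real^'n) set"
    and a :: "'n \<Rightarrow> 'n \<Rightarrow> real^'n \<Rightarrow> real" and b :: "real^'n \<Rightarrow> real"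
    and B :: "(real^'n) L2 \<Rightarrow> (real^'n) L2"
    and P :: "'w measure" and F :: "real \<Rightarrow> 'w measure"
    and f M u v :: "real \<Rightarrow> 'w \<Rightarrow> (real^'n) L2"
    and Q :: "real \<Rightarrow> 'w \<Rightarrow> (real^'n) L2 \<Rightarrow> (real^'n) L2"
    and u0 v0 :: "(real^'n) L2"
    and \<alpha> lam :: real
  assumes domain: "bounded_C2_domain D"
    and coefficients: "elliptic_coefficients D a b"
    and sqrt: "is_sqrt_on (L2_on D) (H2 D \<inter> H10 D) (\<lambda>u. - elliptic_op D a b u) (H10 D) B"
    and prob: "filtered_prob_space P F"
    and alpha: "0 < \<alpha>"
    and initial: "u0 \<in> H10 D" "v0 \<in> L2_on D"
    and f: "\<forall>t\<ge>0. \<forall>\<omega>\<in>space P. f t \<omega> \<in> L2_on D" "predictable P F f" "continuous_paths P f"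
    and M: "\<forall>t\<ge>0. \<forall>\<omega>\<in>space P. M t \<omega> \<in> L2_on D" "martingale P F M" "continuous_paths P M"
      "AE \<omega> in P. M 0 \<omega> = 0"
    and Q: "covariation_operator P F (L2_on D) M Q"
    and finite: "\<forall>T>0. (\<integral>\<^sup>+\<omega>. (\<integral>\<^sup>+s\<in>{0..T}. ennreal ((norm (f s \<omega>))\<^sup>2) \<partial>lborel)
                     + (\<integral>\<^sup>+s\<in>{0..T}. trace_on (L2_on D) (Q s \<omega>) \<partial>lborel) \<partial>P) < \<infinity>"
    and solution: "continuous_wave_solution P F D a b B \<alpha> f M u0 v0 u v"
    and lam: "0 < lam" "lam \<le> min (\<alpha> / 2) (eta1 D B / (4 * \<alpha>))"
  shows "\<exists>\<alpha>1. 0 < \<alpha>1 \<and> \<alpha>1 < lam \<and>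
    (\<forall>t\<ge>0. (\<integral>\<^sup>+\<omega>. ennreal (pseudo_energy B lam (u t \<omega>, v t \<omega>)) \<partial>P)
       \<le> ennreal (pseudo_energy B lam (u0, v0) * exp (- \<alpha>1 * t))
         + (\<integral>\<^sup>+s\<in>{0..t}. ennreal (exp (- \<alpha>1 * (t - s)))
              * (\<integral>\<^sup>+\<omega>. ennreal (2 / \<alpha>1 * (norm (f s \<omega>))\<^sup>2) + trace_on (L2_on D) (Q s \<omega>) \<partial>P) \<partial>lborel))"
proof -
  let ?H = "L2_on D" and ?V = "H10 D"
  have D: "open D" "bounded D" using domain by (auto simp: bounded_C2_domain_def)
  then have Dm: "D \<in> sets borel" by simp
  note Hc = closed_L2_on[OF Dm] and Hs = subspace_L2_on[OF Dm]
  have sa: "selfadjoint_on ?H ?V B" using sqrt by (simp add: is_sqrt_on_def)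
  interpret CS: closed_selfadjoint ?H ?V B by unfold_locales (rule sa, rule Hc, rule Hs)
  interpret Pr: filtered P F
    unfolding filtered_def filtered_axioms_def using prob by (simp add: filtered_prob_space_def)
  define \<eta> where "\<eta> = eta1 D B"
  have lam_le: "lam \<le> \<alpha> / 2" "4 * \<alpha> * lam \<le> \<eta>"
    using lam(2) alpha by (auto simp: \<eta>_def field_simps)
  \<comment> \<open>The positivity of the spectral gap is hidden in that of \<open>lam\<close>.\<close>
  have \<eta>: "0 < \<eta>" using lam_le(2) lam(1) alpha mult_pos_pos[of "4 * \<alpha>" lam] by linarith
  have gap: "\<eta> * (norm x)\<^sup>2 \<le> (norm (B x))\<^sup>2" if x: "x \<in> ?V" for x
  proof (cases "x = 0")
    case False
    have "\<eta> \<le> (norm (B x))\<^sup>2 / (norm x)\<^sup>2"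
      unfolding \<eta>_def eta1_def using x False by (intro cInf_lower bdd_belowI[of _ 0]) auto
    then show ?thesis using False by (simp add: pos_le_divide_eq)
  qed simp
  \<comment> \<open>\<open>G\<close> is the inverse of \<open>B\<close>; it turns the measurability and continuity of \<open>B u\<close> into that of \<open>u\<close>.\<close>
  obtain G where G: "continuous_on (B ` ?V) G" "\<And>x. x \<in> ?V \<Longrightarrow> G (B x) = x"
    by (rule lower_bounded_inverse[OF CS.subspace_V CS.B_diff \<eta> gap]) (assumption | rule that)+
  have uv: "u t \<omega> \<in> ?V" "v t \<omega> \<in> ?H" if "0 \<le> t" "\<omega> \<in> space P" for t \<omega>
    using solution that by (auto simp: continuous_wave_solution_def)
  have uH: "u t \<omega> \<in> ?H" if "0 \<le> t" "\<omega> \<in> space P" for t \<omega> using uv(1)[OF that] CS.V_le_H by blast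
  have emb: "adapted F (\<lambda>t \<omega>. (B (u t \<omega>), v t \<omega>))" "continuous_paths P (\<lambda>t \<omega>. (B (u t \<omega>), v t \<omega>))"
    using solution by (auto simp: continuous_wave_solution_def energy_embedding_def)
  have v_ad: "v t \<in> borel_measurable (F t)" and Bu_ad: "(\<lambda>\<omega>. B (u t \<omega>)) \<in> borel_measurable (F t)" if t: "0 \<le> t" for t
  proof -
    have e: "(\<lambda>\<omega>. (B (u t \<omega>), v t \<omega>)) \<in> borel_measurable (F t)" using emb(1) t by (simp add: adapted_def)
    have "snd \<in> borel_measurable borel" "fst \<in> borel_measurable borel"
      by (intro borel_measurable_continuous_onI continuous_intros)+
    from this[THEN measurable_compose[OF e]]
    show "v t \<in> borel_measurable (F t)" "(\<lambda>\<omega>. B (u t \<omega>)) \<in> borel_measurable (F t)" by simp_all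
  qed
  have u_ad: "u t \<in> borel_measurable (F t)" if t: "0 \<le> t" for t
  proof -
    have "(\<lambda>\<omega>. B (u t \<omega>)) \<in> measurable (F t) (restrict_space borel (B ` ?V))"
      using uv(1)[OF t] by (intro measurable_restrict_space2 Bu_ad t) (auto simp: Pr.space_filtration)
    from measurable_compose[OF this borel_measurable_continuous_on_restrict[OF G(1)]]
    have "(\<lambda>\<omega>. G (B (u t \<omega>))) \<in> borel_measurable (F t)" .
    then show ?thesis
      by (rule measurable_cong[THEN iffD1, rotated]) (use uv(1)[OF t] G(2) in \<open>auto simp: Pr.space_filtration\<close>)
  qed
  have f_ad: "f t \<in> borel_measurable (F t)" if "0 \<le> t" for t
    using Pr.predictable_imp_adapted[OF f(2)] that by (simp add: adapted_def)
  have M_ad: "M t \<in> borel_measurable (F t)" if "0 \<le> t" for t using Pr.martingaleD(1)[OF M(2) that] .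
  have v_c: "continuous_paths P v" and u_c: "continuous_paths P u"
  proof -
    have "AE \<omega> in P. continuous_on {0..} (\<lambda>t. v t \<omega>) \<and> continuous_on {0..} (\<lambda>t. u t \<omega>)"
      using emb(2)[unfolded continuous_paths_def] AE_space
    proof eventually_elim
      case (elim \<omega>)
      have c: "continuous_on {0..} (\<lambda>t. B (u t \<omega>))" using continuous_on_fst[OF elim(1)] by simp
      have "continuous_on {0..} (\<lambda>t. G (B (u t \<omega>)))"
        by (rule continuous_on_compose2[OF G(1) c]) (use uv(1) elim(2) in auto)
      then have "continuous_on {0..} (\<lambda>t. u t \<omega>)"
        by (rule continuous_on_cong[THEN iffD1, rotated 2]) (use uv(1) elim(2) G(2) in auto)
      then show ?case using continuous_on_snd[OF elim(1)] by simp
    qed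
    then show "continuous_paths P v" "continuous_paths P u"
      unfolding continuous_paths_def by (auto elim: eventually_mono)
  qed
  have AE_sol: "AE \<omega> in P. \<forall>t\<ge>0.
        (\<forall>\<phi>\<in>test_functions D. u t \<omega> \<bullet> to_L2 \<phi> = u0 \<bullet> to_L2 \<phi> + (LINT s:{0..t}|lborel. v s \<omega> \<bullet> to_L2 \<phi>)) \<and>
        (\<forall>g\<in>?V. v t \<omega> \<bullet> g = v0 \<bullet> g + (LINT s:{0..t}|lborel. elliptic_pairing D a b (u s \<omega>) g)
             - 2 * \<alpha> * (LINT s:{0..t}|lborel. v s \<omega> \<bullet> g) + (LINT s:{0..t}|lborel. f s \<omega> \<bullet> g) + M t \<omega> \<bullet> g)"
    using solution unfolding continuous_wave_solution_def by blast
  have u0H: "u0 \<in> ?H" using initial(1) CS.V_le_H by blast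
  have u_eq: "AE \<omega> in P. u 0 \<omega> = u0 \<and>
      (\<forall>t\<ge>0. ((\<lambda>s. u s \<omega>) has_vector_derivative v t \<omega>) (at t within {0..}))"
    using AE_sol v_c[unfolded continuous_paths_def] AE_space
  proof eventually_elim
    case (elim \<omega>)
    have eq: "u t \<omega> \<bullet> g = u0 \<bullet> g + (LINT s:{0..t}|lborel. v s \<omega> \<bullet> g)"
      if "0 \<le> t" "g \<in> to_L2 ` test_functions D" for t g
      using elim(1) that by blast
    note W = weak_integral_imp_strong[OF elim(2) test_functions_dense[OF sa] uH[OF _ elim(3)] uv(2)[OF _ elim(3)] u0H eq]
    have "u 0 \<omega> = u0 + integral {0..0} (\<lambda>s. v s \<omega>)" by (rule W(1)) auto
    then show ?case using W(2) by simp
  qed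
  have v_init: "AE \<omega> in P. v 0 \<omega> = v0"
    using AE_sol M(4) AE_space
  proof eventually_elim
    case (elim \<omega>)
    show ?case
    proof (rule dense_inner_eqI[OF Hs CS.dense_V uv(2)[OF order_refl elim(3)] initial(2)])
      fix g assume "g \<in> ?V"
      then have "v 0 \<omega> \<bullet> g = v0 \<bullet> g + (LINT s:{0..0}|lborel. elliptic_pairing D a b (u s \<omega>) g)
             - 2 * \<alpha> * (LINT s:{0..0}|lborel. v s \<omega> \<bullet> g) + (LINT s:{0..0}|lborel. f s \<omega> \<bullet> g) + M 0 \<omega> \<bullet> g"
        using elim(1) by blast
      then show "v 0 \<omega> \<bullet> g = v0 \<bullet> g" by (simp only: set_integral_point elim(2)) simp
    qed
  qed
  \<comment> \<open>Modifications with continuous paths, to which Fubini's theorem applies.\<close>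
  obtain u' where u': "\<And>\<omega>. continuous_on UNIV (\<lambda>t. u' t \<omega>)" "(\<lambda>(t, \<omega>). u' t \<omega>) \<in> borel_measurable (borel \<Otimes>\<^sub>M P)"
    "AE \<omega> in P. \<forall>t\<ge>0. u' t \<omega> = u t \<omega>"
    by (rule continuous_modification[OF Pr.filtration_measurable_P[OF u_ad] u_c]) (assumption | rule that)+
  obtain v' where v': "\<And>\<omega>. continuous_on UNIV (\<lambda>t. v' t \<omega>)" "(\<lambda>(t, \<omega>). v' t \<omega>) \<in> borel_measurable (borel \<Otimes>\<^sub>M P)"
    "AE \<omega> in P. \<forall>t\<ge>0. v' t \<omega> = v t \<omega>"
    by (rule continuous_modification[OF Pr.filtration_measurable_P[OF v_ad] v_c]) (assumption | rule that)+
  obtain f' where f': "\<And>\<omega>. continuous_on UNIV (\<lambda>t. f' t \<omega>)" "(\<lambda>(t, \<omega>). f' t \<omega>) \<in> borel_measurable (borel \<Otimes>\<^sub>M P)"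
    "AE \<omega> in P. \<forall>t\<ge>0. f' t \<omega> = f t \<omega>"
    by (rule continuous_modification[OF Pr.filtration_measurable_P[OF f_ad] f(3)]) (assumption | rule that)+
  obtain M' where M': "\<And>\<omega>. continuous_on UNIV (\<lambda>t. M' t \<omega>)" "(\<lambda>(t, \<omega>). M' t \<omega>) \<in> borel_measurable (borel \<Otimes>\<^sub>M P)"
    "AE \<omega> in P. \<forall>t\<ge>0. M' t \<omega> = M t \<omega>"
    by (rule continuous_modification[OF Pr.filtration_measurable_P[OF M_ad] M(3)]) (assumption | rule that)+
  have pointwise: "AE \<omega> in P. X' t \<omega> = X t \<omega>" if "AE \<omega> in P. \<forall>t\<ge>0. X' t \<omega> = X t \<omega>" "0 \<le> t"
    for X X' :: "real \<Rightarrow> 'w \<Rightarrow> (real^'n) L2" and t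
    using that(1) by eventually_elim (use that(2) in blast)
  let ?tr = "\<lambda>s \<omega>. trace_on ?H (Q s \<omega>)"
  \<comment> \<open>At \<open>t = 0\<close> the hypothesis says nothing, whence the passage to \<open>t + 1\<close>.\<close>
  have split_finite: "(\<integral>\<^sup>+\<omega>. (\<integral>\<^sup>+s\<in>{0..t}. ennreal ((norm (f s \<omega>))\<^sup>2) \<partial>lborel) \<partial>P) < \<infinity>"
    "(\<integral>\<^sup>+\<omega>. (\<integral>\<^sup>+s\<in>{0..t}. ?tr s \<omega> \<partial>lborel) \<partial>P) < \<infinity>" if t: "0 \<le> t" for t
  proof -
    have le: "(\<integral>\<^sup>+s\<in>{0..t}. g s \<partial>lborel) \<le> (\<integral>\<^sup>+s\<in>{0..t + 1}. g s \<partial>lborel)" for g :: "real \<Rightarrow> ennreal"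
      by (intro nn_integral_mono mult_left_mono) (auto simp: indicator_def)
    have fin: "(\<integral>\<^sup>+\<omega>. (\<integral>\<^sup>+s\<in>{0..t + 1}. ennreal ((norm (f s \<omega>))\<^sup>2) \<partial>lborel)
                     + (\<integral>\<^sup>+s\<in>{0..t + 1}. ?tr s \<omega> \<partial>lborel) \<partial>P) < \<infinity>"
      using finite t by simp
    show "(\<integral>\<^sup>+\<omega>. (\<integral>\<^sup>+s\<in>{0..t}. ennreal ((norm (f s \<omega>))\<^sup>2) \<partial>lborel) \<partial>P) < \<infinity>"
      by (rule le_less_trans[OF nn_integral_mono fin]) (intro add_increasing2 le, simp)
    show "(\<integral>\<^sup>+\<omega>. (\<integral>\<^sup>+s\<in>{0..t}. ?tr s \<omega> \<partial>lborel) \<partial>P) < \<infinity>"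
      by (rule le_less_trans[OF nn_integral_mono fin]) (intro add_increasing le, simp)
  qed
  have M_in_H: "M t \<omega> \<in> ?H" if "0 \<le> t" "\<omega> \<in> space P" for t \<omega> using M(1) that by blast
  note C = Pr.covariation_second_moment[OF M(2,3,4) M_in_H Q Hs Hc split_finite(2)]
  have trm: "(\<lambda>(s, \<omega>). ?tr (max 0 s) \<omega>) \<in> borel_measurable (borel \<Otimes>\<^sub>M P)"
    by (rule C(1))
  have M2: "(\<integral>\<^sup>+\<omega>. ennreal ((norm (M t \<omega>))\<^sup>2) \<partial>P) = (\<integral>\<^sup>+s\<in>{0..t}. (\<integral>\<^sup>+\<omega>. ?tr s \<omega> \<partial>P) \<partial>lborel)"
    if "0 \<le> t" for t
    by (rule C(2)) (use that in auto)
  define q where "q s = (\<integral>\<^sup>+\<omega>. ?tr (max 0 s) \<omega> \<partial>P)" for s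
  have trm': "(\<lambda>x. ?tr (max 0 (fst x)) (snd x)) \<in> borel_measurable (borel \<Otimes>\<^sub>M P)"
    using trm by (simp add: split_beta)
  have qm: "q \<in> borel_measurable borel"
    unfolding q_def[abs_def] using trm by (rule Pr.borel_measurable_nn_integral)
  have q_eq: "(\<integral>\<^sup>+s\<in>{0..t}. q s \<partial>lborel) = (\<integral>\<^sup>+s\<in>{0..t}. (\<integral>\<^sup>+\<omega>. ?tr s \<omega> \<partial>P) \<partial>lborel)" for t
    by (intro nn_integral_cong) (auto simp: q_def indicator_def max_def)
  have q_fin: "(\<integral>\<^sup>+s\<in>{0..t}. q s \<partial>lborel) < \<infinity>" if t: "0 \<le> t" for t
  proof -
    have "(\<integral>\<^sup>+s\<in>{0..t}. q s \<partial>lborel) = (\<integral>\<^sup>+\<omega>. (\<integral>\<^sup>+s\<in>{0..t}. ?tr (max 0 s) \<omega> \<partial>lborel) \<partial>P)"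
      unfolding q_def by (rule Pr.time_swap[OF trm', symmetric])
    also have "\<dots> = (\<integral>\<^sup>+\<omega>. (\<integral>\<^sup>+s\<in>{0..t}. ?tr s \<omega> \<partial>lborel) \<partial>P)"
      by (intro nn_integral_cong) (auto simp: indicator_def max_def)
    finally show ?thesis using split_finite(2)[OF t] by simp
  qed
  define c where "c = lam / 2"
  define I where "I t = (\<integral>\<^sup>+s\<in>{0..t}. ennreal (exp (- c * (t - s)))
          * ((\<integral>\<^sup>+\<omega>. ennreal (2 / c * (norm (f' s \<omega>))\<^sup>2) \<partial>P) + q s) \<partial>lborel)" for t
  have I_eq: "I t = (\<integral>\<^sup>+s\<in>{0..t}. ennreal (exp (- c * (t - s)))
              * (\<integral>\<^sup>+\<omega>. ennreal (2 / c * (norm (f s \<omega>))\<^sup>2) + ?tr s \<omega> \<partial>P) \<partial>lborel)" for t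
    unfolding I_def
  proof (rule nn_integral_cong)
    fix s
    have "(\<integral>\<^sup>+\<omega>. ennreal (2 / c * (norm (f' s \<omega>))\<^sup>2) \<partial>P) + q s
        = (\<integral>\<^sup>+\<omega>. ennreal (2 / c * (norm (f s \<omega>))\<^sup>2) + ?tr s \<omega> \<partial>P)" if s: "0 \<le> s"
    proof -
      have [measurable]: "f s \<in> borel_measurable P" by (rule Pr.filtration_measurable_P[OF f_ad[OF s]])
      have [measurable]: "?tr s \<in> borel_measurable P"
        using Pr.slice_measurable[OF trm', of s] s by simp
      have "(\<integral>\<^sup>+\<omega>. ennreal (2 / c * (norm (f' s \<omega>))\<^sup>2) \<partial>P) = (\<integral>\<^sup>+\<omega>. ennreal (2 / c * (norm (f s \<omega>))\<^sup>2) \<partial>P)"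
        using pointwise[OF f'(3) s] by (intro nn_integral_cong_AE) (auto elim: eventually_mono)
      then show ?thesis using s by (simp add: q_def nn_integral_add)
    qed
    then show "ennreal (exp (- c * (t - s))) * ((\<integral>\<^sup>+\<omega>. ennreal (2 / c * (norm (f' s \<omega>))\<^sup>2) \<partial>P) + q s) * indicator {0..t} s
      = ennreal (exp (- c * (t - s))) * (\<integral>\<^sup>+\<omega>. ennreal (2 / c * (norm (f s \<omega>))\<^sup>2) + ?tr s \<omega> \<partial>P) * indicator {0..t} s"
      by (auto simp: indicator_def)
  qed
  let ?R = "\<lambda>n::nat. resolvent ?V B (1 / Suc n)"
  \<comment> \<open>Uniformity in \<open>n\<close> is what Fatou's lemma needs below.\<close>
  have reg: "(\<integral>\<^sup>+\<omega>. ennreal ((norm (B (?R n (u' t \<omega>))))\<^sup>2 + (norm (?R n (v' t \<omega>) + lam *\<^sub>R ?R n (u' t \<omega>)))\<^sup>2) \<partial>P)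
      \<le> ennreal (pseudo_energy B lam (u0, v0) * exp (- c * t)) + I t" if t: "0 \<le> t" for n t
  proof -
    define \<epsilon> where "\<epsilon> = 1 / real (Suc n)"
    have e: "0 < \<epsilon>" by (simp add: \<epsilon>_def)
    define R where "R = resolvent ?V B \<epsilon>"
    define S where "S h = B (R h)" for h
    define K where "K h = (1 / \<epsilon>) *\<^sub>R (h - R h)" for h
    have blR: "bounded_linear R" unfolding R_def by (rule CS.bounded_linear_resolvent[OF e])
    have blS: "bounded_linear S" unfolding S_def R_def by (rule CS.bounded_linear_B_resolvent[OF e])
    have blK: "bounded_linear K"
      unfolding K_def by (intro bounded_linear_const_scaleR bounded_linear_sub bounded_linear_ident blR)
    have RV: "R h \<in> ?V" for h unfolding R_def by (rule CS.resolvent_in_V[OF e])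
    have weak: "B (R h) \<bullet> B g = K h \<bullet> g" if "g \<in> ?V" for g h
      using CS.resolvent_weak[OF e that, of h] e by (simp add: K_def R_def inner_diff_left field_simps)
    have Rsym: "R h \<bullet> k = h \<bullet> R k" for h k unfolding R_def by (rule CS.resolvent_sym[OF e])
    have Rn: "norm (R h) \<le> norm h" for h unfolding R_def by (rule CS.norm_resolvent_le[OF e])
    have Ksym: "K h \<bullet> k = h \<bullet> K k" for h k by (simp add: K_def inner_diff_left inner_diff_right Rsym)
    \<comment> \<open>Testing the velocity equation with \<open>R g\<close>, which lies in the domain of \<open>B\<^sup>2\<close>, turns the pairing
      with \<open>A u\<close> into \<open>- (K u, g)\<close> and makes it an equation in \<open>H\<close>.\<close>
    have v_eq: "AE \<omega> in P. \<forall>t\<ge>0. ((\<lambda>s. R (v s \<omega>) - R (M s \<omega>)) has_vector_derivative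
      - K (u t \<omega>) - (2 * \<alpha>) *\<^sub>R R (v t \<omega>) + R (f t \<omega>)) (at t within {0..})"
      using AE_sol u_c[unfolded continuous_paths_def] v_c[unfolded continuous_paths_def]
        f(3)[unfolded continuous_paths_def] AE_space
    proof eventually_elim
      case (elim \<omega>)
      let ?X = "\<lambda>s. R (v s \<omega>) - R (M s \<omega>)"
      let ?Y = "\<lambda>t. - K (u t \<omega>) - (2 * \<alpha>) *\<^sub>R R (v t \<omega>) + R (f t \<omega>)"
      have RH: "R h \<in> ?H" for h using RV CS.V_le_H by blast
      have KH: "K h \<in> ?H" if "h \<in> ?H" for h
        unfolding K_def using that RH by (intro subspace_scale subspace_diff Hs)
      have cu: "continuous_on {0..} (\<lambda>t. K (u t \<omega>))" and cv: "continuous_on {0..} (\<lambda>t. R (v t \<omega>))"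
        and cf: "continuous_on {0..} (\<lambda>t. R (f t \<omega>))"
        by (rule bounded_linear.continuous_on[OF blK elim(2)] bounded_linear.continuous_on[OF blR elim(3)]
            bounded_linear.continuous_on[OF blR elim(4)])+
      have Yc: "continuous_on {0..} ?Y" by (intro continuous_intros cu cv cf)
      have XH: "?X t \<in> ?H" for t by (intro subspace_diff Hs RH)
      have YH: "?Y t \<in> ?H" if "0 \<le> t" for t
        using uH[OF that elim(5)] by (intro subspace_add subspace_diff subspace_scale subspace_neg Hs RH KH)
      have eq: "?X t \<bullet> g = R v0 \<bullet> g + (LINT s:{0..t}|lborel. ?Y s \<bullet> g)" if t: "0 \<le> t" and g: "g \<in> ?H" for t g
      proof -
        have BR: "B (R g) \<in> ?V" unfolding R_def by (rule CS.B_resolvent_eq(1)[OF e g])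
        have pair: "elliptic_pairing D a b (u s \<omega>) (R g) = - (K (u s \<omega>) \<bullet> g)" if "0 \<le> s" for s
        proof -
          have "elliptic_pairing D a b (u s \<omega>) (R g) = - (B (u s \<omega>) \<bullet> B (R g))"
            by (rule elliptic_pairing_eq_sqrt[OF D coefficients sqrt uv(1)[OF that elim(5)] RV BR])
          also have "B (u s \<omega>) \<bullet> B (R g) = K g \<bullet> u s \<omega>"
            using weak[OF uv(1)[OF that elim(5)], of g] by (simp add: inner_commute)
          finally show ?thesis by (simp add: Ksym inner_commute)
        qed
        have i: "set_integrable lborel {0..t} (\<lambda>s. - (K (u s \<omega>) \<bullet> g))" "set_integrable lborel {0..t} (\<lambda>s. R (v s \<omega>) \<bullet> g)"
          "set_integrable lborel {0..t} (\<lambda>s. R (f s \<omega>) \<bullet> g)"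
          by (intro borel_integrable_atLeastAtMost' continuous_intros continuous_on_subset[OF cu]
              continuous_on_subset[OF cv] continuous_on_subset[OF cf]; auto)+
        have i2: "set_integrable lborel {0..t} (\<lambda>s. 2 * \<alpha> * (R (v s \<omega>) \<bullet> g))"
          using i(2) by (rule set_integrable_mult_right)
        have "v t \<omega> \<bullet> R g = v0 \<bullet> R g + (LINT s:{0..t}|lborel. elliptic_pairing D a b (u s \<omega>) (R g))
             - 2 * \<alpha> * (LINT s:{0..t}|lborel. v s \<omega> \<bullet> R g) + (LINT s:{0..t}|lborel. f s \<omega> \<bullet> R g) + M t \<omega> \<bullet> R g"
          using elim(1) t RV by blast
        moreover have "(LINT s:{0..t}|lborel. elliptic_pairing D a b (u s \<omega>) (R g)) = (LINT s:{0..t}|lborel. - (K (u s \<omega>) \<bullet> g))"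
          by (rule set_lebesgue_integral_cong) (auto simp: pair)
        ultimately have "?X t \<bullet> g = R v0 \<bullet> g + (LINT s:{0..t}|lborel. - (K (u s \<omega>) \<bullet> g))
             - 2 * \<alpha> * (LINT s:{0..t}|lborel. R (v s \<omega>) \<bullet> g) + (LINT s:{0..t}|lborel. R (f s \<omega>) \<bullet> g)"
          by (simp add: inner_diff_left Rsym)
        also have "\<dots> = R v0 \<bullet> g + (LINT s:{0..t}|lborel. - (K (u s \<omega>) \<bullet> g) - 2 * \<alpha> * (R (v s \<omega>) \<bullet> g) + R (f s \<omega>) \<bullet> g)"
          by (simp only: set_integral_add(2)[OF set_integral_diff(1)[OF i(1) i2] i(3)]
              set_integral_diff(2)[OF i(1) i2] set_integral_mult_right)
        finally show ?thesis by (simp add: inner_add_left inner_diff_left)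
      qed
      show ?case
        by (intro allI impI weak_integral_imp_strong(2)[OF Yc closure_subset XH YH RH eq])
    qed
    have RW: "regularized_wave R S K \<alpha> lam \<eta>"
    proof (rule regularized_wave.intro)
      show "S x \<bullet> S y = K x \<bullet> R y" for x y unfolding S_def by (rule weak[OF RV])
      show "\<eta> * (norm (R x))\<^sup>2 \<le> (norm (S x))\<^sup>2" for x unfolding S_def by (rule gap[OF RV])
    qed (fact blR blS blK Rn alpha lam(1) lam_le)+
    interpret W: regularized_stochastic_wave R S K \<alpha> lam \<eta> P F u' v' f' M' M u0 v0 q
    proof (intro regularized_stochastic_wave.intro regularized_stochastic_wave_axioms.intro RW Pr.filtered_axioms)
      show "\<exists>Y\<in>borel_measurable (F t). AE \<omega> in P. u' t \<omega> = Y \<omega>" if "0 \<le> t" for t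
        using u_ad[OF that] pointwise[OF u'(3) that] by blast
      show "\<exists>Y\<in>borel_measurable (F t). AE \<omega> in P. v' t \<omega> = Y \<omega>" if "0 \<le> t" for t
        using v_ad[OF that] pointwise[OF v'(3) that] by blast
      show "\<exists>Y\<in>borel_measurable (F t). AE \<omega> in P. f' t \<omega> = Y \<omega>" if "0 \<le> t" for t
        using f_ad[OF that] pointwise[OF f'(3) that] by blast
      show "AE \<omega> in P. M' 0 \<omega> = 0" using pointwise[OF M'(3) order_refl] M(4) by eventually_elim simp
      show "AE \<omega> in P. u' 0 \<omega> = u0" using pointwise[OF u'(3) order_refl] u_eq by eventually_elim simp
      show "AE \<omega> in P. v' 0 \<omega> = v0" using pointwise[OF v'(3) order_refl] v_init by eventually_elim simp
      show "AE \<omega> in P. \<forall>t\<ge>0. ((\<lambda>s. u' s \<omega>) has_vector_derivative v' t \<omega>) (at t within {0..})"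
        using u_eq u'(3) v'(3)
      proof eventually_elim
        case (elim \<omega>)
        show ?case
        proof (intro allI impI)
          fix t :: real assume t: "0 \<le> t"
          have "((\<lambda>s. u s \<omega>) has_vector_derivative v' t \<omega>) (at t within {0..})" using elim t by simp
          then show "((\<lambda>s. u' s \<omega>) has_vector_derivative v' t \<omega>) (at t within {0..})"
            by (rule has_vector_derivative_transform[rotated 2]) (use elim t in auto)
        qed
      qed
      show "AE \<omega> in P. \<forall>t\<ge>0. ((\<lambda>s. R (v' s \<omega>) - R (M' s \<omega>)) has_vector_derivative
        - K (u' t \<omega>) - (2 * \<alpha>) *\<^sub>R R (v' t \<omega>) + R (f' t \<omega>)) (at t within {0..})"
        using v_eq u'(3) v'(3) f'(3) M'(3)
      proof eventually_elim
        case (elim \<omega>)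
        show ?case
        proof (intro allI impI)
          fix t :: real assume t: "0 \<le> t"
          have "((\<lambda>s. R (v s \<omega>) - R (M s \<omega>)) has_vector_derivative
            - K (u' t \<omega>) - (2 * \<alpha>) *\<^sub>R R (v' t \<omega>) + R (f' t \<omega>)) (at t within {0..})" using elim t by simp
          then show "((\<lambda>s. R (v' s \<omega>) - R (M' s \<omega>)) has_vector_derivative
            - K (u' t \<omega>) - (2 * \<alpha>) *\<^sub>R R (v' t \<omega>) + R (f' t \<omega>)) (at t within {0..})"
            by (rule has_vector_derivative_transform[rotated 2]) (use elim t in auto)
        qed
      qed
      show "(\<integral>\<^sup>+\<omega>. ennreal ((norm (M' t \<omega>))\<^sup>2) \<partial>P) = (\<integral>\<^sup>+s\<in>{0..t}. q s \<partial>lborel)" if t: "0 \<le> t" for t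
      proof -
        have "(\<integral>\<^sup>+\<omega>. ennreal ((norm (M' t \<omega>))\<^sup>2) \<partial>P) = (\<integral>\<^sup>+\<omega>. ennreal ((norm (M t \<omega>))\<^sup>2) \<partial>P)"
          using pointwise[OF M'(3) t] by (intro nn_integral_cong_AE) (auto elim: eventually_mono)
        then show ?thesis using M2[OF t] q_eq[of t] by simp
      qed
      show "(\<integral>\<^sup>+\<omega>. (\<integral>\<^sup>+s\<in>{0..t}. ennreal ((norm (f' s \<omega>))\<^sup>2) \<partial>lborel) \<partial>P) < \<infinity>" if t: "0 \<le> t" for t
      proof -
        have "(\<integral>\<^sup>+\<omega>. (\<integral>\<^sup>+s\<in>{0..t}. ennreal ((norm (f' s \<omega>))\<^sup>2) \<partial>lborel) \<partial>P)
            = (\<integral>\<^sup>+\<omega>. (\<integral>\<^sup>+s\<in>{0..t}. ennreal ((norm (f s \<omega>))\<^sup>2) \<partial>lborel) \<partial>P)"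
        proof (rule nn_integral_cong_AE)
          show "AE \<omega> in P. (\<integral>\<^sup>+s\<in>{0..t}. ennreal ((norm (f' s \<omega>))\<^sup>2) \<partial>lborel)
              = (\<integral>\<^sup>+s\<in>{0..t}. ennreal ((norm (f s \<omega>))\<^sup>2) \<partial>lborel)"
            using f'(3) by eventually_elim (intro nn_integral_cong, auto simp: indicator_def)
        qed
        then show ?thesis using split_finite(1)[OF t] by simp
      qed
      show "AE \<omega> in P. \<forall>t\<ge>0. M' t \<omega> = M t \<omega>" by (rule M'(3))
    qed (fact u' v' f' M' M(2) qm q_fin)+
    \<comment> \<open>As \<open>R\<close> is a contraction commuting with \<open>B\<close>, it does not increase the initial energy.\<close>
    have "(norm (S u0))\<^sup>2 + (norm (R v0 + lam *\<^sub>R R u0))\<^sup>2 \<le> pseudo_energy B lam (u0, v0)"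
    proof -
      have "S u0 = R (B u0)" unfolding S_def R_def by (rule CS.resolvent_B_commute[OF e initial(1)])
      moreover have "R v0 + lam *\<^sub>R R u0 = R (v0 + lam *\<^sub>R u0)"
        using linear_add[OF bounded_linear.linear[OF blR]] linear_scale[OF bounded_linear.linear[OF blR]] by simp
      ultimately show ?thesis by (simp add: pseudo_energy_def Rn add_mono power_mono)
    qed
    then have "ennreal (((norm (S u0))\<^sup>2 + (norm (R v0 + lam *\<^sub>R R u0))\<^sup>2) * exp (- c * t))
        \<le> ennreal (pseudo_energy B lam (u0, v0) * exp (- c * t))"
      by (intro ennreal_leI mult_right_mono) auto
    with W.regularized_energy_estimate[OF t] show ?thesis
      unfolding c_def[symmetric] I_def[symmetric] S_def R_def \<epsilon>_def
      by (meson add_right_mono order_trans)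
  qed
  have main: "(\<integral>\<^sup>+\<omega>. ennreal (pseudo_energy B lam (u t \<omega>, v t \<omega>)) \<partial>P)
      \<le> ennreal (pseudo_energy B lam (u0, v0) * exp (- c * t)) + I t" if t: "0 \<le> t" for t
  proof -
    let ?E = "\<lambda>n \<omega>. ennreal ((norm (B (?R n (u' t \<omega>))))\<^sup>2 + (norm (?R n (v' t \<omega>) + lam *\<^sub>R ?R n (u' t \<omega>)))\<^sup>2)"
    have Em: "?E n \<in> borel_measurable P" for n
    proof -
      have e: "0 < 1 / real (Suc n)" by simp
      have [measurable]: "?R n \<in> borel_measurable borel" "(\<lambda>h. B (?R n h)) \<in> borel_measurable borel"
        by (intro borel_measurable_continuous_onI linear_continuous_on CS.bounded_linear_resolvent[OF e]
            CS.bounded_linear_B_resolvent[OF e])+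
      have [measurable]: "u' t \<in> borel_measurable P" "v' t \<in> borel_measurable P"
        using Pr.slice_measurable[of u' t] Pr.slice_measurable[of v' t] u'(2) v'(2) by (simp_all add: split_beta)
      have [measurable]: "(\<lambda>\<omega>. B (?R n (u' t \<omega>))) \<in> borel_measurable P"
        by (rule measurable_compose[of "u' t" P borel "\<lambda>h. B (?R n h)"]) measurable
      show ?thesis by measurable
    qed
    have "(\<integral>\<^sup>+\<omega>. ennreal (pseudo_energy B lam (u t \<omega>, v t \<omega>)) \<partial>P) = (\<integral>\<^sup>+\<omega>. liminf (\<lambda>n. ?E n \<omega>) \<partial>P)"
    proof (rule nn_integral_cong_AE)
      show "AE \<omega> in P. ennreal (pseudo_energy B lam (u t \<omega>, v t \<omega>)) = liminf (\<lambda>n. ?E n \<omega>)"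
        using pointwise[OF u'(3) t] pointwise[OF v'(3) t] AE_space
      proof eventually_elim
        case (elim \<omega>)
        note uV = uv(1)[OF t elim(3)]
        have comm: "B (?R n (u t \<omega>)) = ?R n (B (u t \<omega>))" for n
          by (rule CS.resolvent_B_commute[OF _ uV]) simp
        have "(\<lambda>n. ennreal ((norm (?R n (B (u t \<omega>))))\<^sup>2 + (norm (?R n (v t \<omega>) + lam *\<^sub>R ?R n (u t \<omega>)))\<^sup>2))
            \<longlonglongrightarrow> ennreal ((norm (B (u t \<omega>)))\<^sup>2 + (norm (v t \<omega> + lam *\<^sub>R u t \<omega>))\<^sup>2)"
          by (intro tendsto_intros CS.resolvent_tendsto CS.B_in_H uV uv(2) uH t elim(3))
        then have "(\<lambda>n. ?E n \<omega>) \<longlonglongrightarrow> ennreal (pseudo_energy B lam (u t \<omega>, v t \<omega>))"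
          by (simp only: elim(1,2) comm pseudo_energy_def prod.case)
        then show ?case by (rule lim_imp_Liminf[OF sequentially_bot, symmetric])
      qed
    qed
    also have "\<dots> \<le> liminf (\<lambda>n. \<integral>\<^sup>+\<omega>. ?E n \<omega> \<partial>P)" by (rule nn_integral_liminf[OF Em])
    also have "\<dots> \<le> ennreal (pseudo_energy B lam (u0, v0) * exp (- c * t)) + I t"
      by (intro Liminf_le always_eventually allI reg t) simp
    finally show ?thesis .
  qed
  show ?thesis
    using main lam(1) unfolding I_eq by (intro exI[of _ c]) (auto simp: c_def)
qed

end
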